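(* For each $n$ let $a_n,b_n>-1$, $\beta_n>0$, and let $\lambda_1^{(n)}\le\dots\le\lambda_n^{(n)}$ be the order statistics of a random vector with the Jacobi ensemble density $$f_n(\lambda)=c_n\prod_{i<j}|\lambda_i-\lambda_j|^{\beta_n}\prod_{i=1}^n(2-\lambda_i)^{a_n}(2+\lambda_i)^{b_n}\,I_{(-2,2)}(\lambda_i)$$ ($c_n$ the normalizing constant), all defined on a common probability space, with empirical distribution function $F_n^J(\xi)=\frac1n\sum_{i=1}^nI\{\lambda_i^{(n)}\le\xi\}$. Put $\tilde a_n=(2a_n+2)/\beta_n$, $\tilde b_n=(2b_n+2)/\beta_n$. Let $(\delta_n)$, $(\varepsilon_n)$ be real sequences with $\delta_n>0$ such that $(a_n+b_n)/\log n\to\infty$ and $\delta_n^4(a_n+b_n)/\log n\to\infty$. Suppose there exist constants $a_1,a_2\in\mathbb R$, $b_1,b_2\in\mathbb R^+$ such that (i) $\lim_{n\to\infty}\frac1{\delta_n}\Big(\frac{n+\tilde b_n-1}{2n+\tilde a_n+\tilde b_n-2}-\varepsilon_n\Big)=\frac{a_1}2$; (ii) $\lim_{n\to\infty}\frac1{\delta_n}\Big(\frac{n(n+\tilde a_n-1)+(n+\tilde b_n-1)(n+\tilde a_n+\tilde b_n-2)}{(2n+\tilde a_n+\tilde b_n-2)^2}-\varepsilon_n\Big)=\frac{a_2}2$; (iii) $\lim_{n\to\infty}\frac1{\delta_n^2}\frac{(n+\tilde b_n-1)(n+\tilde a_n-1)n}{(2n+\tilde a_n+\tilde b_n-2)^3}=\frac{b_1}4$;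 (iv) $\lim_{n\to\infty}\frac1{\delta_n^2}\frac{(n+\tilde b_n-1)(n+\tilde a_n-1)(n+\tilde a_n+\tilde b_n-2)n}{(2n+\tilde a_n+\tilde b_n-2)^4}=\frac{b_2}4$. Then the empirical distribution of the scaled eigenvalues $(\lambda_i^{(n)}-2(2\varepsilon_n-1))/(2\delta_n)$, $i=1,\dots,n$, converges almost surely to a non-degenerate distribution: almost surely, for every $\xi$, $$\lim_{n\to\infty}F_n^J(2\delta_n\xi+2(2\varepsilon_n-1))=\int_{a_2-2\sqrt{b_2}}^{\xi}f^{(a_1,a_2,b_1,b_2)}(x)\,dx,$$ where $f^{(a_1,a_2,b_1,b_2)}(x)=\frac{b_1}{2\pi}\frac{\sqrt{4b_2-(x-a_2)^2}}{(b_2-b_1)x^2+(b_1a_2+b_1a_1-2b_2a_1)x+b_2a_1^2-a_1a_2b_1+b_1^2}$ if $|x-a_2|\le2\sqrt{b_2}$ and $f^{(a_1,a_2,b_1,b_2)}(x)=0$ otherwise. *)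

theory Defs
  imports "HOL-Probability.Probability"
begin

definition jacobi_weight :: "nat \<Rightarrow> real \<Rightarrow> real \<Rightarrow> real \<Rightarrow> (nat \<Rightarrow> real) \<Rightarrow> real" where
  "jacobi_weight n a b \<beta> x =
     (\<Prod>i\<in>{..<n}. \<Prod>j\<in>{i<..<n}. \<bar>x i - x j\<bar> powr \<beta>) *
     (\<Prod>i\<in>{..<n}. (2 - x i) powr a * (2 + x i) powr b * indicator {-2<..<2} (x i))"

abbreviation lebesgue_n :: "nat \<Rightarrow> (nat \<Rightarrow> real) measure" where
  "lebesgue_n n \<equiv> PiM {..<n} (\<lambda>_. lborel)"

definition jacobi_density :: "nat \<Rightarrow> real \<Rightarrow> real \<Rightarrow> real \<Rightarrow> (nat \<Rightarrow> real) \<Rightarrow> real" where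
  "jacobi_density n a b \<beta> x =
     jacobi_weight n a b \<beta> x / (\<integral>y. jacobi_weight n a b \<beta> y \<partial>lebesgue_n n)"

definition empirical_df :: "nat \<Rightarrow> (nat \<Rightarrow> real) \<Rightarrow> real \<Rightarrow> real" where
  "empirical_df n x \<xi> = real (card {i\<in>{..<n}. x i \<le> \<xi>}) / real n"

definition limit_density :: "real \<Rightarrow> real \<Rightarrow> real \<Rightarrow> real \<Rightarrow> real \<Rightarrow> real" where
  "limit_density a1 a2 b1 b2 x =
     (if \<bar>x - a2\<bar> \<le> 2 * sqrt b2 then
        b1 / (2 * pi) * sqrt (4 * b2 - (x - a2)^2) /
          ((b2 - b1) * x^2 + (b1 * a2 + b1 * a1 - 2 * b2 * a1) * x + b2 * a1^2 - a1 * a2 * b1 + b1^2)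
      else 0)"

end

theory Submission
  imports Defs
begin

text \<open>Let \<open>\<lambda>\<^sup>*\<close> maximize the density with exponents \<open>a + 1\<close>, \<open>b + 1\<close>, i.e. the Jacobi density in logistic
  coordinates \<open>t\<close>, where \<open>2 + \<lambda> = 4 / (1 + exp (- t))\<close>. There the weight is log-concave: on
  configurations ordered like \<open>\<lambda>\<^sup>*\<close>, its value at the midpoint of \<open>\<lambda>\<close> and \<open>\<lambda>\<^sup>*\<close> exceeds its value at
  \<open>\<lambda>\<close> by the factor \<open>exp (K * (\<Sum>i. (\<lambda> i - \<lambda>\<^sup>* i)\<^sup>2) / 32)\<close> or more, where
  \<open>K = a + b + 2 + \<beta> * (n - 1)\<close>. As the midpoint map costs only \<open>2 ^ n\<close> in volume and there are \<open>n!\<close>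
  orderings, the mean squared distance to \<open>\<lambda>\<^sup>*\<close> exceeds \<open>\<eta> * \<delta>\<^sup>2\<close> with probability at most
  \<open>n! * 2 ^ n * exp (- K * n * \<eta> * \<delta>\<^sup>2 / 32)\<close>; this is summable, and Borel-Cantelli applies.

  The critical equations of \<open>\<lambda>\<^sup>*\<close> give a Riccati equation for the Stieltjes transform of its empirical
  measure. In the scaling limit this becomes the quadratic equation \<open>Q * G\<^sup>2 - L * G + (1 - \<theta>) = 0\<close>,
  and \<open>Im (2 * Q * G - L) < 0\<close> selects the branch. The boundary values of the branch are the
  claimed density, whose total mass is one, so that Stieltjes inversion needs only lower bounds.\<close>

section \<open>Substitution along logistic midpoints\<close>

text \<open>Only \<open>a, b > -1\<close> is assumed, so the density need not be log-concave in
  \<open>\<lambda>\<close> itself. The Jacobian of the logistic coordinates, proportional to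
  \<open>(2 + \<lambda>) * (2 - \<lambda>)\<close>, raises both exponents by one and makes them
  positive. The convexity obtained depends on the exponents through their sum, the combination whose
  growth is prescribed. Comparing the density at a configuration with the density at its midpoint
  leaves the normalizing constant on both sides. What remains is \<open>n! * 2 ^ n\<close>, at most
  \<open>n ^ (2 * n)\<close>; it is beaten if \<open>\<delta>^2 * (a + b) / ln n\<close> is large.
  The hypothesis on \<open>\<delta>^4\<close> gives this because (iii) keeps \<open>\<delta>\<close>
  bounded. Total mass one rests on \<open>b2 \<le> b1 \<le> 2 * b2\<close> and
  \<open>(a2 - a1)^2 * b2 \<le> (2 * b2 - b1)^2\<close>. These are not among the hypotheses of the
  theorem; they are limits of inequalities between the ratios at stage \<open>n\<close>.\<close>

lemma nn_integral_PiM_substitution_le: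
  fixes S :: "'i \<Rightarrow> real \<Rightarrow> real" and g :: "'i \<Rightarrow> real \<Rightarrow> ennreal"
  assumes "finite I"
    and S[measurable]: "\<And>i. i \<in> I \<Longrightarrow> S i \<in> borel_measurable borel"
    and g[measurable]: "\<And>i. i \<in> I \<Longrightarrow> g i \<in> borel_measurable borel"
    and le: "\<And>i f. i \<in> I \<Longrightarrow> f \<in> borel_measurable borel \<Longrightarrow>
               (\<integral>\<^sup>+t. f (S i t) * g i t \<partial>lborel) \<le> (\<integral>\<^sup>+t. f t \<partial>lborel)"
    and F: "F \<in> borel_measurable (PiM I (\<lambda>_. lborel))"
  shows "(\<integral>\<^sup>+x. F (\<lambda>i\<in>I. S i (x i)) * (\<Prod>i\<in>I. g i (x i)) \<partial>PiM I (\<lambda>_. lborel))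
           \<le> (\<integral>\<^sup>+x. F x \<partial>PiM I (\<lambda>_. lborel))"
  using assms
proof (induction I arbitrary: F rule: finite_induct)
  case empty
  then show ?case by (simp add: restrict_def PiM_empty nn_integral_count_space_finite)
next
  case (insert i I)
  interpret product_sigma_finite "\<lambda>_::'i. lborel :: real measure" ..
  note [measurable] = insert.prems(1,2)
  note F[measurable] = insert.prems(4)
  have Si[measurable]: "S i \<in> borel_measurable borel" and gi[measurable]: "g i \<in> borel_measurable borel"
    using insert.prems by auto
  have SI[measurable]: "(\<lambda>x. \<lambda>i\<in>I. S i (x i)) \<in> measurable (PiM I (\<lambda>_. lborel)) (PiM I (\<lambda>_. lborel))"
  proof (rule measurable_restrict)
    fix j assume j: "j \<in> I"
    then have [measurable]: "S j \<in> borel_measurable borel" using insert.prems(1) by auto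
    show "(\<lambda>x. S j (x j)) \<in> measurable (PiM I (\<lambda>_. lborel)) lborel"
      using j by measurable
  qed
  have SII: "(\<lambda>x. \<lambda>j\<in>insert i I. S j (x j)) \<in> measurable (PiM (insert i I) (\<lambda>_. lborel)) (PiM (insert i I) (\<lambda>_. lborel))"
  proof (rule measurable_restrict)
    fix j assume j: "j \<in> insert i I"
    then have [measurable]: "S j \<in> borel_measurable borel" using insert.prems(1) by auto
    show "(\<lambda>x. S j (x j)) \<in> measurable (PiM (insert i I) (\<lambda>_. lborel)) lborel"
      using j by measurable
  qed
  have gp: "(\<lambda>x. \<Prod>j\<in>insert i I. g j (x j)) \<in> borel_measurable (PiM (insert i I) (\<lambda>_. lborel))"
    by (rule borel_measurable_prod_ennreal) (use insert.prems(2) in measurable)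
  have gpI[measurable]: "(\<lambda>x. \<Prod>j\<in>I. g j (x j)) \<in> borel_measurable (PiM I (\<lambda>_. lborel))"
    by (rule borel_measurable_prod_ennreal) (use insert.prems(2) in measurable)
  have upd: "(\<lambda>(x, y). x(i := y)) \<in> measurable (PiM I (\<lambda>_. lborel) \<Otimes>\<^sub>M lborel) (PiM (insert i I) (\<lambda>_. lborel :: real measure))"
    using measurable_add_dim[of i I "\<lambda>_. lborel :: real measure"] by (simp add: split_beta')
  have Fu[measurable]: "(\<lambda>p. F ((fst p)(i := snd p))) \<in> borel_measurable (PiM I (\<lambda>_. lborel) \<Otimes>\<^sub>M lborel)"
    using measurable_compose[OF upd F] by (simp add: split_beta')
  \<comment> \<open>\<open>F'\<close> integrates the new coordinate out. The one-dimensional bound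
    is applied to that coordinate with the others already substituted, and the induction hypothesis
    then handles \<open>F'\<close>.\<close>
  define F' where "F' = (\<lambda>x. \<integral>\<^sup>+y. F (x(i := y)) \<partial>lborel)"
  have F'[measurable]: "F' \<in> borel_measurable (PiM I (\<lambda>_. lborel))"
    unfolding F'_def using lborel.borel_measurable_nn_integral_fst[OF Fu] by simp
  have sect: "(\<lambda>y. F (x(i := y))) \<in> borel_measurable borel" if "x \<in> space (PiM I (\<lambda>_. lborel))" for x
    using measurable_Pair2[OF Fu that] by simp
  have "(\<integral>\<^sup>+x. F (\<lambda>j\<in>insert i I. S j (x j)) * (\<Prod>j\<in>insert i I. g j (x j)) \<partial>PiM (insert i I) (\<lambda>_. lborel))
      = (\<integral>\<^sup>+x. (\<integral>\<^sup>+y. F (\<lambda>j\<in>insert i I. S j ((x(i:=y)) j)) * (\<Prod>j\<in>insert i I. g j ((x(i:=y)) j)) \<partial>lborel) \<partial>PiM I (\<lambda>_. lborel))"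
    by (rule product_nn_integral_insert) (use insert gp measurable_compose[OF SII F] in auto)
  also have "\<dots> = (\<integral>\<^sup>+x. (\<integral>\<^sup>+y. (F ((\<lambda>j\<in>I. S j (x j))(i := S i y)) * g i y) * (\<Prod>j\<in>I. g j (x j)) \<partial>lborel) \<partial>PiM I (\<lambda>_. lborel))"
  proof (intro nn_integral_cong)
    fix x :: "'i \<Rightarrow> real" and y
    have "(\<lambda>j\<in>insert i I. S j ((x(i:=y)) j)) = (\<lambda>j\<in>I. S j (x j))(i := S i y)"
      using insert.hyps by (auto simp: fun_eq_iff restrict_def)
    moreover have "(\<Prod>j\<in>I. g j ((x(i:=y)) j)) = (\<Prod>j\<in>I. g j (x j))"
      using insert.hyps by (intro prod.cong) auto
    ultimately show "F (\<lambda>j\<in>insert i I. S j ((x(i:=y)) j)) * (\<Prod>j\<in>insert i I. g j ((x(i:=y)) j))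
      = (F ((\<lambda>j\<in>I. S j (x j))(i := S i y)) * g i y) * (\<Prod>j\<in>I. g j (x j))"
      using insert.hyps by (simp add: mult.assoc)
  qed
  also have "\<dots> \<le> (\<integral>\<^sup>+x. F' (\<lambda>j\<in>I. S j (x j)) * (\<Prod>j\<in>I. g j (x j)) \<partial>PiM I (\<lambda>_. lborel))"
  proof (intro nn_integral_mono)
    fix x assume x: "x \<in> space (PiM I (\<lambda>_. lborel :: real measure))"
    then have Sx: "(\<lambda>j\<in>I. S j (x j)) \<in> space (PiM I (\<lambda>_. lborel))"
      by (auto simp: space_PiM)
    note m[measurable] = sect[OF Sx]
    have m2[measurable]: "(\<lambda>y. F ((\<lambda>j\<in>I. S j (x j))(i := S i y))) \<in> borel_measurable borel"
      using measurable_compose[OF Si m] by simp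
    have "(\<integral>\<^sup>+y. (F ((\<lambda>j\<in>I. S j (x j))(i := S i y)) * g i y) * (\<Prod>j\<in>I. g j (x j)) \<partial>lborel)
      = (\<integral>\<^sup>+y. (F ((\<lambda>j\<in>I. S j (x j))(i := S i y)) * g i y) \<partial>lborel) * (\<Prod>j\<in>I. g j (x j))"
      by (rule nn_integral_multc) measurable
    also have "\<dots> \<le> F' (\<lambda>j\<in>I. S j (x j)) * (\<Prod>j\<in>I. g j (x j))"
      unfolding F'_def
      by (intro mult_right_mono insert.prems(3)[of i "\<lambda>y. F ((\<lambda>j\<in>I. S j (x j))(i := y))"] m) auto
    finally show "(\<integral>\<^sup>+y. (F ((\<lambda>j\<in>I. S j (x j))(i := S i y)) * g i y) * (\<Prod>j\<in>I. g j (x j)) \<partial>lborel)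
       \<le> F' (\<lambda>j\<in>I. S j (x j)) * (\<Prod>j\<in>I. g j (x j))" .
  qed
  also have "\<dots> \<le> (\<integral>\<^sup>+x. F' x \<partial>PiM I (\<lambda>_. lborel))"
    by (rule insert.IH) (use insert.prems F' in auto)
  also have "\<dots> = (\<integral>\<^sup>+x. F x \<partial>PiM (insert i I) (\<lambda>_. lborel))"
    unfolding F'_def by (rule product_nn_integral_insert[symmetric]) (use insert F in auto)
  finally show ?case .
qed

text \<open>Since \<open>(2 + \<lambda>) / (2 - \<lambda>) = exp t\<close>, averaging two logistic
  coordinates takes the geometric mean of these ratios; solving for \<open>\<lambda>\<close> gives
  this formula.\<close>

definition jac_mid :: "real \<Rightarrow> real \<Rightarrow> real" where
  "jac_mid m l = 2 * (sqrt ((2 + l) * (2 + m)) - sqrt ((2 - l) * (2 - m)))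
                   / (sqrt ((2 + l) * (2 + m)) + sqrt ((2 - l) * (2 - m)))"

text \<open>The Bhattacharyya coefficient (Hellinger affinity) of the two-point distributions with
  weights \<open>(2 + l) / 4, (2 - l) / 4\<close> and
  \<open>(2 + m) / 4, (2 - m) / 4\<close>.\<close>

definition jac_rho :: "real \<Rightarrow> real \<Rightarrow> real" where
  "jac_rho m l = (sqrt ((2 + l) * (2 + m)) + sqrt ((2 - l) * (2 - m))) / 4"

text \<open>The chain rule through the logistic coordinate:
  \<open>(2 + \<lambda>) * (2 - \<lambda>) / 4\<close> is the derivative of \<open>\<lambda>\<close>
  in \<open>t\<close>, and averaging contributes the factor \<open>1 / 2\<close>.\<close>

definition jac_mid_deriv :: "real \<Rightarrow> real \<Rightarrow> real" where
  "jac_mid_deriv m l = (2 + jac_mid m l) * (2 - jac_mid m l) / (2 * ((2 + l) * (2 - l)))"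

context
  fixes m l :: real
  assumes m: "-2 < m" "m < 2" and l: "-2 < l" "l < 2"
begin

lemma jac_rho_pos: "jac_rho m l > 0"
  using m l by (auto simp: jac_rho_def intro!: add_pos_pos)

text \<open>In this form the one-particle factors of the weight split exactly into values at
  \<open>l\<close> and \<open>m\<close> and a power of \<open>jac_rho\<close>.\<close>

lemma jac_mid_plus: "2 + jac_mid m l = sqrt ((2 + l) * (2 + m)) / jac_rho m l"
  and jac_mid_minus: "2 - jac_mid m l = sqrt ((2 - l) * (2 - m)) / jac_rho m l"
proof -
  have *: "sqrt ((2 + l) * (2 + m)) + sqrt ((2 - l) * (2 - m)) > 0"
    using m l by (auto intro!: add_pos_pos)
  show "2 + jac_mid m l = sqrt ((2 + l) * (2 + m)) / jac_rho m l"
       "2 - jac_mid m l = sqrt ((2 - l) * (2 - m)) / jac_rho m l"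
    using * unfolding jac_mid_def jac_rho_def by (simp_all add: field_simps)
qed

lemma jac_mid_gt: "-2 < jac_mid m l" and jac_mid_lt: "jac_mid m l < 2"
proof -
  have "2 + jac_mid m l > 0" "2 - jac_mid m l > 0"
    unfolding jac_mid_plus jac_mid_minus using m l jac_rho_pos by (auto intro!: divide_pos_pos mult_pos_pos)
  then show "-2 < jac_mid m l" "jac_mid m l < 2" by auto
qed

lemma jac_mid_deriv_nonneg: "jac_mid_deriv m l \<ge> 0"
  using m l jac_mid_gt jac_mid_lt by (auto simp: jac_mid_deriv_def intro!: divide_nonneg_nonneg mult_nonneg_nonneg)

lemma jac_mid_has_derivative: "(jac_mid m has_real_derivative jac_mid_deriv m l) (at l)"
proof -
  define P where "P = sqrt (2 + l)" define Q where "Q = sqrt (2 - l)"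
  define p where "p = sqrt (2 + m)" define q where "q = sqrt (2 - m)"
  have pos: "P > 0" "Q > 0" "p > 0" "q > 0" using m l by (auto simp: P_def Q_def p_def q_def)
  have sq: "P * P = 2 + l" "Q * Q = 2 - l" using m l by (auto simp: P_def Q_def p_def q_def)
  have PQ: "P * P + Q * Q = 4" using sq by simp
  have nz: "P * p + Q * q \<noteq> 0" using pos by (metis add_pos_pos less_irrefl mult_pos_pos)
  have mid: "jac_mid m l = 2 * (P * p - Q * q) / (P * p + Q * q)"
    by (simp add: jac_mid_def P_def Q_def p_def q_def real_sqrt_mult)
  have e1: "2 + jac_mid m l = 4 * (P * p) / (P * p + Q * q)" and e2: "2 - jac_mid m l = 4 * (Q * q) / (P * p + Q * q)"
    unfolding mid using nz by (auto simp: field_simps)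
  have "jac_mid m = (\<lambda>l. 2 * (sqrt (2 + l) * p - sqrt (2 - l) * q) / (sqrt (2 + l) * p + sqrt (2 - l) * q))"
    by (simp add: jac_mid_def fun_eq_iff p_def q_def real_sqrt_mult)
  moreover have "((\<lambda>l. 2 * (sqrt (2 + l) * p - sqrt (2 - l) * q) / (sqrt (2 + l) * p + sqrt (2 - l) * q))
     has_real_derivative (2 * ((inverse P / 2) * p + (inverse Q / 2) * q) * (P * p + Q * q)
       - 2 * (P * p - Q * q) * ((inverse P / 2) * p - (inverse Q / 2) * q)) / ((P * p + Q * q) * (P * p + Q * q))) (at l)"
    using m l nz
    by (auto intro!: derivative_eq_intros simp: P_def Q_def)
  moreover have "(2 * ((inverse P / 2) * p + (inverse Q / 2) * q) * (P * p + Q * q)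
       - 2 * (P * p - Q * q) * ((inverse P / 2) * p - (inverse Q / 2) * q)) / ((P * p + Q * q) * (P * p + Q * q))
     = jac_mid_deriv m l"
  proof -
    have 1: "2 * ((inverse P / 2) * p + (inverse Q / 2) * q) * (P * p + Q * q)
       - 2 * (P * p - Q * q) * ((inverse P / 2) * p - (inverse Q / 2) * q) = 2 * p * q * (P * P + Q * Q) / (P * Q)"
      using pos by (simp add: field_simps)
    show ?thesis
      unfolding 1 jac_mid_deriv_def e1 e2 PQ sq[symmetric] using pos nz
      by (simp add: divide_simps)
  qed
  ultimately show ?thesis by simp
qed

text \<open>The Hellinger-type inequality that turns the convexity gap into a squared distance.\<close>
lemma ln_jac_rho_le: "2 * ln (jac_rho m l) \<le> - ((l - m)^2 / 32)"
proof -
  define P where "P = sqrt (2 + l)" define Q where "Q = sqrt (2 - l)"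
  define p where "p = sqrt (2 + m)" define q where "q = sqrt (2 - m)"
  have pos: "P > 0" "Q > 0" "p > 0" "q > 0" using m l by (auto simp: P_def Q_def p_def q_def)
  have sq: "P^2 = 2 + l" "Q^2 = 2 - l" "p^2 = 2 + m" "q^2 = 2 - m"
     using m l by (auto simp: P_def Q_def p_def q_def)
  have r: "jac_rho m l = (P * p + Q * q) / 4"
    by (simp add: jac_rho_def P_def Q_def p_def q_def real_sqrt_mult)
  have "2 * ln (jac_rho m l) \<le> 2 * (jac_rho m l - 1)"
    using ln_le_minus_one[OF jac_rho_pos] by simp
  also have "\<dots> = - (((P - p)^2 + (Q - q)^2) / 4)"
  proof -
    have "(P - p)^2 + (Q - q)^2 = 8 - 2 * (P * p + Q * q)"
      using sq by (simp add: power2_diff algebra_simps)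
    then show ?thesis by (simp add: r field_simps)
  qed
  \<comment> \<open>All four roots are at most 2, so each of the two squares is at least
    \<open>(l - m)^2 / 16\<close>. Their sum divided by 4 yields the constant 32.\<close>
  also have "\<dots> \<le> - ((l - m)^2 / 32)"
  proof -
    have b: "P \<le> 2" "p \<le> 2" "Q \<le> 2" "q \<le> 2"
      using m l by (auto simp: P_def Q_def p_def q_def intro!: real_le_lsqrt)
    have "l - m = (P - p) * (P + p)" using sq by (simp add: power2_eq_square algebra_simps)
    then have "(l - m)^2 = (P - p)^2 * (P + p)^2" by (simp add: power_mult_distrib)
    also have "\<dots> \<le> (P - p)^2 * 4^2"
      using b pos by (intro mult_left_mono power_mono) auto
    finally have 1: "(l - m)^2 \<le> 16 * (P - p)^2" by simp
    have "l - m = (q - Q) * (q + Q)" using sq by (simp add: power2_eq_square algebra_simps)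
    then have "(l - m)^2 = (q - Q)^2 * (q + Q)^2" by (simp add: power_mult_distrib)
    also have "\<dots> \<le> (q - Q)^2 * 4^2"
      using b pos by (intro mult_left_mono power_mono) auto
    finally have 2: "(l - m)^2 \<le> 16 * (Q - q)^2" by (simp add: power2_commute)
    show ?thesis using 1 2 by simp
  qed
  finally show ?thesis .
qed

end

text \<open>AM-GM after squaring out.\<close>
lemma jac_mid_diff_ge:
  assumes "-2 < m" "m < 2" "-2 < l" "l < 2" "-2 < m'" "m' < 2" "-2 < l'" "l' < 2"
  shows "(l - l') * (m - m') \<le> (jac_mid m l - jac_mid m' l')^2 * (jac_rho m l * jac_rho m' l')^2"
proof -
  define p where "p = sqrt ((2 + l) * (2 + m))" define q where "q = sqrt ((2 - l) * (2 - m))"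
  define p' where "p' = sqrt ((2 + l') * (2 + m'))" define q' where "q' = sqrt ((2 - l') * (2 - m'))"
  have r: "jac_rho m l > 0" "jac_rho m' l' > 0" using assms jac_rho_pos by auto
  have pr: "jac_rho m l = (p + q) / 4" "jac_rho m' l' = (p' + q') / 4" by (auto simp: jac_rho_def p_def q_def p'_def q'_def)
  have mid: "jac_mid m l = 2 * (p - q) / (p + q)" "jac_mid m' l' = 2 * (p' - q') / (p' + q')"
    by (auto simp: jac_mid_def p_def q_def p'_def q'_def)
  have nz: "p + q \<noteq> 0" "p' + q' \<noteq> 0" using r unfolding pr by auto
  \<comment> \<open>Multiplying by the two \<open>jac_rho\<close> clears both denominators, and the
    terms \<open>p * p'\<close> and \<open>q * q'\<close> cancel.\<close>
  have "(jac_mid m l - jac_mid m' l') * (jac_rho m l * jac_rho m' l') = (p * q' - q * p') / 4"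
  proof -
    define D where "D = p + q" define D' where "D' = p' + q'"
    have "2 * (p - q) * D' - 2 * (p' - q') * D = 4 * (p * q' - q * p')"
      by (simp add: D_def D'_def algebra_simps)
    moreover have "(2 * (p - q) / D - 2 * (p' - q') / D') * (D / 4 * (D' / 4)) = (2 * (p - q) * D' - 2 * (p' - q') * D) / 16"
      using nz unfolding D_def[symmetric] D'_def[symmetric] by (simp add: field_simps)
    ultimately show ?thesis unfolding mid pr D_def[symmetric] D'_def[symmetric] by simp
  qed
  then have "(jac_mid m l - jac_mid m' l')^2 * (jac_rho m l * jac_rho m' l')^2 = ((p * q' - q * p') / 4)^2"
    by (metis power_mult_distrib)
  moreover have "16 * ((l - l') * (m - m')) \<le> (p * q' - q * p')^2"
  proof -
    define \<alpha> where "\<alpha> = (2 + l) * (2 - l')" define c where "c = (2 + m) * (2 - m')"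
    define \<gamma> where "\<gamma> = (2 - l) * (2 + l')" define d where "d = (2 - m) * (2 + m')"
    have nn: "\<alpha> \<ge> 0" "c \<ge> 0" "\<gamma> \<ge> 0" "d \<ge> 0" using assms by (auto simp: \<alpha>_def c_def \<gamma>_def d_def)
    have "p * q' = sqrt (\<alpha> * c)" "q * p' = sqrt (\<gamma> * d)"
      by (simp_all add: p_def q'_def q_def p'_def \<alpha>_def c_def \<gamma>_def d_def real_sqrt_mult[symmetric] algebra_simps)
    \<comment> \<open>The mixed root of \<open>\<alpha> * c * \<gamma> * d\<close> is regrouped as
      \<open>sqrt (\<alpha> * d) * sqrt (\<gamma> * c)\<close>. AM-GM then produces exactly the
      terms missing from \<open>(\<alpha> - \<gamma>) * (c - d)\<close>.\<close>
    then have sqq: "(p * q' - q * p')^2 = \<alpha> * c + \<gamma> * d - 2 * (sqrt (\<alpha> * d) * sqrt (\<gamma> * c))"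
      using nn by (simp add: power2_diff) (simp add: real_sqrt_mult)
    have "2 * (sqrt (\<alpha> * d) * sqrt (\<gamma> * c)) \<le> (sqrt (\<alpha> * d))^2 + (sqrt (\<gamma> * c))^2"
      using sum_squares_bound[of "sqrt (\<alpha> * d)" "sqrt (\<gamma> * c)"] by simp
    also have "\<dots> = \<alpha> * d + \<gamma> * c" using nn by simp
    finally have "(\<alpha> - \<gamma>) * (c - d) \<le> (p * q' - q * p')^2" unfolding sqq by (simp add: algebra_simps)
    moreover have "\<alpha> - \<gamma> = 4 * (l - l')" "c - d = 4 * (m - m')"
      by (simp_all add: \<alpha>_def c_def \<gamma>_def d_def algebra_simps)
    ultimately show ?thesis by (simp add: algebra_simps)
  qed
  ultimately show ?thesis by (simp add: power_divide)
qed

section \<open>Change of variables along the midpoint map in one coordinate\<close>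

lemma borel_measurable_jac_mid[measurable]: "jac_mid m \<in> borel_measurable borel"
  unfolding jac_mid_def by measurable

lemma borel_measurable_jac_mid_deriv[measurable]: "jac_mid_deriv m \<in> borel_measurable borel"
  unfolding jac_mid_deriv_def by measurable

text \<open>The derivative is singular at the endpoints, so the substitution rule is applied on
  compact intervals exhausting \<open>(-2, 2)\<close>. An inequality results because the part of
  \<open>f\<close> outside the image is dropped.\<close>

lemma nn_integral_jac_mid_le:
  assumes m: "-2 < m" "m < 2" and f[measurable]: "f \<in> borel_measurable borel"
  shows "(\<integral>\<^sup>+t. f (jac_mid m t) * (ennreal (jac_mid_deriv m t) * indicator {-2<..<2} t) \<partial>lborel) \<le> (\<integral>\<^sup>+t. f t \<partial>lborel)"
proof -
  define A :: "nat \<Rightarrow> real set" where "A k = {-2 + 1 / (real k + 1) .. 2 - 1 / (real k + 1)}" for k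
  have inv: "1 / (real k + 1) \<le> 1" "1 / (real k + 1) > 0" for k by auto
  define h where "h = (\<lambda>t. f (jac_mid m t) * ennreal (jac_mid_deriv m t))"
  have h[measurable]: "h \<in> borel_measurable borel" unfolding h_def by measurable
  have le: "(\<integral>\<^sup>+t. h t * indicator (A k) t \<partial>lborel) \<le> (\<integral>\<^sup>+t. f t \<partial>lborel)" for k
  proof -
    define a where "a = -2 + 1 / (real k + 1)" define b where "b = 2 - 1 / (real k + 1)"
    have ab: "-2 < a" "b < 2" "a < b" using inv[of k] unfolding a_def b_def by linarith+
    have cont: "continuous_on {a..b} (jac_mid_deriv m)"
    proof -
      have "continuous_on {a..b} (jac_mid m)"
        by (rule has_real_derivative_imp_continuous_on) (use m ab in \<open>auto intro!: jac_mid_has_derivative\<close>)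
      then show ?thesis
        unfolding jac_mid_deriv_def[abs_def] using ab by (auto intro!: continuous_intros)
    qed
    have "(\<integral>\<^sup>+t. h t * indicator (A k) t \<partial>lborel) = (\<integral>\<^sup>+t. f (jac_mid m t) * ennreal (jac_mid_deriv m t) * indicator {a..b} t \<partial>lborel)"
      by (simp add: h_def A_def a_def b_def)
    also have "\<dots> = (\<integral>\<^sup>+t. f t * indicator {jac_mid m a..jac_mid m b} t \<partial>lborel)"
      by (rule nn_integral_substitution_aux[symmetric])
         (use f cont ab m in \<open>auto intro!: jac_mid_has_derivative jac_mid_deriv_nonneg\<close>)
    also have "\<dots> \<le> (\<integral>\<^sup>+t. f t \<partial>lborel)"
      by (intro nn_integral_mono) (auto split: split_indicator)
    finally show ?thesis .
  qed
  have inc: "incseq A"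
  proof (rule incseq_SucI)
    fix k
    have "1 / (real (Suc k) + 1) \<le> 1 / (real k + 1)" by (intro divide_left_mono) auto
    then show "A k \<subseteq> A (Suc k)" by (auto simp: A_def)
  qed
  have un: "(\<Union>k. A k) = {-2<..<2}"
  proof (intro set_eqI iffI)
    fix t assume "t \<in> (\<Union>k. A k)"
    then obtain k where "t \<in> A k" by auto
    then show "t \<in> {-2<..<2}" using inv[of k] unfolding A_def atLeastAtMost_iff greaterThanLessThan_iff by linarith
  next
    fix t :: real assume "t \<in> {-2<..<2}"
    then have "min (t + 2) (2 - t) > 0" by auto
    then obtain k where "inverse (real (Suc k)) < min (t + 2) (2 - t)" using reals_Archimedean by blast
    then have "t \<in> A k" by (auto simp: A_def inverse_eq_divide add.commute)
    then show "t \<in> (\<Union>k. A k)" by blast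
  qed
  have "(\<integral>\<^sup>+t. h t * indicator {-2<..<2} t \<partial>lborel) = emeasure (density lborel h) (\<Union>k. A k)"
    unfolding un by (rule emeasure_density[symmetric]) auto
  also have "\<dots> = (SUP k. emeasure (density lborel h) (A k))"
    by (rule SUP_emeasure_incseq[symmetric]) (use inc in \<open>auto simp: A_def[abs_def]\<close>)
  also have "\<dots> \<le> (\<integral>\<^sup>+t. f t \<partial>lborel)"
    by (rule SUP_least) (use le in \<open>auto simp: emeasure_density A_def\<close>)
  finally show ?thesis by (simp add: h_def mult.assoc)
qed

text \<open>Running over ordered pairs with exponent \<open>\<beta> / 2\<close> makes the symmetry a mere reindexing.\<close>
definition sym_weight :: "nat \<Rightarrow> real \<Rightarrow> real \<Rightarrow> real \<Rightarrow> (nat \<Rightarrow> real) \<Rightarrow> real" where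
  "sym_weight n A B \<beta> x =
     (\<Prod>i<n. \<Prod>j\<in>{..<n}-{i}. \<bar>x i - x j\<bar> powr (\<beta> / 2)) * (\<Prod>i<n. (2 - x i) powr A * (2 + x i) powr B)"

lemma prod_pairs_square:
  fixes g :: "nat \<Rightarrow> nat \<Rightarrow> 'a :: comm_monoid_mult"
  assumes "\<And>i j. g i j = g j i"
  shows "(\<Prod>i<n. \<Prod>j\<in>{..<n}-{i}. g i j) = (\<Prod>i<n. \<Prod>j\<in>{i<..<n}. g i j * g i j)"
proof -
  have split: "(\<Prod>j\<in>{..<n}-{i}. g i j) = (\<Prod>j\<in>{i<..<n}. g i j) * (\<Prod>j\<in>{..<i}. g i j)" if "i < n" for i
  proof -
    have "{..<n}-{i} = {i<..<n} \<union> {..<i}" using that by auto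
    show ?thesis unfolding \<open>{..<n}-{i} = {i<..<n} \<union> {..<i}\<close> by (rule prod.union_disjoint) auto
  qed
  have "(\<Prod>i<n. \<Prod>j\<in>{..<n}-{i}. g i j) = (\<Prod>i<n. \<Prod>j\<in>{i<..<n}. g i j) * (\<Prod>i<n. \<Prod>j\<in>{..<i}. g i j)"
    by (simp add: split prod.distrib)
  also have "(\<Prod>i<n. \<Prod>j\<in>{..<i}. g i j) = (\<Prod>(i, j)\<in>(SIGMA i:{..<n}. {..<i}). g i j)"
    by (rule prod.Sigma) auto
  also have "\<dots> = (\<Prod>(j, i)\<in>(SIGMA j:{..<n}. {j<..<n}). g i j)"
    by (rule prod.reindex_bij_witness[of _ prod.swap prod.swap]) auto
  also have "\<dots> = (\<Prod>j<n. \<Prod>i\<in>{j<..<n}. g i j)"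
    by (rule prod.Sigma[symmetric]) auto
  also have "\<dots> = (\<Prod>i<n. \<Prod>j\<in>{i<..<n}. g i j)" using assms by simp
  finally show ?thesis by (simp add: prod.distrib)
qed

lemma sym_weight_permute:
  assumes "\<sigma> permutes {..<n}"
  shows "sym_weight n A B \<beta> (\<lambda>i. x (\<sigma> i)) = sym_weight n A B \<beta> x"
proof -
  have bij: "bij_betw \<sigma> {..<n} {..<n}" using assms by (rule permutes_imp_bij)
  have 1: "(\<Prod>i<n. h (\<sigma> i)) = (\<Prod>i<n. h i)" for h :: "nat \<Rightarrow> real"
    using prod.reindex_bij_betw[OF bij] .
  have "(\<Prod>i<n. \<Prod>j\<in>{..<n}-{i}. \<bar>x (\<sigma> i) - x (\<sigma> j)\<bar> powr (\<beta> / 2)) = (\<Prod>i<n. \<Prod>j\<in>{..<n}-{\<sigma> i}. \<bar>x (\<sigma> i) - x j\<bar> powr (\<beta> / 2))"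
  proof (rule prod.cong[OF refl])
    fix i assume "i \<in> {..<n}"
    then have "bij_betw \<sigma> ({..<n}-{i}) ({..<n}-{\<sigma> i})" using bij by (auto simp: bij_betw_def inj_on_def)
    then show "(\<Prod>j\<in>{..<n}-{i}. \<bar>x (\<sigma> i) - x (\<sigma> j)\<bar> powr (\<beta> / 2)) = (\<Prod>j\<in>{..<n}-{\<sigma> i}. \<bar>x (\<sigma> i) - x j\<bar> powr (\<beta> / 2))"
      by (rule prod.reindex_bij_betw)
  qed
  also have "\<dots> = (\<Prod>i<n. \<Prod>j\<in>{..<n}-{i}. \<bar>x i - x j\<bar> powr (\<beta> / 2))"
    using 1[of "\<lambda>i. \<Prod>j\<in>{..<n}-{i}. \<bar>x i - x j\<bar> powr (\<beta> / 2)"] .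
  finally show ?thesis
    unfolding sym_weight_def using 1[of "\<lambda>i. (2 - x i) powr A * (2 + x i) powr B"] by simp
qed

lemma sym_weight_nonneg: "sym_weight n A B \<beta> x \<ge> 0"
  by (auto simp: sym_weight_def intro!: mult_nonneg_nonneg prod_nonneg)

lemma powr_power2: "(u powr p)^2 = u powr (2 * p)" for u p :: real
  by (simp add: power2_eq_square flip: powr_add)

text \<open>Midpoint log-concavity in logistic coordinates.\<close>
lemma sym_weight_mid_ge:
  assumes x: "\<And>i. i < n \<Longrightarrow> x i \<in> {-2<..<2}" and m: "\<And>i. i < n \<Longrightarrow> m i \<in> {-2<..<2}"
    and ord: "\<And>i j. i < n \<Longrightarrow> j < n \<Longrightarrow> (x i - x j) * (m i - m j) \<ge> 0" and "\<beta> > 0" "A > 0" "B > 0"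
  shows "sym_weight n A B \<beta> x * sym_weight n A B \<beta> m
     \<le> (sym_weight n A B \<beta> (\<lambda>i. jac_mid (m i) (x i)))^2 * (\<Prod>i<n. jac_rho (m i) (x i) powr (2 * (A + B + \<beta> * (real n - 1))))"
proof -
  define r where "r i = jac_rho (m i) (x i)" for i
  define S where "S i = jac_mid (m i) (x i)" for i
  have r: "r i > 0" if "i < n" for i using x[OF that] m[OF that] jac_rho_pos by (auto simp: r_def)
  \<comment> \<open>No loss occurs here: the one-particle factors are log-linear in
    \<open>2 + \<lambda>\<close> and \<open>2 - \<lambda>\<close>, and all convexity shows up in
    \<open>r i\<close>.\<close>
  have one: "((2 - x i) powr A * (2 + x i) powr B) * ((2 - m i) powr A * (2 + m i) powr B)
     = ((2 - S i) powr A * (2 + S i) powr B)^2 * r i powr (2 * (A + B))" if "i < n" for i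
  proof -
    have i: "-2 < m i" "m i < 2" "-2 < x i" "x i < 2" using x[OF that] m[OF that] by auto
    have 1: "2 + S i = sqrt ((2 + x i) * (2 + m i)) / r i" "2 - S i = sqrt ((2 - x i) * (2 - m i)) / r i"
      unfolding S_def r_def using jac_mid_plus[OF i] jac_mid_minus[OF i] by auto
    have sq: "(u powr p)^2 = (u^2) powr p" if "u > 0" for u p :: real
      using that by (simp add: power2_eq_square powr_mult)
    have r2: "((r i)^2) powr q = r i powr (2 * q)" for q
      using sq[OF r[OF that], of q] by (simp add: powr_power2)
    have "((2 - S i) powr A)^2 = ((2 - x i) * (2 - m i) / (r i)^2) powr A"
      using i r[OF that] by (subst sq) (auto simp: 1 power_divide)
    also have "\<dots> = (2 - x i) powr A * (2 - m i) powr A / (r i powr (2 * A))"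
      using i r[OF that] by (simp add: powr_divide powr_mult r2)
    finally have 2: "((2 - S i) powr A)^2 = (2 - x i) powr A * (2 - m i) powr A / (r i powr (2 * A))" .
    have "((2 + S i) powr B)^2 = ((2 + x i) * (2 + m i) / (r i)^2) powr B"
      using i r[OF that] by (subst sq) (auto simp: 1 power_divide)
    also have "\<dots> = (2 + x i) powr B * (2 + m i) powr B / (r i powr (2 * B))"
      using i r[OF that] by (simp add: powr_divide powr_mult r2)
    finally have 3: "((2 + S i) powr B)^2 = (2 + x i) powr B * (2 + m i) powr B / (r i powr (2 * B))" .
    show ?thesis
      unfolding power_mult_distrib 2 3 using r[OF that] by (simp add: powr_add ring_distribs)
  qed
  \<comment> \<open>The common ordering makes
    \<open>\<bar>x i - x j\<bar> * \<bar>m i - m j\<bar>\<close> equal to the signed product, which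
    \<open>jac_mid_diff_ge\<close> bounds.\<close>
  have two: "(\<bar>x i - x j\<bar> powr (\<beta> / 2)) * (\<bar>m i - m j\<bar> powr (\<beta> / 2))
      \<le> (\<bar>S i - S j\<bar> powr (\<beta> / 2))^2 * ((r i powr \<beta>) * (r j powr \<beta>))" if "i < n" "j < n" for i j
  proof -
    have "\<bar>x i - x j\<bar> * \<bar>m i - m j\<bar> = (x i - x j) * (m i - m j)"
      using ord[OF that] by (simp flip: abs_mult)
    also have "\<dots> \<le> (S i - S j)^2 * (r i * r j)^2"
      unfolding S_def r_def by (rule jac_mid_diff_ge) (use x[OF that(1)] m[OF that(1)] x[OF that(2)] m[OF that(2)] in auto)
    also have "\<dots> = (\<bar>S i - S j\<bar> * (r i * r j)) ^ 2" by (simp add: power_mult_distrib)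
    finally have "(\<bar>x i - x j\<bar> * \<bar>m i - m j\<bar>) powr (\<beta> / 2) \<le> ((\<bar>S i - S j\<bar> * (r i * r j)) ^ 2) powr (\<beta> / 2)"
      using \<open>\<beta> > 0\<close> by (intro powr_mono2) auto
    also have "\<dots> = (\<bar>S i - S j\<bar> powr (\<beta> / 2))^2 * ((r i * r j) powr (\<beta>/2))^2"
      using r[OF that(1)] r[OF that(2)] by (simp add: powr_mult power2_eq_square)
    also have "((r i * r j) powr (\<beta>/2))^2 = r i powr \<beta> * r j powr \<beta>"
      using r[OF that(1)] r[OF that(2)] by (simp add: powr_mult power_mult_distrib powr_power2)
    finally show ?thesis by (simp add: powr_mult)
  qed
  \<comment> \<open>Each index occurs \<open>n - 1\<close> times in the first and
    \<open>n - 1\<close> times in the second place of an ordered pair, whence the exponent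
    \<open>2 * \<beta> * (n - 1)\<close>.\<close>
  have pairs: "(\<Prod>i<n. \<Prod>j\<in>{..<n}-{i}. (r i powr \<beta>) * (r j powr \<beta>)) = (\<Prod>i<n. r i powr (2 * (\<beta> * (real n - 1))))"
  proof -
    define g where "g i = r i powr \<beta>" for i
    have "(\<Prod>i<n. \<Prod>j\<in>{..<n}-{i}. g j) = (\<Prod>(i, j)\<in>(SIGMA i:{..<n}. {..<n}-{i}). g j)"
      by (rule prod.Sigma) auto
    also have "\<dots> = (\<Prod>(i, j)\<in>(SIGMA i:{..<n}. {..<n}-{i}). g i)"
      by (rule prod.reindex_bij_witness[of _ prod.swap prod.swap]) auto
    also have "\<dots> = (\<Prod>i<n. \<Prod>j\<in>{..<n}-{i}. g i)"
      by (rule prod.Sigma[symmetric]) auto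
    finally have 1: "(\<Prod>i<n. \<Prod>j\<in>{..<n}-{i}. g j) = (\<Prod>i<n. \<Prod>j\<in>{..<n}-{i}. g i)" .
    have 2: "(\<Prod>i<n. \<Prod>j\<in>{..<n}-{i}. g i) = (\<Prod>i<n. r i powr (\<beta> * (real n - 1)))"
    proof (rule prod.cong[OF refl])
      fix i assume "i \<in> {..<n}"
      then have i: "i < n" "r i > 0" using r by auto
      have "(\<Prod>j\<in>{..<n}-{i}. g i) = (r i powr \<beta>) ^ (n - 1)" using i by (simp add: g_def)
      also have "\<dots> = r i powr (\<beta> * (real n - 1))"
        using i by (simp add: powr_powr of_nat_diff flip: powr_realpow)
      finally show "(\<Prod>j\<in>{..<n}-{i}. g i) = r i powr (\<beta> * (real n - 1))" .
    qed
    have "(\<Prod>i<n. \<Prod>j\<in>{..<n}-{i}. g i * g j) = (\<Prod>i<n. r i powr (\<beta> * (real n - 1))) * (\<Prod>i<n. r i powr (\<beta> * (real n - 1)))"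
      unfolding prod.distrib 1 2 ..
    also have "\<dots> = (\<Prod>i<n. r i powr (2 * (\<beta> * (real n - 1))))"
      unfolding prod.distrib[symmetric] powr_add[symmetric] mult_2 ..
    finally show ?thesis unfolding g_def .
  qed
  have "(\<Prod>i<n. \<Prod>j\<in>{..<n}-{i}. \<bar>x i - x j\<bar> powr (\<beta> / 2)) * (\<Prod>i<n. \<Prod>j\<in>{..<n}-{i}. \<bar>m i - m j\<bar> powr (\<beta> / 2))
     = (\<Prod>i<n. \<Prod>j\<in>{..<n}-{i}. \<bar>x i - x j\<bar> powr (\<beta> / 2) * \<bar>m i - m j\<bar> powr (\<beta> / 2))"
    by (simp add: prod.distrib)
  also have "\<dots> \<le> (\<Prod>i<n. \<Prod>j\<in>{..<n}-{i}. (\<bar>S i - S j\<bar> powr (\<beta> / 2))^2 * ((r i powr \<beta>) * (r j powr \<beta>)))"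
    by (intro prod_mono conjI prod_nonneg two) auto
  also have "\<dots> = (\<Prod>i<n. \<Prod>j\<in>{..<n}-{i}. \<bar>S i - S j\<bar> powr (\<beta> / 2))^2 * (\<Prod>i<n. r i powr (2 * (\<beta> * (real n - 1))))"
    by (simp only: prod.distrib prod_power_distrib flip: pairs)
  finally have P: "(\<Prod>i<n. \<Prod>j\<in>{..<n}-{i}. \<bar>x i - x j\<bar> powr (\<beta> / 2)) * (\<Prod>i<n. \<Prod>j\<in>{..<n}-{i}. \<bar>m i - m j\<bar> powr (\<beta> / 2))
    \<le> (\<Prod>i<n. \<Prod>j\<in>{..<n}-{i}. \<bar>S i - S j\<bar> powr (\<beta> / 2))^2 * (\<Prod>i<n. r i powr (2 * (\<beta> * (real n - 1))))" .
  have W: "(\<Prod>i<n. (2 - x i) powr A * (2 + x i) powr B) * (\<Prod>i<n. (2 - m i) powr A * (2 + m i) powr B)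
    = (\<Prod>i<n. (2 - S i) powr A * (2 + S i) powr B)^2 * (\<Prod>i<n. r i powr (2 * (A + B)))"
    unfolding prod_power_distrib prod.distrib[symmetric] by (rule prod.cong) (use one in auto)
  define px where "px = (\<Prod>i<n. \<Prod>j\<in>{..<n}-{i}. \<bar>x i - x j\<bar> powr (\<beta> / 2))"
  define pm where "pm = (\<Prod>i<n. \<Prod>j\<in>{..<n}-{i}. \<bar>m i - m j\<bar> powr (\<beta> / 2))"
  define pS where "pS = (\<Prod>i<n. \<Prod>j\<in>{..<n}-{i}. \<bar>S i - S j\<bar> powr (\<beta> / 2))"
  define wx where "wx = (\<Prod>i<n. (2 - x i) powr A * (2 + x i) powr B)"
  define wm where "wm = (\<Prod>i<n. (2 - m i) powr A * (2 + m i) powr B)"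
  define wS where "wS = (\<Prod>i<n. (2 - S i) powr A * (2 + S i) powr B)"
  define R where "R = (\<Prod>i<n. r i powr (2 * (\<beta> * (real n - 1))))"
  define R' where "R' = (\<Prod>i<n. r i powr (2 * (A + B)))"
  have R: "R * R' = (\<Prod>i<n. r i powr (2 * (A + B + \<beta> * (real n - 1))))"
    unfolding R_def R'_def prod.distrib[symmetric] powr_add[symmetric]
    by (simp add: distrib_left add.commute)
  have "wS \<ge> 0" "R' \<ge> 0" by (auto simp: wS_def R'_def intro!: mult_nonneg_nonneg prod_nonneg)
  then have "(px * pm) * (wx * wm) \<le> (pS^2 * R) * (wS^2 * R')"
    using P W unfolding px_def[symmetric] pm_def[symmetric] pS_def[symmetric] wx_def[symmetric] wm_def[symmetric]
      wS_def[symmetric] R_def[symmetric] R'_def[symmetric] by (simp add: mult_right_mono)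
  moreover have "sym_weight n A B \<beta> x = px * wx" "sym_weight n A B \<beta> m = pm * wm"
    "sym_weight n A B \<beta> S = pS * wS"
    by (simp_all only: sym_weight_def px_def pm_def pS_def wx_def wm_def wS_def)
  ultimately show ?thesis
    unfolding S_def[symmetric, abs_def] r_def[symmetric] R[symmetric] by (simp add: power_mult_distrib mult_ac)
qed

section \<open>The maximizer of the weight\<close>

lemma sym_weight_cong: "(\<And>i. i < n \<Longrightarrow> x i = y i) \<Longrightarrow> sym_weight n A B \<beta> x = sym_weight n A B \<beta> y"
  unfolding sym_weight_def by (intro arg_cong2[of _ _ _ _ "(*)"] prod.cong) auto

text \<open>Positive exponents make the weight vanish at collisions and on the boundary of the cube.
  This is what forces a maximizer over the closed cube to have distinct interior
  coordinates.\<close>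

lemma sym_weight_pos_iff:
  assumes "\<And>i. i < n \<Longrightarrow> x i \<in> {-2..2}" "A > 0" "B > 0" "\<beta> > 0"
  shows "sym_weight n A B \<beta> x > 0 \<longleftrightarrow> inj_on x {..<n} \<and> (\<forall>i<n. x i \<in> {-2<..<2})"
proof -
  have "sym_weight n A B \<beta> x > 0 \<longleftrightarrow> sym_weight n A B \<beta> x \<noteq> 0"
    using sym_weight_nonneg[of n A B \<beta> x] by linarith
  also have "\<dots> \<longleftrightarrow> inj_on x {..<n} \<and> (\<forall>i<n. x i \<noteq> 2 \<and> 2 + x i \<noteq> 0)"
    unfolding sym_weight_def inj_on_def by (auto simp: prod_zero_iff)
  also have "\<dots> \<longleftrightarrow> inj_on x {..<n} \<and> (\<forall>i<n. x i \<in> {-2<..<2})"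
  proof -
    have "x i \<noteq> 2 \<and> 2 + x i \<noteq> 0 \<longleftrightarrow> x i \<in> {-2<..<2}" if "i < n" for i
      using assms(1)[OF that] by auto
    then show ?thesis by blast
  qed
  finally show ?thesis .
qed

lemma continuous_on_sym_weight:
  assumes "A > 0" "B > 0" "\<beta> > 0"
  shows "continuous_on (PiE UNIV (\<lambda>_. {-2..2})) (sym_weight n A B \<beta>)"
proof -
  have *: "continuous_on S (\<lambda>x. f x powr p)"
    if "continuous_on S f" "p > 0" "\<And>x. x \<in> S \<Longrightarrow> f x \<ge> 0" for S and f :: "(nat \<Rightarrow> real) \<Rightarrow> real" and p
    using that by (intro continuous_on_powr' continuous_on_const) auto
  have bnd: "0 \<le> 2 - x i" "0 \<le> 2 + x i" if "x \<in> PiE UNIV (\<lambda>_. {-2..2})" for x :: "nat \<Rightarrow> real" and i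
    using PiE_mem[OF that, of i] by auto
  show ?thesis
    unfolding sym_weight_def[abs_def]
    by (intro continuous_on_mult continuous_on_prod * continuous_on_rabs continuous_on_diff continuous_on_add continuous_on_const
          continuous_on_subset[OF continuous_on_product_coordinates subset_UNIV])
       (use assms bnd in auto)
qed

lemma sym_weight_maximizer:
  assumes "A > 0" "B > 0" "\<beta> > 0"
  obtains m where "inj_on m {..<n}" "\<And>i. i < n \<Longrightarrow> m i \<in> {-2<..<2}"
    "\<And>x. (\<And>i. i < n \<Longrightarrow> x i \<in> {-2..2}) \<Longrightarrow> sym_weight n A B \<beta> x \<le> sym_weight n A B \<beta> m"
proof -
  \<comment> \<open>The cube is taken in all coordinates of \<open>nat \<Rightarrow> real\<close>,
    where Tychonoff's theorem gives compactness; the weight ignores the coordinates from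
    \<open>n\<close> on.\<close>
  let ?K = "PiE UNIV (\<lambda>_::nat. {-2..2::real})"
  have "compactin (product_topology (\<lambda>_::nat. euclidean :: real topology) UNIV) ?K"
    unfolding compactin_PiE by simp
  then have "compact ?K" unfolding euclidean_product_topology compactin_euclidean_iff .
  moreover have "(\<lambda>_. 0) \<in> ?K" by (intro PiE_I) auto
  then have "?K \<noteq> {}" by blast
  ultimately have "\<exists>m\<in>?K. \<forall>x\<in>?K. sym_weight n A B \<beta> x \<le> sym_weight n A B \<beta> m"
    using continuous_on_sym_weight[OF assms] by (intro continuous_attains_sup)
  then obtain m where m: "m \<in> ?K" "\<And>x. x \<in> ?K \<Longrightarrow> sym_weight n A B \<beta> x \<le> sym_weight n A B \<beta> m" by auto
  have max: "sym_weight n A B \<beta> x \<le> sym_weight n A B \<beta> m" if "\<And>i. i < n \<Longrightarrow> x i \<in> {-2..2}" for x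
  proof -
    have "sym_weight n A B \<beta> x = sym_weight n A B \<beta> (\<lambda>i. if i < n then x i else 0)"
      by (rule sym_weight_cong) auto
    also have "\<dots> \<le> sym_weight n A B \<beta> m" by (rule m(2), rule PiE_I) (use that in auto)
    finally show ?thesis .
  qed
  have mm: "m i \<in> {-2..2}" for i using PiE_mem[OF m(1)] by simp
  \<comment> \<open>Any configuration of distinct interior points would do: it certifies that the
    maximum is positive.\<close>
  define x where "x i = real i / (real n + 1)" for i
  have x: "x i \<in> {-2<..<2}" if "i < n" for i using that by (auto simp: x_def field_simps)
  then have x': "x i \<in> {-2..2}" if "i < n" for i using that by (simp add: less_imp_le)
  have "inj_on x {..<n}" by (auto simp: inj_on_def x_def)
  then have "sym_weight n A B \<beta> x > 0"
    using x x' by (subst sym_weight_pos_iff[OF _ assms]) auto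
  moreover have "sym_weight n A B \<beta> x \<le> sym_weight n A B \<beta> m" by (rule max) (use x' in auto)
  ultimately have "sym_weight n A B \<beta> m > 0" by linarith
  then have "inj_on m {..<n} \<and> (\<forall>i<n. m i \<in> {-2<..<2})"
    using sym_weight_pos_iff[OF mm assms] by simp
  then show thesis using max by (intro that[of m]) auto
qed

text \<open>Separates the factors containing coordinate \<open>i\<close> when the others are frozen;
  they appear squared because each pair is met in both orders.\<close>

lemma prod_pairs_isolate:
  fixes g :: "nat \<Rightarrow> nat \<Rightarrow> 'a :: comm_monoid_mult"
  assumes "\<And>i j. g i j = g j i" "i < n"
  shows "(\<Prod>k<n. \<Prod>j\<in>{..<n}-{k}. g k j) =
    (\<Prod>j\<in>{..<n}-{i}. g i j * g i j) * (\<Prod>k\<in>{..<n}-{i}. \<Prod>j\<in>{..<n}-{k,i}. g k j)"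
proof -
  have "(\<Prod>k<n. \<Prod>j\<in>{..<n}-{k}. g k j) = (\<Prod>j\<in>{..<n}-{i}. g i j) * (\<Prod>k\<in>{..<n}-{i}. \<Prod>j\<in>{..<n}-{k}. g k j)"
    using assms by (subst prod.remove[of _ i]) auto
  also have "(\<Prod>k\<in>{..<n}-{i}. \<Prod>j\<in>{..<n}-{k}. g k j) = (\<Prod>k\<in>{..<n}-{i}. g i k * (\<Prod>j\<in>{..<n}-{k,i}. g k j))"
  proof (rule prod.cong[OF refl])
    fix k assume "k \<in> {..<n}-{i}"
    moreover have "{..<n}-{k}-{i} = {..<n}-{k,i}" by auto
    ultimately show "(\<Prod>j\<in>{..<n}-{k}. g k j) = g i k * (\<Prod>j\<in>{..<n}-{k,i}. g k j)"
      using assms by (subst prod.remove[of _ i]) auto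
  qed
  finally show ?thesis by (simp add: prod.distrib mult.assoc)
qed

text \<open>Moving only coordinate \<open>i\<close> near \<open>m i\<close>, the weight is a
  positive constant times \<open>exp (h t)\<close>, so \<open>h\<close> has an interior local
  maximum at \<open>m i\<close>.\<close>

lemma sym_weight_maximizer_critical:
  assumes pos: "A > 0" "B > 0" "\<beta> > 0" and inj: "inj_on m {..<n}" and m: "\<And>i. i < n \<Longrightarrow> m i \<in> {-2<..<2}"
    and max: "\<And>x. (\<And>i. i < n \<Longrightarrow> x i \<in> {-2..2}) \<Longrightarrow> sym_weight n A B \<beta> x \<le> sym_weight n A B \<beta> m"
    and i: "i < n"
  shows "\<beta> * (\<Sum>j\<in>{..<n}-{i}. 1 / (m i - m j)) + B / (2 + m i) - A / (2 - m i) = 0"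
proof -
  \<comment> \<open>Writing \<open>ln ((t - m j)^2) / 2\<close> for the logarithm of
    \<open>\<bar>t - m j\<bar>\<close> avoids a case distinction on the side of \<open>m j\<close>
    on which \<open>t\<close> lies.\<close>
  define h where "h t = (\<Sum>j\<in>{..<n}-{i}. \<beta> * (ln ((t - m j)^2) / 2)) + (A * ln (2 - t) + B * ln (2 + t))" for t
  define C where "C = (\<Prod>k\<in>{..<n}-{i}. \<Prod>j\<in>{..<n}-{k,i}. \<bar>m k - m j\<bar> powr (\<beta> / 2)) *
     (\<Prod>k\<in>{..<n}-{i}. (2 - m k) powr A * (2 + m k) powr B)"
  define U where "U = {-2<..<2} - m ` ({..<n}-{i})"
  have "open U" unfolding U_def by (intro open_Diff finite_imp_closed) auto
  moreover have miU: "m i \<in> U" using m[OF i] inj i by (auto simp: U_def inj_on_def)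
  ultimately obtain d where d: "d > 0" "ball (m i) d \<subseteq> U" using open_contains_ball by blast
  have "\<bar>m k - m j\<bar> powr (\<beta> / 2) > 0" if "k \<in> {..<n}-{i}" "j \<in> {..<n}-{k,i}" for j k
    using that inj by (auto simp: inj_on_def)
  moreover have "(2 - m k) powr A * (2 + m k) powr B > 0" if "k \<in> {..<n}-{i}" for k
    using that m[of k] by auto
  ultimately have Cpos: "C > 0" unfolding C_def
    by (intro mult_pos_pos[OF prod_pos prod_pos] prod_pos)
  have eq: "sym_weight n A B \<beta> (m(i := t)) = C * exp (h t)" if t: "t \<in> U" for t
  proof -
    have tn: "t \<noteq> m j" if "j \<in> {..<n}-{i}" for j using that t by (auto simp: U_def)
    have sq: "\<bar>u\<bar> powr (\<beta> / 2) * \<bar>u\<bar> powr (\<beta> / 2) = exp (\<beta> * (ln (u^2) / 2))" if "u \<noteq> 0" for u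
    proof -
      have "u^2 = \<bar>u\<bar> * \<bar>u\<bar>" by (simp add: power2_eq_square)
      then have "ln (u^2) = 2 * ln \<bar>u\<bar>" using that by (simp only: ln_mult abs_0_eq zero_less_abs_iff) simp
      then show ?thesis using that by (simp add: powr_def flip: exp_add)
    qed
    have "(\<Prod>k<n. \<Prod>j\<in>{..<n}-{k}. \<bar>(m(i := t)) k - (m(i := t)) j\<bar> powr (\<beta> / 2))
      = (\<Prod>j\<in>{..<n}-{i}. \<bar>(m(i := t)) i - (m(i := t)) j\<bar> powr (\<beta> / 2) * \<bar>(m(i := t)) i - (m(i := t)) j\<bar> powr (\<beta> / 2)) *
       (\<Prod>k\<in>{..<n}-{i}. \<Prod>j\<in>{..<n}-{k,i}. \<bar>(m(i := t)) k - (m(i := t)) j\<bar> powr (\<beta> / 2))"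
      by (rule prod_pairs_isolate) (use i in \<open>simp_all add: abs_minus_commute\<close>)
    also have "(\<Prod>j\<in>{..<n}-{i}. \<bar>(m(i := t)) i - (m(i := t)) j\<bar> powr (\<beta> / 2) * \<bar>(m(i := t)) i - (m(i := t)) j\<bar> powr (\<beta> / 2))
      = (\<Prod>j\<in>{..<n}-{i}. exp (\<beta> * (ln ((t - m j)^2) / 2)))"
    proof (rule prod.cong[OF refl])
      fix j assume j: "j \<in> {..<n}-{i}"
      then have "(m(i := t)) i - (m(i := t)) j = t - m j" by auto
      then show "\<bar>(m(i := t)) i - (m(i := t)) j\<bar> powr (\<beta> / 2) * \<bar>(m(i := t)) i - (m(i := t)) j\<bar> powr (\<beta> / 2) = exp (\<beta> * (ln ((t - m j)^2) / 2))"
        using sq[of "t - m j"] tn[OF j] by simp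
    qed
    also have "\<dots> = exp (\<Sum>j\<in>{..<n}-{i}. \<beta> * (ln ((t - m j)^2) / 2))" by (simp add: exp_sum)
    also have "(\<Prod>k\<in>{..<n}-{i}. \<Prod>j\<in>{..<n}-{k,i}. \<bar>(m(i := t)) k - (m(i := t)) j\<bar> powr (\<beta> / 2))
      = (\<Prod>k\<in>{..<n}-{i}. \<Prod>j\<in>{..<n}-{k,i}. \<bar>m k - m j\<bar> powr (\<beta> / 2))"
      by (intro prod.cong refl) auto
    finally have 1: "(\<Prod>k<n. \<Prod>j\<in>{..<n}-{k}. \<bar>(m(i := t)) k - (m(i := t)) j\<bar> powr (\<beta> / 2))
      = exp (\<Sum>j\<in>{..<n}-{i}. \<beta> * (ln ((t - m j)^2) / 2)) * (\<Prod>k\<in>{..<n}-{i}. \<Prod>j\<in>{..<n}-{k,i}. \<bar>m k - m j\<bar> powr (\<beta> / 2))" .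
    have "(\<Prod>k<n. (2 - (m(i := t)) k) powr A * (2 + (m(i := t)) k) powr B)
      = ((2 - t) powr A * (2 + t) powr B) * (\<Prod>k\<in>{..<n}-{i}. (2 - (m(i := t)) k) powr A * (2 + (m(i := t)) k) powr B)"
      using i by (subst prod.remove[of _ i]) auto
    also have "(\<Prod>k\<in>{..<n}-{i}. (2 - (m(i := t)) k) powr A * (2 + (m(i := t)) k) powr B) = (\<Prod>k\<in>{..<n}-{i}. (2 - m k) powr A * (2 + m k) powr B)"
      by (intro prod.cong refl) auto
    also have "(2 - t) powr A * (2 + t) powr B = exp (A * ln (2 - t) + B * ln (2 + t))"
      using t by (simp add: powr_def U_def exp_add)
    finally have 2: "(\<Prod>k<n. (2 - (m(i := t)) k) powr A * (2 + (m(i := t)) k) powr B)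
      = exp (A * ln (2 - t) + B * ln (2 + t)) * (\<Prod>k\<in>{..<n}-{i}. (2 - m k) powr A * (2 + m k) powr B)" .
    show ?thesis unfolding sym_weight_def 1 2 C_def h_def exp_add by (simp only: mult_ac)
  qed
  have le: "h t \<le> h (m i)" if "t \<in> ball (m i) d" for t
  proof -
    have t: "t \<in> U" using that d by auto
    have "sym_weight n A B \<beta> (m(i := t)) \<le> sym_weight n A B \<beta> m"
    proof (rule max)
      fix j assume "j < n"
      then show "(m(i := t)) j \<in> {-2..2}" using m[of j] t by (auto simp: U_def)
    qed
    then have "C * exp (h t) \<le> C * exp (h (m i))" using eq[OF t] eq[OF miU] by simp
    then show ?thesis using Cpos by simp
  qed
  have der: "(h has_real_derivative (\<Sum>j\<in>{..<n}-{i}. \<beta> * (1 / (m i - m j))) + (A * (- 1 / (2 - m i)) + B * (1 / (2 + m i)))) (at (m i))"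
    unfolding h_def[abs_def]
  proof (intro DERIV_add DERIV_sum DERIV_cmult)
    fix j assume "j \<in> {..<n}-{i}"
    then have "m i \<noteq> m j" using miU by (auto simp: U_def)
    then show "((\<lambda>t. ln ((t - m j)^2) / 2) has_real_derivative 1 / (m i - m j)) (at (m i))"
    proof -
      have "(m i - m j)^2 > 0" using \<open>m i \<noteq> m j\<close> by simp
      moreover have "((\<lambda>t. (t - m j)^2) has_real_derivative 2 * (m i - m j)) (at (m i))"
        by (auto intro!: derivative_eq_intros)
      ultimately have "((\<lambda>t. ln ((t - m j)^2) / 2) has_real_derivative (1 / (m i - m j)^2 * (2 * (m i - m j))) / 2) (at (m i))"
        by (intro DERIV_cdivide) (rule DERIV_chain2[OF DERIV_ln_divide])
      moreover have "(1 / r^2 * (2 * r)) / 2 = 1 / r" for r :: real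
        by (simp add: power2_eq_square)
      ultimately show ?thesis by (simp only:)
    qed
  next
    show "((\<lambda>t. ln (2 - t)) has_real_derivative - 1 / (2 - m i)) (at (m i))"
      using m[OF i] by (auto intro!: derivative_eq_intros)
    show "((\<lambda>t. ln (2 + t)) has_real_derivative 1 / (2 + m i)) (at (m i))"
      using m[OF i] by (auto intro!: derivative_eq_intros)
  qed
  have "\<forall>t. \<bar>m i - t\<bar> < d \<longrightarrow> h t \<le> h (m i)"
    using le unfolding mem_ball dist_real_def by blast
  then have "(\<Sum>j\<in>{..<n}-{i}. \<beta> * (1 / (m i - m j))) + (A * (- 1 / (2 - m i)) + B * (1 / (2 + m i))) = 0"
    by (rule DERIV_local_max[OF der d(1)])
  then show ?thesis unfolding sum_distrib_left[symmetric] by simp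
qed

text \<open>A permutation maximizing the scalar product admits no improving swap.\<close>
lemma similarly_ordered_permutation:
  fixes x y :: "nat \<Rightarrow> real"
  obtains \<sigma> where "\<sigma> permutes {..<n}" "\<And>i j. i < n \<Longrightarrow> j < n \<Longrightarrow> (x i - x j) * (y (\<sigma> i) - y (\<sigma> j)) \<ge> 0"
proof -
  define f where "f \<sigma> = (\<Sum>i<n. x i * y (\<sigma> i))" for \<sigma>
  have fin: "finite {\<sigma>. \<sigma> permutes {..<n}}" by (simp add: finite_permutations)
  moreover have "{\<sigma>. \<sigma> permutes {..<n}} \<noteq> {}" using permutes_id by blast
  ultimately have "Max (f ` {\<sigma>. \<sigma> permutes {..<n}}) \<in> f ` {\<sigma>. \<sigma> permutes {..<n}}" by (intro Max_in) auto
  then obtain \<sigma> where s: "\<sigma> permutes {..<n}" "f \<sigma> = Max (f ` {\<sigma>. \<sigma> permutes {..<n}})" by auto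
  have max: "f \<tau> \<le> f \<sigma>" if "\<tau> permutes {..<n}" for \<tau> unfolding s(2) using fin that by (intro Max_ge) auto
  have "(x i - x j) * (y (\<sigma> i) - y (\<sigma> j)) \<ge> 0" if ij: "i < n" "j < n" for i j
  proof (cases "i = j")
    case False
    define \<tau> where "\<tau> = \<sigma> \<circ> Transposition.transpose i j"
    have "\<tau> permutes {..<n}" unfolding \<tau>_def using ij s(1) by (intro permutes_compose permutes_swap_id) auto
    from max[OF this] have "f \<tau> \<le> f \<sigma>" .
    have split: "f \<rho> = x i * y (\<rho> i) + (x j * y (\<rho> j) + (\<Sum>k\<in>{..<n}-{i}-{j}. x k * y (\<rho> k)))" for \<rho>
      unfolding f_def using ij False by (subst sum.remove[of _ i], simp, simp, subst sum.remove[of _ j]) auto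
    have "(\<Sum>k\<in>{..<n}-{i}-{j}. x k * y (\<tau> k)) = (\<Sum>k\<in>{..<n}-{i}-{j}. x k * y (\<sigma> k))"
      by (intro sum.cong refl) (auto simp: \<tau>_def Transposition.transpose_def)
    moreover have "\<tau> i = \<sigma> j" "\<tau> j = \<sigma> i" by (auto simp: \<tau>_def)
    ultimately show ?thesis using \<open>f \<tau> \<le> f \<sigma>\<close> unfolding split by (simp add: algebra_simps)
  qed auto
  then show thesis using s(1) that by blast
qed

section \<open>Concentration around the maximizer\<close>

lemma jacobi_weight_eq_sym_weight:
  assumes "\<And>i. i < n \<Longrightarrow> x i \<in> {-2<..<2}"
  shows "jacobi_weight n a b \<beta> x = sym_weight n a b \<beta> x"
proof -
  have "(\<Prod>i<n. \<Prod>j\<in>{..<n}-{i}. \<bar>x i - x j\<bar> powr (\<beta> / 2))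
    = (\<Prod>i<n. \<Prod>j\<in>{i<..<n}. \<bar>x i - x j\<bar> powr (\<beta> / 2) * \<bar>x i - x j\<bar> powr (\<beta> / 2))"
    by (rule prod_pairs_square) (simp add: abs_minus_commute)
  also have "\<dots> = (\<Prod>i<n. \<Prod>j\<in>{i<..<n}. \<bar>x i - x j\<bar> powr \<beta>)"
    by (simp flip: powr_add)
  finally have "(\<Prod>i<n. \<Prod>j\<in>{..<n}-{i}. \<bar>x i - x j\<bar> powr (\<beta> / 2)) = (\<Prod>i<n. \<Prod>j\<in>{i<..<n}. \<bar>x i - x j\<bar> powr \<beta>)" .
  moreover have "(\<Prod>i<n. (2 - x i) powr a * (2 + x i) powr b * indicator {-2<..<2} (x i)) = (\<Prod>i<n. (2 - x i) powr a * (2 + x i) powr b)"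
    using assms by (intro prod.cong refl) auto
  ultimately show ?thesis unfolding jacobi_weight_def sym_weight_def by simp
qed

lemma jacobi_weight_eq_0:
  assumes "i < n" "x i \<notin> {-2<..<2}"
  shows "jacobi_weight n a b \<beta> x = 0"
proof -
  have "(\<Prod>i<n. (2 - x i) powr a * (2 + x i) powr b * indicator {-2<..<2} (x i)) = 0"
    using assms by (intro prod_zero[OF _ bexI[of _ i]]) auto
  then show ?thesis unfolding jacobi_weight_def by simp
qed

lemma jacobi_weight_nonneg: "jacobi_weight n a b \<beta> x \<ge> 0"
  unfolding jacobi_weight_def by (intro mult_nonneg_nonneg prod_nonneg ballI) auto

text \<open>The extra factors are \<open>4 ^ n\<close> times the Jacobian of the logistic
  coordinates. This links the maximized weight to the weight of the actual density.\<close>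

lemma sym_weight_Suc_exponents:
  assumes "\<And>i. i < n \<Longrightarrow> x i \<in> {-2<..<2}"
  shows "sym_weight n (a + 1) (b + 1) \<beta> x = sym_weight n a b \<beta> x * (\<Prod>i<n. (2 + x i) * (2 - x i))"
proof -
  have "(\<Prod>i<n. (2 - x i) powr (a + 1) * (2 + x i) powr (b + 1)) = (\<Prod>i<n. ((2 - x i) powr a * (2 + x i) powr b) * ((2 + x i) * (2 - x i)))"
  proof (rule prod.cong[OF refl])
    fix i assume "i \<in> {..<n}"
    then have "2 - x i > 0" "2 + x i > 0" using assms[of i] by auto
    then show "(2 - x i) powr (a + 1) * (2 + x i) powr (b + 1) = ((2 - x i) powr a * (2 + x i) powr b) * ((2 + x i) * (2 - x i))"
      by (simp add: powr_add)
  qed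
  then show ?thesis unfolding sym_weight_def prod.distrib by simp
qed

context
  fixes n :: nat and a b \<beta> :: real and m :: "nat \<Rightarrow> real"
  assumes ab: "a > -1" "b > -1" "\<beta> > 0" and inj: "inj_on m {..<n}" and m: "\<And>i. i < n \<Longrightarrow> m i \<in> {-2<..<2}"
    and max: "\<And>x. (\<And>i. i < n \<Longrightarrow> x i \<in> {-2..2}) \<Longrightarrow> sym_weight n (a + 1) (b + 1) \<beta> x \<le> sym_weight n (a + 1) (b + 1) \<beta> m"
begin

text \<open>Of the two factors \<open>?W S\<close> in the midpoint inequality, one is at most the
  maximum \<open>?W m\<close>. It cancels against the value at the permuted maximizer, so
  \<open>?W x\<close> is compared with a single \<open>?W S\<close>. Lowering the exponents back to
  \<open>a\<close> and \<open>b\<close> turns the leftover factors into the derivative of the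
  midpoint map.\<close>

lemma jacobi_weight_contraction:
  assumes s: "\<sigma> permutes {..<n}" and x: "\<And>i. i < n \<Longrightarrow> x i \<in> {-2<..<2}"
    and ord: "\<And>i j. i < n \<Longrightarrow> j < n \<Longrightarrow> (x i - x j) * (m (\<sigma> i) - m (\<sigma> j)) \<ge> 0"
    and K: "K = (a + 1) + (b + 1) + \<beta> * (real n - 1)" "K \<ge> 0" and D: "(\<Sum>i<n. (x i - m (\<sigma> i))^2) \<ge> D"
  shows "jacobi_weight n a b \<beta> x \<le> 2 ^ n * exp (- K * D / 32) *
     (jacobi_weight n a b \<beta> (\<lambda>i\<in>{..<n}. jac_mid (m (\<sigma> i)) (x i)) * (\<Prod>i<n. jac_mid_deriv (m (\<sigma> i)) (x i)))"
proof -
  define m' where "m' i = m (\<sigma> i)" for i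
  define S where "S i = jac_mid (m' i) (x i)" for i
  define R where "R = (\<Prod>i<n. jac_rho (m' i) (x i) powr (2 * K))"
  let ?W = "sym_weight n (a + 1) (b + 1) \<beta>"
  have m': "m' i \<in> {-2<..<2}" if "i < n" for i
    unfolding m'_def using m permutes_in_image[OF s, of i] that by simp
  have S: "S i \<in> {-2<..<2}" if "i < n" for i
    using m'[OF that] x[OF that] jac_mid_gt jac_mid_lt by (auto simp: S_def)
  have A: "a + 1 > 0" "b + 1 > 0" using ab by auto
  have Wm: "?W m' = ?W m" unfolding m'_def by (rule sym_weight_permute[OF s])
  have Wmpos: "?W m > 0"
    using sym_weight_pos_iff[of n m "a + 1" "b + 1" \<beta>] m inj A ab by (auto simp: less_imp_le)
  have WS: "?W S \<le> ?W m" by (rule max) (use S in \<open>auto simp: less_imp_le\<close>)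
  have Rpos: "R \<ge> 0" by (auto simp: R_def intro!: prod_nonneg)
  have "?W x * ?W m' \<le> (?W S)^2 * R"
    unfolding S_def R_def K(1) by (rule sym_weight_mid_ge) (use x m' ord A ab in \<open>auto simp: m'_def\<close>)
  also have "\<dots> \<le> (?W S * ?W m) * R"
    unfolding power2_eq_square by (intro mult_right_mono mult_left_mono WS Rpos sym_weight_nonneg)
  finally have "?W m * ?W x \<le> ?W m * (?W S * R)" unfolding Wm by (simp add: mult_ac)
  then have 1: "?W x \<le> ?W S * R" using Wmpos by simp
  have "R \<le> exp (- K * D / 32)"
  proof -
    have "R = (\<Prod>i<n. exp (K * (2 * ln (jac_rho (m' i) (x i)))))"
      unfolding R_def
    proof (rule prod.cong[OF refl])
      fix i assume "i \<in> {..<n}"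
      then have "jac_rho (m' i) (x i) > 0" using m'[of i] x[of i] jac_rho_pos by auto
      then show "jac_rho (m' i) (x i) powr (2 * K) = exp (K * (2 * ln (jac_rho (m' i) (x i))))"
        by (simp add: powr_def)
    qed
    also have "\<dots> \<le> (\<Prod>i<n. exp (K * (- ((x i - m' i)^2 / 32))))"
    proof (intro prod_mono conjI)
      fix i assume "i \<in> {..<n}"
      then have "2 * ln (jac_rho (m' i) (x i)) \<le> - ((x i - m' i)^2 / 32)"
        using m'[of i] x[of i] by (intro ln_jac_rho_le) auto
      then show "exp (K * (2 * ln (jac_rho (m' i) (x i)))) \<le> exp (K * (- ((x i - m' i)^2 / 32)))"
        unfolding exp_le_cancel_iff by (rule mult_left_mono[OF _ K(2)])
    qed auto
    also have "\<dots> = exp (- K * (\<Sum>i<n. (x i - m' i)^2) / 32)"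
      by (simp add: exp_sum[symmetric] sum_distrib_left[symmetric] sum_negf sum_divide_distrib[symmetric])
    also have "\<dots> \<le> exp (- K * D / 32)"
      using mult_left_mono[OF D K(2)] by (simp add: m'_def)
    finally show ?thesis .
  qed
  with 1 have 2: "?W x \<le> ?W S * exp (- K * D / 32)"
    using mult_left_mono[OF _ sym_weight_nonneg] order_trans by blast
  define P where "P = (\<Prod>i<n. (2 + x i) * (2 - x i))"
  have 3: "sym_weight n a b \<beta> x * P \<le> sym_weight n a b \<beta> S * (\<Prod>i<n. (2 + S i) * (2 - S i)) * exp (- K * D / 32)"
  proof -
    have "?W x = sym_weight n a b \<beta> x * P" unfolding P_def by (rule sym_weight_Suc_exponents) (rule x)
    moreover have "?W S = sym_weight n a b \<beta> S * (\<Prod>i<n. (2 + S i) * (2 - S i))"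
      by (rule sym_weight_Suc_exponents) (rule S)
    ultimately show ?thesis using 2 by (simp only:)
  qed
  have "(2 + x i) * (2 - x i) > 0" if "i < n" for i using x[OF that] by (intro mult_pos_pos) auto
  then have Ppos: "P > 0" unfolding P_def by (intro prod_pos) simp
  \<comment> \<open>The \<open>2 ^ n\<close> collects the factors \<open>1 / 2\<close> in the
    coordinate derivatives; it is the volume cost of averaging.\<close>
  have 4: "(\<Prod>i<n. jac_mid_deriv (m' i) (x i)) = (\<Prod>i<n. (2 + S i) * (2 - S i)) / (2 ^ n * P)"
    unfolding jac_mid_deriv_def S_def P_def by (simp add: prod_dividef prod.distrib)
  have "sym_weight n a b \<beta> x = sym_weight n a b \<beta> x * P / P" using Ppos by simp
  also have "\<dots> \<le> sym_weight n a b \<beta> S * (\<Prod>i<n. (2 + S i) * (2 - S i)) * exp (- K * D / 32) / P"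
    using Ppos by (intro divide_right_mono[OF 3]) simp
  also have "\<dots> = 2 ^ n * exp (- K * D / 32) * (sym_weight n a b \<beta> S * (\<Prod>i<n. jac_mid_deriv (m' i) (x i)))"
    unfolding 4 using Ppos by simp
  finally have "jacobi_weight n a b \<beta> x \<le> 2 ^ n * exp (- K * D / 32) * (jacobi_weight n a b \<beta> S * (\<Prod>i<n. jac_mid_deriv (m' i) (x i)))"
    using jacobi_weight_eq_sym_weight[of n x a b \<beta>] jacobi_weight_eq_sym_weight[of n S a b \<beta>] x S by simp
  moreover have "jacobi_weight n a b \<beta> S = jacobi_weight n a b \<beta> (\<lambda>i\<in>{..<n}. S i)"
  proof -
    have "jacobi_weight n a b \<beta> S = sym_weight n a b \<beta> S" by (rule jacobi_weight_eq_sym_weight[OF S])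
    also have "\<dots> = sym_weight n a b \<beta> (\<lambda>i\<in>{..<n}. S i)" by (rule sym_weight_cong) auto
    also have "\<dots> = jacobi_weight n a b \<beta> (\<lambda>i\<in>{..<n}. S i)"
      by (rule jacobi_weight_eq_sym_weight[symmetric]) (use S in auto)
    finally show ?thesis .
  qed
  ultimately show ?thesis unfolding S_def m'_def by simp
qed

text \<open>On \<open>bad\<close>, every permutation of \<open>m\<close> is far from
  \<open>x\<close>, in particular the one ordered like \<open>x\<close>, for which the contraction
  holds. Each permutation contributes mass at most one after the change of variables, and a union
  bound over all of them gives the factorial.\<close>

lemma jacobi_concentration:
  fixes D :: real
  assumes X: "distributed M (lebesgue_n n) X (\<lambda>x. ennreal (jacobi_density n a b \<beta> x))" and "prob_space M"
    and K: "K = (a + 1) + (b + 1) + \<beta> * (real n - 1)" "K \<ge> 0"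
  defines "bad \<equiv> {x \<in> space (lebesgue_n n). \<forall>\<sigma>\<in>{\<sigma>. \<sigma> permutes {..<n}}. D \<le> (\<Sum>i<n. (x i - m (\<sigma> i))^2)}"
  shows "bad \<in> sets (lebesgue_n n)"
    "measure M (X -` bad \<inter> space M) \<le> fact n * (2 ^ n * exp (- K * D / 32))"
proof -
  interpret prob_space M by fact
  let ?P = "{\<sigma>. \<sigma> permutes {..<n}}"
  have finP: "finite ?P" by (simp add: finite_permutations)
  show bad[measurable]: "bad \<in> sets (lebesgue_n n)"
    unfolding bad_def
  proof (rule sets.sets_Collect_finite_All[OF _ finP])
    fix \<sigma>
    have [measurable]: "(\<lambda>x. \<Sum>i<n. (x i - m (\<sigma> i))^2) \<in> borel_measurable (lebesgue_n n)"
    proof (rule borel_measurable_sum)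
      fix i assume "i \<in> {..<n}"
      then have [measurable]: "(\<lambda>x. x i) \<in> measurable (lebesgue_n n) borel"
        using measurable_component_singleton[of i "{..<n}" "\<lambda>_. lborel :: real measure"] by simp
      show "(\<lambda>x. (x i - m (\<sigma> i))^2) \<in> borel_measurable (lebesgue_n n)" by measurable
    qed
    show "{x \<in> space (lebesgue_n n). D \<le> (\<Sum>i<n. (x i - m (\<sigma> i))^2)} \<in> sets (lebesgue_n n)" by measurable
  qed
  define F where "F x = ennreal (jacobi_density n a b \<beta> x)" for x
  have F[measurable]: "F \<in> borel_measurable (lebesgue_n n)"
    using distributed_borel_measurable[OF X] unfolding F_def by simp
  \<comment> \<open>Only the sign of this Selberg integral enters: both sides of the contraction are
    divided by it.\<close>
  define Z where "Z = (\<integral>y. jacobi_weight n a b \<beta> y \<partial>lebesgue_n n)"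
  have Z: "Z \<ge> 0" unfolding Z_def by (intro integral_nonneg_AE AE_I2 jacobi_weight_nonneg)
  define c where "c = 2 ^ n * exp (- K * D / 32)"
  have c: "c \<ge> 0" by (simp add: c_def)
  define S where "S \<sigma> x = (\<lambda>i\<in>{..<n}. jac_mid (m (\<sigma> i)) (x i))" for \<sigma> and x :: "nat \<Rightarrow> real"
  define g where "g \<sigma> i t = ennreal (jac_mid_deriv (m (\<sigma> i)) t) * indicator {-2<..<2} t" for \<sigma> :: "nat \<Rightarrow> nat" and i t
  define G where "G \<sigma> x = F (S \<sigma> x) * (\<Prod>i<n. g \<sigma> i (x i))" for \<sigma> x
  have gm[measurable]: "g \<sigma> i \<in> borel_measurable borel" for \<sigma> i unfolding g_def by measurable
  have Gm: "G \<sigma> \<in> borel_measurable (lebesgue_n n)" for \<sigma>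
  proof -
    have comp: "(\<lambda>x. x i) \<in> measurable (lebesgue_n n) borel" if "i < n" for i
      using measurable_component_singleton[of i "{..<n}" "\<lambda>_. lborel :: real measure"] that by simp
    have "S \<sigma> \<in> measurable (lebesgue_n n) (lebesgue_n n)"
      unfolding S_def
    proof (rule measurable_restrict)
      fix i assume "i \<in> {..<n}"
      then show "(\<lambda>x. jac_mid (m (\<sigma> i)) (x i)) \<in> measurable (lebesgue_n n) lborel"
        using measurable_compose[OF comp[of i] borel_measurable_jac_mid] by simp
    qed
    then have "(\<lambda>x. F (S \<sigma> x)) \<in> borel_measurable (lebesgue_n n)" by (rule measurable_compose[OF _ F])
    moreover have "(\<lambda>x. \<Prod>i<n. g \<sigma> i (x i)) \<in> borel_measurable (lebesgue_n n)"
      by (rule borel_measurable_prod_ennreal) (use measurable_compose[OF comp gm] in simp)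
    ultimately show ?thesis unfolding G_def by (rule borel_measurable_times_ennreal)
  qed
  have GF: "(\<integral>\<^sup>+x. G \<sigma> x \<partial>lebesgue_n n) \<le> 1" if "\<sigma> \<in> ?P" for \<sigma>
  proof -
    have "(\<integral>\<^sup>+x. G \<sigma> x \<partial>lebesgue_n n) \<le> (\<integral>\<^sup>+x. F x \<partial>lebesgue_n n)"
      unfolding G_def S_def
    proof (rule nn_integral_PiM_substitution_le)
      fix i and f :: "real \<Rightarrow> ennreal" assume i: "i \<in> {..<n}" and f: "f \<in> borel_measurable borel"
      have "m (\<sigma> i) \<in> {-2<..<2}" using m permutes_in_image[of \<sigma> "{..<n}" i] that i by simp
      then show "(\<integral>\<^sup>+t. f (jac_mid (m (\<sigma> i)) t) * g \<sigma> i t \<partial>lborel) \<le> (\<integral>\<^sup>+t. f t \<partial>lborel)"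
        unfolding g_def using f by (intro nn_integral_jac_mid_le) auto
    qed (use F in auto)
    also have "\<dots> = emeasure M (X -` space (lebesgue_n n) \<inter> space M)"
      using distributed_emeasure[OF X, of "space (lebesgue_n n)"] unfolding F_def
      by (auto intro!: nn_integral_cong)
    also have "\<dots> \<le> 1" by (rule measure_le_1)
    finally show ?thesis .
  qed
  \<comment> \<open>The ordering permutation depends on \<open>x\<close>, so its term is dominated
    by the sum over all permutations. Off the open cube, or off \<open>bad\<close>, the left side
    vanishes.\<close>
  have point: "F x * indicator bad x \<le> (\<Sum>\<sigma>\<in>?P. ennreal c * G \<sigma> x)" if xs: "x \<in> space (lebesgue_n n)" for x
  proof (cases "x \<in> bad \<and> (\<forall>i<n. x i \<in> {-2<..<2})")
    case True
    obtain \<sigma> where s: "\<sigma> permutes {..<n}" "\<And>i j. i < n \<Longrightarrow> j < n \<Longrightarrow> (x i - x j) * (m (\<sigma> i) - m (\<sigma> j)) \<ge> 0"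
      using similarly_ordered_permutation[of n x m] by blast
    have D: "(\<Sum>i<n. (x i - m (\<sigma> i))^2) \<ge> D" using True s(1) by (auto simp: bad_def)
    have "jacobi_weight n a b \<beta> x \<le> c * (jacobi_weight n a b \<beta> (S \<sigma> x) * (\<Prod>i<n. jac_mid_deriv (m (\<sigma> i)) (x i)))"
      unfolding c_def S_def by (rule jacobi_weight_contraction[OF s(1) _ s(2) K D]) (use True in auto)
    then have "jacobi_weight n a b \<beta> x / Z \<le> c * (jacobi_weight n a b \<beta> (S \<sigma> x) * (\<Prod>i<n. jac_mid_deriv (m (\<sigma> i)) (x i))) / Z"
      by (rule divide_right_mono[OF _ Z])
    then have "jacobi_density n a b \<beta> x \<le> c * (jacobi_density n a b \<beta> (S \<sigma> x) * (\<Prod>i<n. jac_mid_deriv (m (\<sigma> i)) (x i)))"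
      unfolding jacobi_density_def Z_def[symmetric] by simp
    then have "F x \<le> ennreal (c * (jacobi_density n a b \<beta> (S \<sigma> x) * (\<Prod>i<n. jac_mid_deriv (m (\<sigma> i)) (x i))))"
      unfolding F_def by (rule ennreal_leI)
    also have "\<dots> = ennreal c * G \<sigma> x"
    proof -
      have nn: "jac_mid_deriv (m (\<sigma> i)) (x i) \<ge> 0" if "i < n" for i
        using m[of "\<sigma> i"] permutes_in_image[OF s(1), of i] that True by (intro jac_mid_deriv_nonneg) auto
      have "(\<Prod>i<n. g \<sigma> i (x i)) = (\<Prod>i<n. ennreal (jac_mid_deriv (m (\<sigma> i)) (x i)))"
        using True by (intro prod.cong refl) (auto simp: g_def)
      also have "\<dots> = ennreal (\<Prod>i<n. jac_mid_deriv (m (\<sigma> i)) (x i))"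
        by (rule prod_ennreal) (use nn in auto)
      finally have "(\<Prod>i<n. g \<sigma> i (x i)) = ennreal (\<Prod>i<n. jac_mid_deriv (m (\<sigma> i)) (x i))" .
      moreover have "jacobi_density n a b \<beta> (S \<sigma> x) \<ge> 0"
        unfolding jacobi_density_def Z_def[symmetric] using Z jacobi_weight_nonneg by (intro divide_nonneg_nonneg) auto
      moreover have "(\<Prod>i<n. jac_mid_deriv (m (\<sigma> i)) (x i)) \<ge> 0" using nn by (intro prod_nonneg) auto
      ultimately show ?thesis unfolding G_def F_def using c by (simp add: ennreal_mult)
    qed
    also have "\<dots> \<le> (\<Sum>\<sigma>\<in>?P. ennreal c * G \<sigma> x)"
      using s(1) finP by (intro member_le_sum) auto
    finally show ?thesis using True by simp
  next
    case False
    then consider "x \<notin> bad" | i where "i < n" "x i \<notin> {-2<..<2}" by blast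
    then have "F x * indicator bad x = 0"
    proof cases
      case 2
      then show ?thesis by (simp add: F_def jacobi_density_def jacobi_weight_eq_0)
    qed simp
    then show ?thesis by (simp only: zero_le)
  qed
  have "emeasure M (X -` bad \<inter> space M) = (\<integral>\<^sup>+x. F x * indicator bad x \<partial>lebesgue_n n)"
    unfolding F_def by (rule distributed_emeasure[OF X bad])
  also have "\<dots> \<le> (\<integral>\<^sup>+x. (\<Sum>\<sigma>\<in>?P. ennreal c * G \<sigma> x) \<partial>lebesgue_n n)"
    by (intro nn_integral_mono point)
  also have "\<dots> = (\<Sum>\<sigma>\<in>?P. ennreal c * (\<integral>\<^sup>+x. G \<sigma> x \<partial>lebesgue_n n))"
    using Gm by (subst nn_integral_sum) (auto intro!: sum.cong nn_integral_cmult)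
  also have "\<dots> \<le> (\<Sum>\<sigma>\<in>?P. ennreal c * 1)"
    by (intro sum_mono mult_left_mono GF) auto
  also have "\<dots> = ennreal (fact n * c)"
    using c card_permutations[OF refl, of "{..<n}"] by (simp add: ennreal_of_nat_eq_real_of_nat ennreal_mult'[symmetric])
  finally have "ennreal (measure M (X -` bad \<inter> space M)) \<le> ennreal (fact n * c)"
    by (simp add: emeasure_eq_measure)
  then show "measure M (X -` bad \<inter> space M) \<le> fact n * (2 ^ n * exp (- K * D / 32))"
    using c unfolding c_def by (subst (asm) ennreal_le_iff) auto
qed

end

section \<open>The loop equation\<close>

lemma sum_pairs_swap:
  fixes h :: "nat \<Rightarrow> nat \<Rightarrow> 'a :: comm_monoid_add"
  shows "(\<Sum>i<n. \<Sum>j\<in>{..<n}-{i}. h i j) = (\<Sum>i<n. \<Sum>j\<in>{..<n}-{i}. h j i)"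
proof -
  have "(\<Sum>i<n. \<Sum>j\<in>{..<n}-{i}. h i j) = (\<Sum>(i, j)\<in>(SIGMA i:{..<n}. {..<n}-{i}). h i j)"
    by (rule sum.Sigma) auto
  also have "\<dots> = (\<Sum>(i, j)\<in>(SIGMA i:{..<n}. {..<n}-{i}). h j i)"
    by (rule sum.reindex_bij_witness[of _ prod.swap prod.swap]) auto
  also have "\<dots> = (\<Sum>i<n. \<Sum>j\<in>{..<n}-{i}. h j i)"
    by (rule sum.Sigma[symmetric]) auto
  finally show ?thesis .
qed

text \<open>Multiply the \<open>i\<close>-th critical equation by \<open>x i * (1 - x i) / (w - x i)\<close>, sum, and symmetrize.\<close>
lemma loop_equation:
  fixes x :: "nat \<Rightarrow> real" and w :: complex
  assumes crit: "\<And>i. i < n \<Longrightarrow> 2 * (\<Sum>j\<in>{..<n}-{i}. 1 / (x i - x j)) + tb / x i - ta / (1 - x i) = 0"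
    and x: "\<And>i. i < n \<Longrightarrow> 0 < x i \<and> x i < 1" and inj: "inj_on x {..<n}" and w: "Im w \<noteq> 0"
  defines "g \<equiv> (\<Sum>i<n. 1 / (w - of_real (x i)))" and "k \<equiv> (\<Sum>i<n. 1 / (w - of_real (x i))^2)"
  shows "w * (1 - w) * (g^2 - k) + (of_real tb - of_real (ta + tb) * w) * g
           + of_nat n * (of_nat n - 1 + of_real (ta + tb)) = 0"
proof -
  define X where "X i = complex_of_real (x i)" for i
  have wX: "w - X i \<noteq> 0" for i using w by (auto simp: X_def complex_eq_iff)
  have X01: "X i \<noteq> 0" "1 - X i \<noteq> 0" if "i < n" for i
    using x[OF that] by (auto simp: X_def)
  have Xne: "X i - X j \<noteq> 0" if "i < n" "j \<in> {..<n}-{i}" for i j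
    using that inj by (auto simp: X_def inj_on_def)
  define \<phi> where "\<phi> i = X i * (1 - X i) / (w - X i)" for i
  \<comment> \<open>Division with remainder in \<open>X i\<close>. In a difference quotient the pole
    part gives a product of two resolvents, and the linear part gives the constant 1 for each
    pair.\<close>
  have phi: "\<phi> i = w * (1 - w) / (w - X i) - (1 - X i - w)" for i
  proof -
    have "X i * (1 - X i) = w * (1 - w) - (1 - X i - w) * (w - X i)" by (simp add: algebra_simps)
    then show ?thesis unfolding \<phi>_def using wX[of i] by (simp add: diff_divide_distrib)
  qed
  have c: "2 * (\<Sum>j\<in>{..<n}-{i}. \<phi> i / (X i - X j)) + (of_real tb - of_real (ta + tb) * X i) / (w - X i) = 0" if i: "i < n" for i
  proof -
    have "2 * (\<Sum>j\<in>{..<n}-{i}. 1 / (X i - X j)) + of_real tb / X i - of_real ta / (1 - X i) = complex_of_real 0"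
      unfolding crit[OF i, symmetric] X_def by simp
    then have "\<phi> i * (2 * (\<Sum>j\<in>{..<n}-{i}. 1 / (X i - X j)) + (of_real tb / X i - of_real ta / (1 - X i))) = 0"
      by (simp only: add_diff_eq mult_zero_right of_real_0)
    moreover have "\<phi> i * (2 * (\<Sum>j\<in>{..<n}-{i}. 1 / (X i - X j))) = 2 * (\<Sum>j\<in>{..<n}-{i}. \<phi> i / (X i - X j))"
      by (simp add: sum_distrib_left mult.commute)
    moreover have "\<phi> i * (of_real tb / X i - of_real ta / (1 - X i)) = (of_real tb - of_real (ta + tb) * X i) / (w - X i)"
    proof -
      have "X i * (1 - X i) * (of_real tb / X i - of_real ta / (1 - X i)) = of_real tb - of_real (ta + tb) * X i"
        using X01[OF i] by (simp add: field_simps)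
      then show ?thesis unfolding \<phi>_def by (metis times_divide_eq_left)
    qed
    ultimately show ?thesis by (simp only: distrib_left)
  qed
  have "2 * (\<Sum>i<n. \<Sum>j\<in>{..<n}-{i}. \<phi> i / (X i - X j))
      = (\<Sum>i<n. \<Sum>j\<in>{..<n}-{i}. \<phi> i / (X i - X j)) + (\<Sum>i<n. \<Sum>j\<in>{..<n}-{i}. \<phi> j / (X j - X i))"
    using sum_pairs_swap[of "\<lambda>i j. \<phi> i / (X i - X j)" n] by simp
  also have "\<dots> = (\<Sum>i<n. \<Sum>j\<in>{..<n}-{i}. w * (1 - w) * (1 / (w - X i) * (1 / (w - X j))) + 1)"
    unfolding sum.distrib[symmetric]
  proof (intro sum.cong refl)
    fix i j assume ij: "i \<in> {..<n}" "j \<in> {..<n}-{i}"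
    then have ne: "X i - X j \<noteq> 0" using Xne by auto
    then have "\<phi> i / (X i - X j) + \<phi> j / (X j - X i) = (\<phi> i - \<phi> j) / (X i - X j)"
      by (metis diff_divide_distrib minus_diff_eq minus_divide_right uminus_add_conv_diff add.commute)
    also have "\<phi> i - \<phi> j = (w * (1 - w) * (1 / (w - X i) * (1 / (w - X j))) + 1) * (X i - X j)"
    proof -
      have "1 / (w - X i) - 1 / (w - X j) = (X i - X j) * (1 / (w - X i) * (1 / (w - X j)))"
        using wX[of i] wX[of j] by (simp add: divide_simps)
      then have "w * (1 - w) / (w - X i) - w * (1 - w) / (w - X j) = w * (1 - w) * ((X i - X j) * (1 / (w - X i) * (1 / (w - X j))))"
        by (metis mult.right_neutral right_diff_distrib times_divide_eq_right)
      then show ?thesis unfolding phi by (simp add: algebra_simps)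
    qed
    finally show "\<phi> i / (X i - X j) + \<phi> j / (X j - X i) = w * (1 - w) * (1 / (w - X i) * (1 / (w - X j))) + 1"
      using ne by simp
  qed
  also have "\<dots> = w * (1 - w) * (\<Sum>i<n. \<Sum>j\<in>{..<n}-{i}. 1 / (w - X i) * (1 / (w - X j))) + of_nat n * (of_nat n - 1)"
    by (simp add: sum.distrib sum_distrib_left of_nat_diff)
  \<comment> \<open>The excluded diagonal produces \<open>k\<close>, which is minus the derivative
    of \<open>g\<close> in \<open>w\<close>; this makes the equation a Riccati equation.\<close>
  also have "(\<Sum>i<n. \<Sum>j\<in>{..<n}-{i}. 1 / (w - X i) * (1 / (w - X j))) = g^2 - k"
  proof -
    have "g^2 = (\<Sum>i<n. \<Sum>j<n. 1 / (w - X i) * (1 / (w - X j)))"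
      unfolding g_def X_def power2_eq_square by (rule sum_product)
    also have "\<dots> = (\<Sum>i<n. 1 / (w - X i) * (1 / (w - X i)) + (\<Sum>j\<in>{..<n}-{i}. 1 / (w - X i) * (1 / (w - X j))))"
      by (intro sum.cong refl) (subst sum.remove, auto)
    also have "\<dots> = k + (\<Sum>i<n. \<Sum>j\<in>{..<n}-{i}. 1 / (w - X i) * (1 / (w - X j)))"
      by (simp add: sum.distrib k_def X_def power2_eq_square)
    finally show ?thesis by simp
  qed
  finally have 1: "2 * (\<Sum>i<n. \<Sum>j\<in>{..<n}-{i}. \<phi> i / (X i - X j)) = w * (1 - w) * (g^2 - k) + of_nat n * (of_nat n - 1)" .
  have 2: "(\<Sum>i<n. (of_real tb - of_real (ta + tb) * X i) / (w - X i)) = (of_real tb - of_real (ta + tb) * w) * g + of_nat n * of_real (ta + tb)"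
  proof -
    have "(of_real tb - of_real (ta + tb) * X i) / (w - X i) = (of_real tb - of_real (ta + tb) * w) * (1 / (w - X i)) + of_real (ta + tb)" for i
      using wX[of i] by (simp add: field_simps)
    then show ?thesis by (simp add: sum.distrib sum_distrib_left g_def X_def)
  qed
  have "0 = (\<Sum>i<n. 2 * (\<Sum>j\<in>{..<n}-{i}. \<phi> i / (X i - X j)) + (of_real tb - of_real (ta + tb) * X i) / (w - X i))"
    using c by simp
  also have "\<dots> = (w * (1 - w) * (g^2 - k) + of_nat n * (of_nat n - 1)) + ((of_real tb - of_real (ta + tb) * w) * g + of_nat n * of_real (ta + tb))"
    unfolding sum.distrib 1[symmetric] 2 by (simp add: sum_distrib_left)
  finally show ?thesis by (simp add: algebra_simps)
qed

text \<open>This sign condition singles out the branch of the quadratic equation.\<close>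
lemma Im_cauchy_sum_le:
  fixes x :: "nat \<Rightarrow> real" and w :: complex
  assumes x: "\<And>i. i < n \<Longrightarrow> 0 < x i \<and> x i < 1" and w: "Im w > 0"
  shows "Im (w * (1 - w) * (\<Sum>i<n. 1 / (w - of_real (x i)))) \<le> - real n * Im w"
proof -
  have "Im (w * (1 - w) * (1 / (w - of_real (x i)))) \<le> - Im w" if i: "i < n" for i
  proof -
    have ne: "w - of_real (x i) \<noteq> 0" using w by (auto simp: complex_eq_iff)
    \<comment> \<open>The same division with remainder: the pole term has nonpositive imaginary
      part, and the polynomial term has imaginary part exactly \<open>- Im w\<close>.\<close>
    have "w * (1 - w) = of_real (x i * (1 - x i)) + (1 - of_real (x i) - w) * (w - of_real (x i))"
      by (simp add: algebra_simps)
    then have "w * (1 - w) * (1 / (w - of_real (x i))) = of_real (x i * (1 - x i)) / (w - of_real (x i)) + (1 - of_real (x i) - w)"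
      using ne by (simp add: add_divide_distrib)
    moreover have "Im (of_real (x i * (1 - x i)) / (w - of_real (x i))) \<le> 0"
    proof -
      have "Im (of_real r / v) = - r * Im v / (cmod v)^2" for r v
        by (simp add: Im_divide cmod_power2)
      moreover have "x i * (1 - x i) \<ge> 0" using x[OF i] by simp
      ultimately show ?thesis using w by (simp only:) (intro divide_nonpos_nonneg, auto)
    qed
    ultimately show ?thesis by simp
  qed
  then have "(\<Sum>i<n. Im (w * (1 - w) * (1 / (w - of_real (x i))))) \<le> (\<Sum>i<n. - Im w)"
    by (intro sum_mono) auto
  then show ?thesis unfolding sum_distrib_left by simp
qed

section \<open>Total mass of the limit density\<close>

text \<open>The closed form divides by \<open>p^2\<close> and needs \<open>1 - p * cos t\<close> to
  stay positive up to \<open>t = 0\<close>, so \<open>p = 0\<close> and \<open>p = 1\<close> are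
  integrated separately. The total increment is the same for all \<open>p\<close>.\<close>

lemma poisson_sine_antiderivative:
  assumes "0 \<le> p" "p \<le> (1::real)"
  obtains \<Psi> where "continuous_on {0..pi} \<Psi>"
    "\<And>t. t \<in> {0<..<pi} \<Longrightarrow> (\<Psi> has_real_derivative (sin t)^2 / (1 + p^2 - 2 * p * cos t)) (at t)"
    "\<Psi> pi - \<Psi> 0 = pi / 2"
proof -
  consider "p = 1" | "p = 0" | "0 < p" "p < 1" using assms by linarith
  then show thesis
  proof cases
    case 1
    show thesis
    proof (rule that[of "\<lambda>t. (t + sin t) / 2"])
      fix t :: real assume t: "t \<in> {0<..<pi}"
      then have "cos t < 1" using cos_monotone_0_pi[of 0 t] by auto
      then have "(sin t)^2 / (1 + p^2 - 2 * p * cos t) = (1 + cos t) / 2"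
        unfolding sin_squared_eq 1 by (simp add: field_simps power2_eq_square)
      moreover have "((\<lambda>t. (t + sin t) / 2) has_real_derivative (1 + cos t) / 2) (at t)"
        by (auto intro!: derivative_eq_intros)
      ultimately show "((\<lambda>t. (t + sin t) / 2) has_real_derivative (sin t)^2 / (1 + p^2 - 2 * p * cos t)) (at t)"
        by (simp only:)
    qed (auto intro!: continuous_intros)
  next
    case 2
    show thesis
    proof (rule that[of "\<lambda>t. (t - sin t * cos t) / 2"])
      fix t :: real
      have "((\<lambda>t. (t - sin t * cos t) / 2) has_real_derivative (1 - (cos t * cos t + - sin t * sin t)) / 2) (at t)"
        by (auto intro!: derivative_eq_intros)
      also have "(1 - (cos t * cos t + - sin t * sin t)) / 2 = (sin t)^2 / (1 + p^2 - 2 * p * cos t)"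
        using sin_cos_squared_add[of t] unfolding 2 by (simp add: power2_eq_square)
      finally show "((\<lambda>t. (t - sin t * cos t) / 2) has_real_derivative (sin t)^2 / (1 + p^2 - 2 * p * cos t)) (at t)" .
    qed (auto intro!: continuous_intros)
  next
    case 3
    text \<open>\<open>t + 2 * arctan (p * sin t / (1 - p * cos t))\<close> is the primitive of the Poisson kernel.\<close>
    define P where "P t = t + 2 * arctan (p * sin t / (1 - p * cos t))" for t
    \<comment> \<open>With \<open>D = 1 + p^2 - 2 * p * cos t\<close> one has
      \<open>4 * p^2 * (sin t)^2 = 2 * (1 + p^2) * D - D^2 - (1 - p^2)^2\<close>. Dividing by
      \<open>D\<close> and integrating term by term gives \<open>\<Psi>\<close>.\<close>
    define \<Psi> where "\<Psi> t = (2 * (1 + p^2) * t - ((1 + p^2) * t - 2 * p * sin t) - (1 - p^2) * P t) / (4 * p^2)" for t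
    have pos: "1 - p * cos t > 0" for t
    proof -
      have "p * cos t \<le> p * 1" using 3 by (intro mult_left_mono) auto
      then show ?thesis using 3 by linarith
    qed
    have D: "1 + p^2 - 2 * p * cos t = (1 - p * cos t)^2 + (p * sin t)^2" for t
    proof -
      have "(p * sin t)^2 = p^2 * (1 - (cos t)^2)" by (simp add: power_mult_distrib sin_squared_eq)
      then show ?thesis by (simp add: power2_eq_square algebra_simps)
    qed
    have Dpos: "1 + p^2 - 2 * p * cos t > 0" for t
      unfolding D using pos[of t] by (intro add_pos_nonneg) auto
    have dP: "(P has_real_derivative (1 - p^2) / (1 + p^2 - 2 * p * cos t)) (at t)" for t
    proof -
      define q where "q = 1 - p * cos t" define s where "s = p * sin t"
      have q: "q > 0" using pos by (simp add: q_def)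
      have "((\<lambda>t. p * sin t / (1 - p * cos t)) has_real_derivative (p * cos t * q - s * s) / (q * q)) (at t)"
        using q by (auto intro!: derivative_eq_intros simp: q_def s_def)
      then have "((\<lambda>t. arctan (p * sin t / (1 - p * cos t))) has_real_derivative
          inverse (1 + (p * sin t / (1 - p * cos t))^2) * ((p * cos t * q - s * s) / (q * q))) (at t)"
        by (rule DERIV_chain2[OF DERIV_arctan])
      then have "(P has_real_derivative 1 + 2 * (inverse (1 + (s / q)^2) * ((p * cos t * q - s * s) / (q * q)))) (at t)"
        unfolding P_def[abs_def] q_def[symmetric] s_def[symmetric] by (intro DERIV_add DERIV_ident DERIV_cmult)
      also have "1 + 2 * (inverse (1 + (s / q)^2) * ((p * cos t * q - s * s) / (q * q))) = (1 - p^2) / (q^2 + s^2)"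
      proof -
        have nz: "q^2 + s^2 \<noteq> 0" using q by (metis add_pos_nonneg zero_le_power2 less_irrefl zero_less_power)
        have "1 + (s / q)^2 = (q^2 + s^2) / q^2" using q by (simp add: power_divide add_divide_distrib)
        then have i: "inverse (1 + (s / q)^2) = q^2 / (q^2 + s^2)" by simp
        have "1 + 2 * (q^2 / (q^2 + s^2) * ((p * cos t * q - s * s) / (q * q))) = (q^2 + s^2 + 2 * (p * cos t * q - s * s)) / (q^2 + s^2)"
        proof -
          have *: "1 + 2 * (u / d * (v / u)) = (d + 2 * v) / d" if "u \<noteq> 0" "d \<noteq> 0" for u d v :: real
            using that by (simp add: field_simps)
          show ?thesis unfolding power2_eq_square[of q] by (rule *) (use q nz in \<open>auto simp: power2_eq_square\<close>)
        qed
        moreover have "q^2 + s^2 + 2 * (p * cos t * q - s * s) = 1 - p^2"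
        proof -
          have "p * cos t = 1 - q" by (simp add: q_def)
          moreover have "q^2 + s^2 = 1 + p^2 - 2 * (1 - q)" using D[of t] by (simp add: q_def s_def)
          ultimately have "q^2 + s^2 + 2 * ((1 - q) * q - s * s) = 1 - p^2"
            by (simp add: power2_eq_square algebra_simps)
          then show ?thesis unfolding \<open>p * cos t = 1 - q\<close> .
        qed
        ultimately show ?thesis unfolding i by simp
      qed
      finally show ?thesis unfolding q_def s_def D[symmetric] .
    qed
    have d: "(\<Psi> has_real_derivative (sin t)^2 / (1 + p^2 - 2 * p * cos t)) (at t)" for t
    proof -
      define d where "d = 1 + p^2 - 2 * p * cos t"
      have d: "d > 0" using Dpos by (simp add: d_def)
      have "(\<Psi> has_real_derivative (2 * (1 + p^2) * 1 - ((1 + p^2) * 1 - 2 * p * cos t) - (1 - p^2) * ((1 - p^2) / d)) / (4 * p^2)) (at t)"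
        unfolding \<Psi>_def[abs_def] d_def by (intro DERIV_cdivide DERIV_diff DERIV_cmult DERIV_ident DERIV_sin dP)
      also have "(2 * (1 + p^2) * 1 - ((1 + p^2) * 1 - 2 * p * cos t) - (1 - p^2) * ((1 - p^2) / d)) = (2 * (1 + p^2) * d - d^2 - (1 - p^2)^2) / d"
      proof -
        have "k * 1 - (l * 1 - v) - e * (e / d) = (k * d - d^2 - e^2) / d" if "l - v = d" for k l v e :: real
        proof -
          have "k * 1 - (l * 1 - v) = k - d" using that by simp
          then show ?thesis using d by (simp only:) (simp add: power2_eq_square diff_divide_distrib)
        qed
        from this[OF d_def[symmetric]] show ?thesis .
      qed
      also have "2 * (1 + p^2) * d - d^2 - (1 - p^2)^2 = 4 * p^2 * (1 - (cos t)^2)"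
        unfolding d_def by (simp add: power2_eq_square algebra_simps)
      also have "4 * p^2 * (1 - (cos t)^2) / d / (4 * p^2) = (sin t)^2 / d"
        using 3 by (simp add: sin_squared_eq)
      finally show ?thesis unfolding d_def .
    qed
    show thesis
    proof (rule that[of \<Psi>])
      show "continuous_on {0..pi} \<Psi>" by (rule DERIV_continuous_on[OF has_field_derivative_at_within[OF d]])
      show "\<Psi> pi - \<Psi> 0 = pi / 2" using 3 by (simp add: \<Psi>_def P_def field_simps power2_eq_square)
    qed (rule d)
  qed
qed

text \<open>Partial fractions: with \<open>A\<close>, \<open>B\<close> the two denominators,
  \<open>p * B + m * A = (p + m) * (1 + p * m)\<close> does not depend on \<open>t\<close>. The
  factor with \<open>+ 2 * m * cos t\<close> reduces to the previous lemma by the reflection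
  \<open>t \<mapsto> pi - t\<close>.\<close>

lemma poisson_sine_product_antiderivative:
  assumes "0 \<le> p" "p \<le> (1::real)" "0 \<le> m" "m \<le> 1"
  obtains \<Psi> where "continuous_on {0..pi} \<Psi>"
    "\<And>t. t \<in> {0<..<pi} \<Longrightarrow>
       (\<Psi> has_real_derivative (sin t)^2 / ((1 + p^2 - 2 * p * cos t) * (1 + m^2 + 2 * m * cos t))) (at t)"
    "\<Psi> pi - \<Psi> 0 = pi / (2 * (1 + p * m))"
proof -
  have pos: "1 + q^2 - 2 * q * cos t > 0" if "0 \<le> q" "q \<le> 1" "t \<in> {0<..<pi}" for q t :: real
  proof -
    have "cos t < 1" using that cos_monotone_0_pi[of 0 t] by auto
    have "1 + q^2 - 2 * q * cos t = (1 - q)^2 + 2 * q * (1 - cos t)" by (simp add: power2_eq_square algebra_simps)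
    moreover have "q > 0 \<or> (1 - q)^2 > 0" using that by auto
    ultimately show ?thesis using \<open>cos t < 1\<close> that
      by (smt (verit) mult_pos_pos mult_nonneg_nonneg zero_le_power2)
  qed
  obtain F where F: "continuous_on {0..pi} F"
    "\<And>t. t \<in> {0<..<pi} \<Longrightarrow> (F has_real_derivative (sin t)^2 / (1 + p^2 - 2 * p * cos t)) (at t)"
    "F pi - F 0 = pi / 2" using poisson_sine_antiderivative[OF assms(1,2)] by blast
  obtain G where G: "continuous_on {0..pi} G"
    "\<And>t. t \<in> {0<..<pi} \<Longrightarrow> (G has_real_derivative (sin t)^2 / (1 + m^2 - 2 * m * cos t)) (at t)"
    "G pi - G 0 = pi / 2" using poisson_sine_antiderivative[OF assms(3,4)] by blast
  show thesis
  proof (cases "p + m = 0")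
    case True
    then have "p = 0" "m = 0" using assms by auto
    then show thesis using F that[of F] by simp
  next
    case False
    define \<Psi> where "\<Psi> t = (p * F t - m * G (pi - t)) / ((p + m) * (1 + p * m))" for t
    have nz: "(p + m) * (1 + p * m) \<noteq> 0" using False assms by (simp add: add_nonneg_eq_0_iff)
    show thesis
    proof (rule that[of \<Psi>])
      have "continuous_on {0..pi} (\<lambda>t. G (pi - t))"
        by (rule continuous_on_compose2[OF G(1)]) (auto intro!: continuous_intros)
      then show "continuous_on {0..pi} \<Psi>" unfolding \<Psi>_def[abs_def] using F(1) nz by (auto intro!: continuous_intros)
      show "\<Psi> pi - \<Psi> 0 = pi / (2 * (1 + p * m))"
      proof -
        have "\<Psi> pi - \<Psi> 0 = (p * (F pi - F 0) + m * (G pi - G 0)) / ((p + m) * (1 + p * m))"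
          unfolding \<Psi>_def by (simp add: diff_divide_distrib[symmetric] algebra_simps)
        also have "\<dots> = ((p + m) * (pi / 2)) / ((p + m) * (1 + p * m))"
          by (simp only: F(3) G(3) distrib_right)
        also have "\<dots> = (pi / 2) / (1 + p * m)" by (rule mult_divide_mult_cancel_left[OF False])
        finally show ?thesis by simp
      qed
      fix t :: real assume t: "t \<in> {0<..<pi}"
      have t': "pi - t \<in> {0<..<pi}" using t by auto
      define A where "A = 1 + p^2 - 2 * p * cos t" define B where "B = 1 + m^2 + 2 * m * cos t"
      have AB: "A > 0" "B > 0" using pos[OF assms(1,2) t] pos[OF assms(3,4) t'] by (auto simp: A_def B_def)
      have "((\<lambda>t. G (pi - t)) has_real_derivative (sin (pi - t))^2 / (1 + m^2 - 2 * m * cos (pi - t)) * (0 - 1)) (at t)"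
        by (rule DERIV_chain2[of G _ "\<lambda>t. pi - t", OF G(2)[OF t']]) (auto intro!: derivative_eq_intros)
      then have "(\<Psi> has_real_derivative (p * ((sin t)^2 / A) - m * ((sin t)^2 / B * (0 - 1))) / ((p + m) * (1 + p * m))) (at t)"
        unfolding \<Psi>_def[abs_def] A_def B_def
        using F(2)[OF t] by (intro DERIV_cdivide DERIV_diff DERIV_cmult) simp_all
      also have "(p * ((sin t)^2 / A) - m * ((sin t)^2 / B * (0 - 1))) = (sin t)^2 * (p * B + m * A) / (A * B)"
        using AB by (simp add: field_simps)
      also have "p * B + m * A = (p + m) * (1 + p * m)" unfolding A_def B_def by (simp add: power2_eq_square algebra_simps)
      finally show "(\<Psi> has_real_derivative (sin t)^2 / ((1 + p^2 - 2 * p * cos t) * (1 + m^2 + 2 * m * cos t))) (at t)"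
        using nz unfolding A_def[symmetric] B_def[symmetric] by simp
    qed
  qed
qed

text \<open>Up to the factor \<open>4 * b2\<close>, the denominator is the squared modulus of the
  numerator of the limiting Stieltjes transform: a real square plus \<open>b1^2\<close> times the
  radicand.\<close>

lemma limit_density_denominator_pos:
  fixes a1 a2 b1 b2 x :: real
  assumes "b1 > 0" "b2 > 0" "\<bar>x - a2\<bar> < 2 * sqrt b2"
  shows "(b2 - b1) * x^2 + (b1 * a2 + b1 * a1 - 2 * b2 * a1) * x + b2 * a1^2 - a1 * a2 * b1 + b1^2 > 0"
    (is "?D > 0")
proof -
  have "(x - a2)^2 < (2 * sqrt b2)^2" using assms by (metis abs_ge_zero power2_abs power_strict_mono zero_less_numeral)
  then have "4 * b2 - (x - a2)^2 > 0" using assms by (simp add: power_mult_distrib)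
  then have "b1^2 * (4 * b2 - (x - a2)^2) > 0" using assms by (intro mult_pos_pos) auto
  moreover have "4 * b2 * ?D = (b1 * (a2 - a1) + (2 * b2 - b1) * (x - a1))^2 + b1^2 * (4 * b2 - (x - a2)^2)"
    by (simp add: power2_eq_square algebra_simps)
  ultimately have "4 * b2 * ?D > 0" by (simp add: add_nonneg_pos)
  then show ?thesis using assms(2) by (simp add: zero_less_mult_iff)
qed

text \<open>With \<open>x = a2 - 2 * sqrt b2 * cos t\<close> the density becomes a product of two Poisson kernels, whose
  parameters \<open>p\<close>, \<open>m\<close> lie in the unit interval by the assumption on the discriminant.\<close>
lemma limit_density_has_integral:
  assumes b: "b1 > 0" "b2 > 0" "b2 \<le> b1" "b1 \<le> 2 * b2" and disc: "(a2 - a1)^2 * b2 \<le> (2 * b2 - b1)^2"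
  shows "(limit_density a1 a2 b1 b2 has_integral 1) {a2 - 2 * sqrt b2 .. a2 + 2 * sqrt b2}"
proof -
  define r where "r = sqrt b2"
  define \<kappa> where "\<kappa> = (b1 - b2) / b2"
  define s where "s = (a2 - a1) / r"
  \<comment> \<open>Matching the denominator with two Poisson factors demands
    \<open>m - p = s\<close> and \<open>p * m = \<kappa>\<close>; hence \<open>m\<close> and
    \<open>- p\<close> are the roots of \<open>X^2 - s * X - \<kappa>\<close>.\<close>
  define p where "p = (sqrt (s^2 + 4 * \<kappa>) - s) / 2"
  define m where "m = (sqrt (s^2 + 4 * \<kappa>) + s) / 2"
  have r: "r > 0" "r^2 = b2" using b by (auto simp: r_def)
  have kap: "\<kappa> \<ge> 0" "\<kappa> \<le> 1" using b by (auto simp: \<kappa>_def field_simps)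
  have k1: "1 - \<kappa> = (2 * b2 - b1) / b2" and k2: "1 + \<kappa> = b1 / b2" using b by (simp_all add: \<kappa>_def field_simps)
  \<comment> \<open>The discriminant assumption divided by \<open>b2^2\<close>. The resulting
    \<open>\<bar>s\<bar> \<le> 1 - \<kappa>\<close> is what puts both \<open>p\<close> and
    \<open>m\<close> below one.\<close>
  have "s^2 \<le> (1 - \<kappa>)^2"
  proof -
    have "s^2 = (a2 - a1)^2 * b2 / b2^2" using b r by (simp add: s_def power_divide power2_eq_square)
    also have "\<dots> \<le> (2 * b2 - b1)^2 / b2^2" by (intro divide_right_mono disc) auto
    finally show ?thesis by (simp add: k1 power_divide)
  qed
  then have s: "\<bar>s\<bar> \<le> 1 - \<kappa>" using kap by (metis abs_le_square_iff abs_of_nonneg diff_ge_0_iff_ge)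
  have sq: "sqrt (s^2 + 4 * \<kappa>) \<ge> \<bar>s\<bar>" using kap by (intro real_le_rsqrt) simp
  have ub: "sqrt (s^2 + 4 * \<kappa>) \<le> 2 + s" "sqrt (s^2 + 4 * \<kappa>) \<le> 2 - s"
    by (rule real_le_lsqrt; use s kap in \<open>simp add: power2_eq_square algebra_simps\<close>)+
  have pm: "0 \<le> p" "p \<le> 1" "0 \<le> m" "m \<le> 1" using sq ub by (auto simp: p_def m_def)
  have mp: "m - p = s" by (simp add: m_def p_def field_simps)
  have pmk: "p * m = \<kappa>"
  proof -
    have "p * m = ((sqrt (s^2 + 4 * \<kappa>))^2 - s^2) / 4" by (simp add: p_def m_def power2_eq_square algebra_simps)
    then show ?thesis using kap by simp
  qed
  obtain \<Psi> where \<Psi>: "continuous_on {0..pi} \<Psi>"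
    "\<And>t. t \<in> {0<..<pi} \<Longrightarrow>
       (\<Psi> has_real_derivative (sin t)^2 / ((1 + m^2 - 2 * m * cos t) * (1 + p^2 + 2 * p * cos t))) (at t)"
    "\<Psi> pi - \<Psi> 0 = pi / (2 * (1 + m * p))"
    using poisson_sine_product_antiderivative[OF pm(3,4) pm(1,2)] by blast
  define \<phi> where "\<phi> x = arccos ((a2 - x) / (2 * r))" for x
  define F where "F x = 2 / pi * (1 + \<kappa>) * \<Psi> (\<phi> x)" for x
  have arg: "(a2 - x) / (2 * r) \<in> {-1..1}" if "x \<in> {a2 - 2 * r .. a2 + 2 * r}" for x
    using that r by (simp add: field_simps)
  have "(limit_density a1 a2 b1 b2 has_integral (F (a2 + 2 * r) - F (a2 - 2 * r))) {a2 - 2 * r .. a2 + 2 * r}"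
  \<comment> \<open>The angle \<open>arccos\<close> is continuous but not differentiable at the ends
    of the support, hence the interior version.\<close>
  proof (rule fundamental_theorem_of_calculus_interior)
    show "a2 - 2 * r \<le> a2 + 2 * r" using r by simp
    have "continuous_on {a2 - 2 * r .. a2 + 2 * r} \<phi>" unfolding \<phi>_def[abs_def]
      by (rule continuous_on_compose2[OF continuous_on_arccos'])
         (use arg r in \<open>auto intro!: continuous_intros\<close>)
    moreover have "\<phi> ` {a2 - 2 * r .. a2 + 2 * r} \<subseteq> {0..pi}"
      using arg by (auto simp: \<phi>_def intro!: arccos_lbound arccos_ubound)
    ultimately have "continuous_on {a2 - 2 * r .. a2 + 2 * r} (\<lambda>x. \<Psi> (\<phi> x))"
      using continuous_on_compose2[OF \<Psi>(1)] by blast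
    then show "continuous_on {a2 - 2 * r .. a2 + 2 * r} F" unfolding F_def[abs_def] by (intro continuous_intros)
  next
    fix x assume x: "x \<in> {a2 - 2 * r <..< a2 + 2 * r}"
    define v where "v = (a2 - x) / (2 * r)"
    define t where "t = \<phi> x"
    have v: "-1 < v" "v < 1" using x r by (auto simp: v_def field_simps)
    have cost: "cos t = v" unfolding t_def \<phi>_def v_def[symmetric] using v by (intro cos_arccos) auto
    have tt: "t \<in> {0<..<pi}" unfolding t_def \<phi>_def v_def[symmetric] using v by (auto intro!: arccos_lt_bounded)
    have st: "sin t > 0" using tt by (auto intro!: sin_gt_zero)
    have st2: "sqrt (1 - v^2) = sin t" unfolding cost[symmetric] sin_squared_eq[symmetric] using st by simp
    have "((\<lambda>x. (a2 - x) / (2 * r)) has_real_derivative - 1 / (2 * r)) (at x)"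
      using r by (auto intro!: derivative_eq_intros)
    then have "(\<phi> has_real_derivative inverse (- sqrt (1 - v^2)) * (- 1 / (2 * r))) (at x)"
      unfolding \<phi>_def[abs_def] v_def
      by (intro DERIV_chain2[OF DERIV_arccos]) (use v in \<open>simp_all add: v_def\<close>)
    also have "inverse (- sqrt (1 - v^2)) * (- 1 / (2 * r)) = 1 / (2 * r * sin t)"
      unfolding st2 by (simp add: field_simps)
    finally have d\<phi>: "(\<phi> has_real_derivative 1 / (2 * r * sin t)) (at x)" .
    define E where "E = (1 + m^2 - 2 * m * cos t) * (1 + p^2 + 2 * p * cos t)"
    have "((\<lambda>x. \<Psi> (\<phi> x)) has_real_derivative (sin t)^2 / E * (1 / (2 * r * sin t))) (at x)"
      by (rule DERIV_chain2[OF _ d\<phi>]) (use \<Psi>(2)[OF tt] in \<open>simp add: t_def E_def\<close>)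
    then have dF: "(F has_real_derivative 2 / pi * (1 + \<kappa>) * ((sin t)^2 / E * (1 / (2 * r * sin t)))) (at x)"
      unfolding F_def[abs_def] by (rule DERIV_cmult)
    have xt: "x = a2 - 2 * r * cos t" using r by (simp add: cost v_def)
    have b1e: "b1 = r^2 * (1 + \<kappa>)" using r b by (simp add: k2)
    have b2e: "b2 = r^2" using r by simp
    have a1e: "a1 = a2 - r * (m - p)" using r by (simp add: mp s_def)
    \<comment> \<open>Expanded around \<open>a1\<close>, with
      \<open>x - a1 = r * (m - p - 2 * cos t)\<close> and \<open>b1 = r^2 * (1 + p * m)\<close>, the
      quadratic factors.\<close>
    have den: "(b2 - b1) * x^2 + (b1 * a2 + b1 * a1 - 2 * b2 * a1) * x + b2 * a1^2 - a1 * a2 * b1 + b1^2 = r^4 * E"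
    proof -
      have "(b2 - b1) * x^2 + (b1 * a2 + b1 * a1 - 2 * b2 * a1) * x + b2 * a1^2 - a1 * a2 * b1 + b1^2
        = b1^2 + b1 * (a2 - a1) * (x - a1) - (b1 - b2) * (x - a1)^2"
        by (simp add: power2_eq_square algebra_simps)
      also have "\<dots> = r^4 * E"
        unfolding b1e b2e a1e xt E_def pmk[symmetric] by algebra
      finally show ?thesis .
    qed
    have "4 * b2 - (x - a2)^2 = (2 * r * sin t)^2"
      unfolding b2e xt by (simp add: power_mult_distrib sin_squared_eq algebra_simps)
    then have "sqrt (4 * b2 - (x - a2)^2) = 2 * r * sin t" using r st by simp
    moreover have "\<bar>x - a2\<bar> \<le> 2 * sqrt b2" using x by (auto simp: r_def)
    ultimately have "limit_density a1 a2 b1 b2 x = b1 / (2 * pi) * (2 * r * sin t) / (r^4 * E)"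
      unfolding limit_density_def den by simp
    also have "\<dots> = 2 / pi * (1 + \<kappa>) * ((sin t)^2 / E * (1 / (2 * r * sin t)))"
      unfolding b1e using r(1) st
      by (cases "E = 0") (simp_all add: divide_simps power2_eq_square power4_eq_xxxx)
    finally show "(F has_vector_derivative limit_density a1 a2 b1 b2 x) (at x)"
      using dF by (simp add: has_real_derivative_iff_has_vector_derivative)
  qed
  moreover have "F (a2 + 2 * r) - F (a2 - 2 * r) = 1"
  proof -
    have "\<phi> (a2 + 2 * r) = pi" "\<phi> (a2 - 2 * r) = 0" using r by (simp_all add: \<phi>_def)
    then have "F (a2 + 2 * r) - F (a2 - 2 * r) = 2 / pi * (1 + \<kappa>) * (\<Psi> pi - \<Psi> 0)" by (simp only: F_def right_diff_distrib)
    also have "\<dots> = 1"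
    proof -
      have "2 / pi * k * (pi / (2 * k)) = 1" if "k > 0" for k :: real using that by simp
      from this[of "1 + \<kappa>"] show ?thesis unfolding \<Psi>(3) mult.commute[of m p] pmk using kap by simp
    qed
    finally show ?thesis .
  qed
  ultimately show ?thesis unfolding r_def by simp
qed

section \<open>Stieltjes inversion\<close>

text \<open>The root of the limiting quadratic equation, with numerator and denominator multiplied
  by \<open>b1\<close>. The root of \<open>(z - a2)^2 - 4 * b2\<close> is written as
  \<open>\<i> * csqrt (4 * b2 - (z - a2)^2)\<close>: this has positive imaginary part in the upper
  half-plane, and the cut of \<open>csqrt\<close> is avoided even on the open support interval, so
  the transform extends continuously to it.\<close>

definition jac_stieltjes :: "real \<Rightarrow> real \<Rightarrow> real \<Rightarrow> real \<Rightarrow> complex \<Rightarrow> complex" where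
  "jac_stieltjes a1 a2 b1 b2 z =
     (of_real (b1 * (a2 - a1)) + of_real (2 * b2 - b1) * (z - of_real a1)
        - of_real b1 * (\<i> * csqrt (of_real (4 * b2) - (z - of_real a2)^2))) /
     (2 * (of_real (b1^2) + of_real (b1 * (a2 - a1)) * (z - of_real a1) - of_real (b1 - b2) * (z - of_real a1)^2))"

definition cauchy_mean :: "nat \<Rightarrow> (nat \<Rightarrow> real) \<Rightarrow> complex \<Rightarrow> complex" where
  "cauchy_mean n y z = (\<Sum>i<n. 1 / (z - of_real (y i))) / of_nat n"

text \<open>For \<open>Im z > 0\<close> the value is real only if \<open>Re z = a2\<close>, and then
  it equals \<open>4 * b2 + (Im z)^2\<close>. On the real interval it is positive directly.\<close>

lemma csqrt_argument_notin_nonpos: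
  assumes "b2 > 0" "Im z > 0 \<or> Im z = 0 \<and> \<bar>Re z - a2\<bar> < 2 * sqrt b2"
  shows "of_real (4 * b2) - (z - of_real a2)^2 \<notin> \<real>\<^sub>\<le>\<^sub>0"
proof
  assume "of_real (4 * b2) - (z - of_real a2)^2 \<in> \<real>\<^sub>\<le>\<^sub>0"
  then have im: "Im z * (Re z - a2) = 0" and re: "4 * b2 \<le> (Re z - a2)^2 - (Im z)^2"
    by (auto simp: complex_nonpos_Reals_iff power2_eq_square algebra_simps)
  show False
  proof (cases "Im z = 0")
    case True
    then have "\<bar>Re z - a2\<bar> < 2 * sqrt b2" using assms by auto
    then have "(Re z - a2)^2 < (2 * sqrt b2)^2" by (metis abs_ge_zero power2_abs power_strict_mono zero_less_numeral)
    then show False using re True assms by (simp add: power_mult_distrib)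
  next
    case False
    then have "Re z - a2 = 0" using im by simp
    then have "4 * b2 + (Im z)^2 \<le> 0" using re by simp
    then show False using assms(1) by (smt (verit) zero_le_power2)
  qed
qed

text \<open>A quadratic with real coefficients, positive constant term and leading coefficient
  \<open>b2 - b1 \<le> 0\<close> has no roots off the real line: eliminating the linear coefficient
  between real and imaginary parts leaves a sum that is at least \<open>b1^2\<close>.\<close>

lemma jac_stieltjes_denominator_nonzero:
  assumes b: "b1 > 0" "b2 > 0" "b2 \<le> b1" and z: "Im z > 0 \<or> Im z = 0 \<and> \<bar>Re z - a2\<bar> < 2 * sqrt b2"
  shows "of_real (b1^2) + of_real (b1 * (a2 - a1)) * (z - of_real a1) - of_real (b1 - b2) * (z - of_real a1)^2 \<noteq> 0" (is "?D \<noteq> 0")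
proof (cases "Im z = 0")
  case True
  then have "z = of_real (Re z)" by (simp add: complex_eq_iff)
  define x where "x = Re z"
  have "?D = of_real (b1^2 + b1 * (a2 - a1) * (x - a1) - (b1 - b2) * (x - a1)^2)"
    unfolding x_def by (subst (1 2) \<open>z = of_real (Re z)\<close>) simp
  also have "b1^2 + b1 * (a2 - a1) * (x - a1) - (b1 - b2) * (x - a1)^2
    = (b2 - b1) * x^2 + (b1 * a2 + b1 * a1 - 2 * b2 * a1) * x + b2 * a1^2 - a1 * a2 * b1 + b1^2"
    by (simp add: power2_eq_square algebra_simps)
  finally show ?thesis
    using limit_density_denominator_pos[of b1 b2 x a2 a1] b z True unfolding x_def
    by (metis less_irrefl of_real_eq_0_iff)
next
  case False
  then have y: "Im z > 0" using z by auto
  define u where "u = Re z - a1"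
  show ?thesis
  proof
    assume "?D = 0"
    then have "Re ?D = 0" "Im ?D = 0" by auto
    then have re: "b1^2 + b1 * (a2 - a1) * u - (b1 - b2) * (u^2 - (Im z)^2) = 0"
      and im: "Im z * (b1 * (a2 - a1) - 2 * (b1 - b2) * u) = 0"
      by (auto simp: u_def power2_eq_square algebra_simps)
    from im y have "b1 * (a2 - a1) = 2 * (b1 - b2) * u" by simp
    then have "b1^2 + (2 * (b1 - b2) * u) * u - (b1 - b2) * (u^2 - (Im z)^2) = 0"
      using re by (simp only:)
    then have "b1^2 + (b1 - b2) * u^2 + (b1 - b2) * (Im z)^2 = 0"
      by (simp add: power2_eq_square algebra_simps)
    moreover have "b1^2 > 0" "(b1 - b2) * u^2 \<ge> 0" "(b1 - b2) * (Im z)^2 \<ge> 0" using b by auto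
    ultimately show False by linarith
  qed
qed

lemma jac_stieltjes_boundary:
  assumes b: "b1 > 0" "b2 > 0" and x: "\<bar>x - a2\<bar> < 2 * sqrt b2"
  shows "- Im (jac_stieltjes a1 a2 b1 b2 (of_real x)) / pi = limit_density a1 a2 b1 b2 x"
proof -
  define E where "E = b1^2 + b1 * (a2 - a1) * (x - a1) - (b1 - b2) * (x - a1)^2"
  define N where "N = b1 * (a2 - a1) + (2 * b2 - b1) * (x - a1)"
  have E: "E = (b2 - b1) * x^2 + (b1 * a2 + b1 * a1 - 2 * b2 * a1) * x + b2 * a1^2 - a1 * a2 * b1 + b1^2"
    by (simp add: E_def power2_eq_square algebra_simps)
  have "(x - a2)^2 \<le> (2 * sqrt b2)^2" using x by (intro abs_le_square_iff[THEN iffD1]) auto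
  then have nn: "4 * b2 - (x - a2)^2 \<ge> 0" using b by (simp add: power_mult_distrib)
  have "jac_stieltjes a1 a2 b1 b2 (of_real x) = (of_real N - of_real b1 * (\<i> * csqrt (of_real (4 * b2 - (x - a2)^2)))) / of_real (2 * E)"
    by (simp add: jac_stieltjes_def E_def N_def)
  also have "csqrt (of_real (4 * b2 - (x - a2)^2)) = of_real (sqrt (4 * b2 - (x - a2)^2))"
    by (rule of_real_sqrt[OF nn, symmetric])
  finally have "Im (jac_stieltjes a1 a2 b1 b2 (of_real x)) = - b1 * sqrt (4 * b2 - (x - a2)^2) / (2 * E)"
    unfolding Im_divide_of_real by simp
  then show ?thesis using x by (simp add: limit_density_def E)
qed

lemma continuous_on_jac_stieltjes:
  assumes b: "b1 > 0" "b2 > 0" "b2 \<le> b1"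
  shows "continuous_on {z. Im z > 0 \<or> Im z = 0 \<and> \<bar>Re z - a2\<bar> < 2 * sqrt b2} (jac_stieltjes a1 a2 b1 b2)"
proof -
  let ?S = "{z. Im z > 0 \<or> Im z = 0 \<and> \<bar>Re z - a2\<bar> < 2 * sqrt b2}"
  have "continuous_on ?S (\<lambda>z. csqrt (of_real (4 * b2) - (z - of_real a2)^2))"
  proof (rule continuous_on_compose2[of "- \<real>\<^sub>\<le>\<^sub>0" csqrt])
    show "continuous_on (- \<real>\<^sub>\<le>\<^sub>0) csqrt" by (intro continuous_at_imp_continuous_on ballI continuous_at_csqrt) auto
    show "(\<lambda>z. of_real (4 * b2) - (z - of_real a2)^2) ` ?S \<subseteq> - \<real>\<^sub>\<le>\<^sub>0"
      using csqrt_argument_notin_nonpos[OF b(2)] by blast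
  qed (intro continuous_intros)
  then have num: "continuous_on ?S (\<lambda>z. of_real (b1 * (a2 - a1)) + of_real (2 * b2 - b1) * (z - of_real a1)
      - of_real b1 * (\<i> * csqrt (of_real (4 * b2) - (z - of_real a2)^2)))"
    by (intro continuous_on_diff continuous_on_add continuous_on_mult continuous_on_const continuous_on_id)
  have den: "continuous_on ?S (\<lambda>z. 2 * (of_real (b1^2) + of_real (b1 * (a2 - a1)) * (z - of_real a1)
      - of_real (b1 - b2) * (z - of_real a1)^2))"
    by (intro continuous_intros)
  have "2 * (of_real (b1^2) + of_real (b1 * (a2 - a1)) * (z - of_real a1) - of_real (b1 - b2) * (z - of_real a1)^2) \<noteq> 0"
    if "z \<in> ?S" for z
    using jac_stieltjes_denominator_nonzero[OF b, of z a2 a1] that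
    unfolding mem_Collect_eq mult_eq_0_iff by simp
  then show ?thesis
    unfolding jac_stieltjes_def[abs_def] by (intro continuous_on_divide[OF num den] ballI)
qed

text \<open>Beyond \<open>K\<close> the arctangent is within \<open>arctan (1 / K)\<close> of
  \<open>pi / 2\<close>. This controls the tail of the Cauchy kernel.\<close>

lemma arctan_diff_le:
  assumes "0 < K" "K \<le> s" "K \<le> t"
  shows "arctan s - arctan t \<le> 1 / K"
proof -
  have "arctan s - arctan t \<le> pi / 2 - arctan K" using assms arctan_ubound[of s] arctan_monotone'[of K t] by linarith
  also have "\<dots> = arctan (1 / K)" using assms arctan_inverse[of K] by (simp add: inverse_eq_divide)
  also have "\<dots> \<le> 1 / K" using assms by (intro arctan_le_self) auto
  finally show ?thesis .
qed

text \<open>\<open>- Im / pi\<close> of a single resolvent is the Cauchy density of width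
  \<open>\<eta>\<close> centred at the atom, so every atom contributes a smoothed indicator of the
  window.\<close>

lemma Im_cauchy_mean_integral:
  assumes "\<alpha> \<le> \<beta>" "\<eta> > 0"
  shows "((\<lambda>x. - Im (cauchy_mean n y (Complex x \<eta>)) / pi) has_integral
     (\<Sum>i<n. (arctan ((\<beta> - y i) / \<eta>) - arctan ((\<alpha> - y i) / \<eta>)) / pi) / real n) {\<alpha>..\<beta>}"
proof -
  have "((\<lambda>x. - Im (1 / (Complex x \<eta> - of_real t)) / pi) has_integral
     arctan ((\<beta> - t) / \<eta>) / pi - arctan ((\<alpha> - t) / \<eta>) / pi) {\<alpha>..\<beta>}" for t
  proof (rule fundamental_theorem_of_calculus[OF assms(1)])
    fix x
    have "((\<lambda>x. arctan ((x - t) / \<eta>) / pi) has_real_derivative (inverse (1 + ((x - t) / \<eta>)^2) * (1 / \<eta>)) / pi) (at x)"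
      by (intro DERIV_cdivide DERIV_chain2[OF DERIV_arctan]) (use assms in \<open>auto intro!: derivative_eq_intros\<close>)
    also have "inverse (1 + ((x - t) / \<eta>)^2) * (1 / \<eta>) = - Im (1 / (Complex x \<eta> - of_real t))"
    proof -
      have "1 + ((x - t) / \<eta>)^2 = ((x - t)^2 + \<eta>^2) / \<eta>^2" using assms by (simp add: power_divide field_simps)
      then have "inverse (1 + ((x - t) / \<eta>)^2) * (1 / \<eta>) = \<eta> / ((x - t)^2 + \<eta>^2)"
        using assms by (simp add: power2_eq_square)
      then show ?thesis by (simp add: Im_divide)
    qed
    finally show "((\<lambda>x. arctan ((x - t) / \<eta>) / pi) has_vector_derivative - Im (1 / (Complex x \<eta> - of_real t)) / pi) (at x within {\<alpha>..\<beta>})"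
      by (simp add: has_real_derivative_iff_has_vector_derivative has_vector_derivative_at_within)
  qed
  then have "((\<lambda>x. (\<Sum>i<n. - Im (1 / (Complex x \<eta> - of_real (y i))) / pi) / real n) has_integral
     (\<Sum>i<n. arctan ((\<beta> - y i) / \<eta>) / pi - arctan ((\<alpha> - y i) / \<eta>) / pi) / real n) {\<alpha>..\<beta>}"
    by (intro has_integral_divide has_integral_sum) auto
  moreover have "(\<Sum>i<n. - Im (1 / (Complex x \<eta> - of_real (y i))) / pi) / real n = - Im (cauchy_mean n y (Complex x \<eta>)) / pi" for x
  proof -
    have "Im (cauchy_mean n y (Complex x \<eta>)) = (\<Sum>i<n. Im (1 / (Complex x \<eta> - of_real (y i)))) / real n"
      unfolding cauchy_mean_def by (simp only: Im_divide_of_nat Im_sum)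
    then show ?thesis by (simp add: sum_divide_distrib[symmetric] sum_negf)
  qed
  ultimately show ?thesis by (simp add: diff_divide_distrib)
qed

lemma norm_cauchy_mean_le:
  assumes "Im z > 0"
  shows "cmod (cauchy_mean n y z) \<le> 1 / Im z"
proof -
  have "cmod (\<Sum>i<n. 1 / (z - of_real (y i))) \<le> (\<Sum>i<n. 1 / Im z)"
  proof (rule sum_norm_le)
    fix i
    have "Im z \<le> cmod (z - of_real (y i))" using abs_Im_le_cmod[of "z - of_real (y i)"] by simp
    then show "cmod (1 / (z - of_real (y i))) \<le> 1 / Im z"
      using assms by (simp add: norm_divide frac_le)
  qed
  then have *: "cmod (\<Sum>i<n. 1 / (z - of_real (y i))) \<le> real n * (1 / Im z)" by simp
  show ?thesis
  proof (cases "n = 0")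
    case False
    have "cmod (cauchy_mean n y z) = cmod (\<Sum>i<n. 1 / (z - of_real (y i))) / real n"
      by (simp add: cauchy_mean_def norm_divide)
    also have "\<dots> \<le> real n * (1 / Im z) / real n" by (intro divide_right_mono *) auto
    finally show ?thesis using False by simp
  qed (use assms in \<open>simp add: cauchy_mean_def\<close>)
qed

text \<open>The smoothed indicator of the window is at most one and is small off its
  \<open>\<kappa>\<close>-neighbourhood, so its mean bounds the fraction of points in that
  neighbourhood from below. The window lies strictly inside the support, where the limiting
  transform is continuous up to the real line.\<close>

lemma count_ge_of_stieltjes_convergence:
  assumes b: "b1 > 0" "b2 > 0" "b2 \<le> b1"
    and conv: "\<And>z. Im z > 0 \<Longrightarrow> (\<lambda>n. cauchy_mean n (y n) z) \<longlonglongrightarrow> jac_stieltjes a1 a2 b1 b2 z"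
    and ab: "a2 - 2 * sqrt b2 < \<alpha>" "\<alpha> < \<beta>" "\<beta> < a2 + 2 * sqrt b2" and "\<kappa> > 0" "e > 0"
  shows "eventually (\<lambda>n. real (card {i\<in>{..<n}. \<alpha> - \<kappa> \<le> y n i \<and> y n i \<le> \<beta> + \<kappa>}) / real n
           \<ge> integral {\<alpha>..\<beta>} (limit_density a1 a2 b1 b2) - e) sequentially"
proof -
  define g where "g \<eta> x = - Im (jac_stieltjes a1 a2 b1 b2 (Complex x \<eta>)) / pi" for \<eta> x
  \<comment> \<open>The parameter interval includes \<open>\<eta> = 0\<close>: boundary values and
    smoothed values are compared by plain continuity.\<close>
  have cont: "continuous_on {0..1} (\<lambda>\<eta>. integral (cbox \<alpha> \<beta>) (g \<eta>))"
  proof (rule integral_continuous_on_param)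
    have "continuous_on ({0..1} \<times> cbox \<alpha> \<beta>) (\<lambda>p. Complex (snd p) (fst p))"
      unfolding Complex_eq by (intro continuous_intros)
    moreover have "(\<lambda>p. Complex (snd p) (fst p)) ` ({0..1} \<times> cbox \<alpha> \<beta>) \<subseteq> {z. Im z > 0 \<or> Im z = 0 \<and> \<bar>Re z - a2\<bar> < 2 * sqrt b2}"
      using ab by auto
    ultimately have "continuous_on ({0..1} \<times> cbox \<alpha> \<beta>) (\<lambda>p. jac_stieltjes a1 a2 b1 b2 (Complex (snd p) (fst p)))"
      using continuous_on_compose2[OF continuous_on_jac_stieltjes[OF b, of a2 a1]] by blast
    then show "continuous_on ({0..1} \<times> cbox \<alpha> \<beta>) (\<lambda>(\<eta>, x). g \<eta> x)"
      unfolding g_def split_beta' by (intro continuous_intros) auto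
  qed
  have g0: "integral (cbox \<alpha> \<beta>) (g 0) = integral {\<alpha>..\<beta>} (limit_density a1 a2 b1 b2)"
    unfolding cbox_interval
  proof (rule integral_cong)
    fix x assume "x \<in> {\<alpha>..\<beta>}"
    then have "\<bar>x - a2\<bar> < 2 * sqrt b2" using ab by auto
    then show "g 0 x = limit_density a1 a2 b1 b2 x"
      using jac_stieltjes_boundary[OF b(1,2)] by (simp add: g_def complex_of_real_def)
  qed
  obtain d where d: "d > 0" "\<And>\<eta>. \<eta> \<in> {0..1} \<Longrightarrow> dist \<eta> 0 < d \<Longrightarrow>
      dist (integral (cbox \<alpha> \<beta>) (g \<eta>)) (integral (cbox \<alpha> \<beta>) (g 0)) < e / 3"
  proof -
    have "0 \<in> {0..1::real}" "e / 3 > 0" using \<open>e > 0\<close> by auto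
    then show thesis using cont that unfolding continuous_on_iff by blast
  qed
  \<comment> \<open>The three bounds serve continuity at zero, membership in the parameter interval,
    and the kernel tail \<open>\<eta> / \<kappa> \<le> e / 3\<close>.\<close>
  define \<eta> where "\<eta> = min (min (d / 2) 1) (e * \<kappa> / 3)"
  have \<eta>: "\<eta> > 0" "\<eta> \<le> 1" "\<eta> < d" "\<eta> / \<kappa> \<le> e / 3"
    using d(1) assms(8,9) by (auto simp: \<eta>_def min_def field_simps)
  have I: "integral {\<alpha>..\<beta>} (g \<eta>) > integral {\<alpha>..\<beta>} (limit_density a1 a2 b1 b2) - e / 3"
  proof -
    have "dist (integral (cbox \<alpha> \<beta>) (g \<eta>)) (integral (cbox \<alpha> \<beta>) (g 0)) < e / 3"
      using d(2)[of \<eta>] \<eta> by simp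
    then show ?thesis unfolding g0 unfolding dist_real_def cbox_interval by linarith
  qed
  define h where "h t = (arctan ((\<beta> - t) / \<eta>) - arctan ((\<alpha> - t) / \<eta>)) / pi" for t
  have hi: "((\<lambda>x. - Im (cauchy_mean n (y n) (Complex x \<eta>)) / pi) has_integral (\<Sum>i<n. h (y n i)) / real n) {\<alpha>..\<beta>}" for n
    unfolding h_def using ab \<eta> by (intro Im_cauchy_mean_integral) auto
  note int = integral_unique[OF hi] has_integral_integrable[OF hi]
  have "(\<lambda>n. integral {\<alpha>..\<beta>} (\<lambda>x. - Im (cauchy_mean n (y n) (Complex x \<eta>)) / pi)) \<longlonglongrightarrow> integral {\<alpha>..\<beta>} (g \<eta>)"
  proof (rule dominated_convergence(2))
    show "(\<lambda>x. 1 / \<eta> / pi) integrable_on {\<alpha>..\<beta>}" by (rule integrable_const_ivl)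
    fix n x
    have le: "\<bar>Im (cauchy_mean n (y n) (Complex x \<eta>))\<bar> \<le> 1 / \<eta>"
      using order_trans[OF abs_Im_le_cmod norm_cauchy_mean_le[of "Complex x \<eta>" n "y n"]] \<eta> by simp
    show "norm (- Im (cauchy_mean n (y n) (Complex x \<eta>)) / pi) \<le> 1 / \<eta> / pi"
    proof -
      have "norm (- Im (cauchy_mean n (y n) (Complex x \<eta>)) / pi) = \<bar>Im (cauchy_mean n (y n) (Complex x \<eta>))\<bar> / pi" by simp
      also have "\<dots> \<le> 1 / \<eta> / pi" by (rule divide_right_mono[OF le]) simp
      finally show ?thesis .
    qed
  next
    fix x
    show "(\<lambda>n. - Im (cauchy_mean n (y n) (Complex x \<eta>)) / pi) \<longlonglongrightarrow> g \<eta> x"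
      unfolding g_def using \<eta> by (intro tendsto_divide tendsto_minus tendsto_Im conv tendsto_const) simp_all
  qed (rule int(2))
  then have "eventually (\<lambda>n. (\<Sum>i<n. h (y n i)) / real n > integral {\<alpha>..\<beta>} (limit_density a1 a2 b1 b2) - e / 3) sequentially"
    unfolding int using I by (rule order_tendstoD)
  then show ?thesis
    using eventually_gt_at_top[of 0]
  proof eventually_elim
    case (elim n)
    define N where "N = {i\<in>{..<n}. \<alpha> - \<kappa> \<le> y n i \<and> y n i \<le> \<beta> + \<kappa>}"
    have h1: "h t \<le> 1" for t
      using arctan_ubound[of "(\<beta> - t) / \<eta>"] arctan_lbound[of "(\<alpha> - t) / \<eta>"] by (simp add: h_def)
    have h2: "h t \<le> e / 3" if "\<not> (\<alpha> - \<kappa> \<le> t \<and> t \<le> \<beta> + \<kappa>)" for t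
    proof -
      have "arctan ((\<beta> - t) / \<eta>) - arctan ((\<alpha> - t) / \<eta>) \<le> 1 / (\<kappa> / \<eta>)"
      proof (cases "t < \<alpha> - \<kappa>")
        case True
        then show ?thesis using \<eta> ab assms(8) by (intro arctan_diff_le divide_right_mono) auto
      next
        case False
        then have "t > \<beta> + \<kappa>" using that by auto
        then have "arctan (- ((\<alpha> - t) / \<eta>)) - arctan (- ((\<beta> - t) / \<eta>)) \<le> 1 / (\<kappa> / \<eta>)"
          using \<eta> ab assms(8) unfolding minus_divide_left by (intro arctan_diff_le divide_right_mono) auto
        then show ?thesis by (simp add: arctan_minus)
      qed
      then have "h t \<le> (1 / (\<kappa> / \<eta>)) / pi" unfolding h_def by (rule divide_right_mono) simp
      also have "\<dots> = (\<eta> / \<kappa>) / pi" by simp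
      also have "\<dots> \<le> (\<eta> / \<kappa>) / 1" using \<eta> assms(8) pi_gt3 by (intro divide_left_mono) auto
      finally have "h t \<le> \<eta> / \<kappa>" by simp
      then show ?thesis using \<eta>(4) by linarith
    qed
    have "(\<Sum>i<n. h (y n i)) \<le> (\<Sum>i<n. (if i \<in> N then 1 else 0) + e / 3)"
    proof (rule sum_mono)
      fix i assume i: "i \<in> {..<n}"
      show "h (y n i) \<le> (if i \<in> N then 1 else 0) + e / 3"
      proof (cases "i \<in> N")
        case True
        then show ?thesis using h1[of "y n i"] \<open>e > 0\<close> by simp
      next
        case False
        then show ?thesis using h2[of "y n i"] i by (simp add: N_def)
      qed
    qed
    also have "\<dots> = real (card N) + real n * (e / 3)"
    proof -
      have "(\<Sum>i<n. if i \<in> N then 1 else 0) = (\<Sum>i\<in>{..<n} \<inter> N. 1::real)" by (rule sum.inter_restrict[symmetric]) simp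
      moreover have "{..<n} \<inter> N = N" by (auto simp: N_def)
      ultimately show ?thesis by (simp add: sum.distrib)
    qed
    finally have "(\<Sum>i<n. h (y n i)) / real n \<le> (real (card N) + real n * (e / 3)) / real n"
      by (rule divide_right_mono) simp
    also have "\<dots> = real (card N) / real n + e / 3" using elim(2) by (simp add: add_divide_distrib)
    finally show ?case using elim(1) \<open>e > 0\<close> unfolding N_def by linarith
  qed
qed

text \<open>Counting needs a window strictly inside the support, with room for its margin; shrinking
  the interval at both ends costs at most \<open>e\<close>.\<close>

lemma continuous_on_interior_points:
  fixes \<Phi> :: "real \<Rightarrow> real"
  assumes "continuous_on {lo..hi} \<Phi>" "lo \<le> u" "u < v" "v \<le> hi" "e > 0"
  obtains \<alpha> \<beta> where "u < \<alpha>" "\<alpha> < \<beta>" "\<beta> < v" "\<Phi> \<beta> - \<Phi> \<alpha> \<ge> \<Phi> v - \<Phi> u - e"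
proof -
  have e2: "e / 2 > 0" using assms(5) by simp
  have uv: "u \<in> {lo..hi}" "v \<in> {lo..hi}" using assms by auto
  obtain d1 where d1: "d1 > 0" "\<And>x. x \<in> {lo..hi} \<Longrightarrow> dist x u < d1 \<Longrightarrow> dist (\<Phi> x) (\<Phi> u) < e / 2"
    using assms(1) uv(1) e2 unfolding continuous_on_iff by blast
  obtain d2 where d2: "d2 > 0" "\<And>x. x \<in> {lo..hi} \<Longrightarrow> dist x v < d2 \<Longrightarrow> dist (\<Phi> x) (\<Phi> v) < e / 2"
    using assms(1) uv(2) e2 unfolding continuous_on_iff by blast
  define t where "t = min (min (d1 / 2) (d2 / 2)) ((v - u) / 3)"
  have t: "t > 0" "t < d1" "t < d2" "t \<le> (v - u) / 3" using d1(1) d2(1) assms by (auto simp: t_def min_def)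
  have "3 * t \<le> v - u" using t(4) by simp
  then have *: "u + t < v - t" using t(1) by linarith
  have "dist (\<Phi> (u + t)) (\<Phi> u) < e / 2" by (rule d1(2)) (use t assms * in \<open>auto simp: dist_real_def\<close>)
  moreover have "dist (\<Phi> (v - t)) (\<Phi> v) < e / 2" by (rule d2(2)) (use t assms * in \<open>auto simp: dist_real_def\<close>)
  ultimately have "\<Phi> (v - t) - \<Phi> (u + t) \<ge> \<Phi> v - \<Phi> u - e" unfolding dist_real_def by linarith
  then show thesis using that[of "u + t" "v - t"] t * by simp
qed

text \<open>The lower bounds on both sides of \<open>\<xi>\<close> are sharp because the density has total mass one.\<close>
lemma empirical_df_convergence:
  assumes b: "b1 > 0" "b2 > 0" "b2 \<le> b1" "b1 \<le> 2 * b2" and disc: "(a2 - a1)^2 * b2 \<le> (2 * b2 - b1)^2"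
    and conv: "\<And>z. Im z > 0 \<Longrightarrow> (\<lambda>n. cauchy_mean n (y n) z) \<longlonglongrightarrow> jac_stieltjes a1 a2 b1 b2 z"
  shows "(\<lambda>n. empirical_df n (y n) \<xi>) \<longlonglongrightarrow> integral {a2 - 2 * sqrt b2 .. \<xi>} (limit_density a1 a2 b1 b2)"
proof -
  define f where "f = limit_density a1 a2 b1 b2"
  define lo where "lo = a2 - 2 * sqrt b2"
  define hi where "hi = a2 + 2 * sqrt b2"
  define \<Phi> where "\<Phi> x = integral {lo..x} f" for x
  have lohi: "lo < hi" using b by (simp add: lo_def hi_def)
  have tot: "(f has_integral 1) {lo..hi}"
    unfolding f_def lo_def hi_def by (rule limit_density_has_integral[OF b disc])
  then have int: "f integrable_on {lo..hi}" by blast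
  have cont: "continuous_on {lo..hi} \<Phi>" unfolding \<Phi>_def[abs_def] by (rule indefinite_integral_continuous_1[OF int])
  have \<Phi>hi: "\<Phi> hi = 1" unfolding \<Phi>_def by (rule integral_unique[OF tot])
  have \<Phi>lo: "\<Phi> x = 0" if "x \<le> lo" for x
    using that by (cases "x = lo") (auto simp: \<Phi>_def)
  have \<Phi>ge: "\<Phi> x = 1" if "x \<ge> hi" for x
  proof -
    have "(f has_integral 0) {hi..x}"
    proof (rule has_integral_spike_finite)
      show "finite {hi}" by simp
      show "f t = 0" if "t \<in> {hi..x} - {hi}" for t
        using that by (auto simp: f_def limit_density_def hi_def)
      show "((\<lambda>_. 0::real) has_integral 0) {hi..x}" by simp
    qed
    then have "(f has_integral (1 + 0)) {lo..x}"
      using lohi by (intro has_integral_combine[OF _ that tot]) auto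
    then show ?thesis unfolding \<Phi>_def by (simp add: integral_unique)
  qed
  have diff: "integral {\<alpha>..\<beta>} f = \<Phi> \<beta> - \<Phi> \<alpha>" if "lo \<le> \<alpha>" "\<alpha> \<le> \<beta>" "\<beta> \<le> hi" for \<alpha> \<beta>
  proof -
    have "f integrable_on {lo..\<beta>}" by (rule integrable_on_subinterval[OF int]) (use that in auto)
    from Henstock_Kurzweil_Integration.integral_combine[OF that(1,2) this] show ?thesis unfolding \<Phi>_def by simp
  qed
  have count: "eventually (\<lambda>n. real (card {i\<in>{..<n}. \<alpha> - \<kappa> \<le> y n i \<and> y n i \<le> \<beta> + \<kappa>}) / real n \<ge> \<Phi> \<beta> - \<Phi> \<alpha> - e) sequentially"
    if "lo < \<alpha>" "\<alpha> < \<beta>" "\<beta> < hi" "\<kappa> > 0" "e > 0" for \<alpha> \<beta> \<kappa> e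
    using count_ge_of_stieltjes_convergence[OF b(1-3) conv, of \<alpha> \<beta> \<kappa> e] that diff[of \<alpha> \<beta>]
    by (simp add: lo_def hi_def f_def)
  have lower: "eventually (\<lambda>n. empirical_df n (y n) \<xi> \<ge> \<Phi> \<xi> - e) sequentially" if e: "e > 0" for e
  proof (cases "\<xi> \<le> lo")
    case True
    have nn: "empirical_df n (y n) \<xi> \<ge> 0" for n by (simp add: empirical_df_def)
    have "empirical_df n (y n) \<xi> \<ge> \<Phi> \<xi> - e" for n
      using \<Phi>lo[OF True] e nn[of n] by linarith
    then show ?thesis by simp
  next
    case False
    define v where "v = min \<xi> hi"
    have v: "lo < v" "v \<le> hi" "v \<le> \<xi>" using False lohi by (auto simp: v_def)
    have \<Phi>v: "\<Phi> v = \<Phi> \<xi>" using \<Phi>ge \<Phi>hi by (auto simp: v_def min_def)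
    obtain \<alpha> \<beta> where ab: "lo < \<alpha>" "\<alpha> < \<beta>" "\<beta> < v" "\<Phi> \<beta> - \<Phi> \<alpha> \<ge> \<Phi> v - \<Phi> lo - e / 2"
      by (rule continuous_on_interior_points[OF cont order_refl v(1,2), of "e / 2"]) (use e in simp_all)
    \<comment> \<open>With margin \<open>v - \<beta>\<close> the enlarged window ends at
      \<open>v\<close>, which is at most \<open>\<xi>\<close>; an overshoot on the left does no
      harm.\<close>
    have "eventually (\<lambda>n. real (card {i\<in>{..<n}. \<alpha> - (v - \<beta>) \<le> y n i \<and> y n i \<le> \<beta> + (v - \<beta>)}) / real n \<ge> \<Phi> \<beta> - \<Phi> \<alpha> - e / 2) sequentially"
      by (rule count) (use ab v e in auto)
    then show ?thesis
    proof eventually_elim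
      case (elim n)
      have "card {i\<in>{..<n}. \<alpha> - (v - \<beta>) \<le> y n i \<and> y n i \<le> \<beta> + (v - \<beta>)} \<le> card {i\<in>{..<n}. y n i \<le> \<xi>}"
        using v by (intro card_mono) auto
      then have "real (card {i\<in>{..<n}. \<alpha> - (v - \<beta>) \<le> y n i \<and> y n i \<le> \<beta> + (v - \<beta>)}) / real n \<le> empirical_df n (y n) \<xi>"
        unfolding empirical_df_def by (intro divide_right_mono) auto
      then show ?case using elim ab(4) \<Phi>lo[of lo] \<Phi>v by linarith
    qed
  qed
  \<comment> \<open>Points counted to the right of \<open>\<xi>\<close> are missing from the
    distribution function, and \<open>\<Phi> hi = 1\<close> converts the lower bound on them into
    this upper bound.\<close>
  have upper: "eventually (\<lambda>n. empirical_df n (y n) \<xi> \<le> \<Phi> \<xi> + e) sequentially" if e: "e > 0" for e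
  proof (cases "\<xi> \<ge> hi")
    case True
    have le1: "empirical_df n (y n) \<xi> \<le> 1" for n
    proof -
      have "card {i\<in>{..<n}. y n i \<le> \<xi>} \<le> card {..<n}" by (intro card_mono) auto
      then show ?thesis by (cases "n = 0") (auto simp: empirical_df_def divide_le_eq)
    qed
    have "empirical_df n (y n) \<xi> \<le> \<Phi> \<xi> + e" for n
      using \<Phi>ge[OF True] e le1[of n] by linarith
    then show ?thesis by simp
  next
    case False
    define u where "u = max \<xi> lo"
    have u: "u < hi" "lo \<le> u" "\<xi> \<le> u" using False lohi by (auto simp: u_def)
    have \<Phi>u: "\<Phi> u = \<Phi> \<xi>" using \<Phi>lo by (auto simp: u_def max_def)
    obtain \<alpha> \<beta> where ab: "u < \<alpha>" "\<alpha> < \<beta>" "\<beta> < hi" "\<Phi> \<beta> - \<Phi> \<alpha> \<ge> \<Phi> hi - \<Phi> u - e / 2"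
      by (rule continuous_on_interior_points[OF cont u(2,1) order_refl, of "e / 2"]) (use e in simp_all)
    \<comment> \<open>Half the distance from \<open>u\<close> to \<open>\<alpha>\<close> keeps the
      enlarged window strictly to the right of \<open>\<xi>\<close>, hence disjoint from the points
      counted at \<open>\<xi>\<close>.\<close>
    have "eventually (\<lambda>n. real (card {i\<in>{..<n}. \<alpha> - (\<alpha> - u) / 2 \<le> y n i \<and> y n i \<le> \<beta> + (\<alpha> - u) / 2}) / real n \<ge> \<Phi> \<beta> - \<Phi> \<alpha> - e / 2) sequentially"
      by (rule count) (use ab u e in auto)
    then show ?thesis using eventually_gt_at_top[of 0]
    proof eventually_elim
      case (elim n)
      define A where "A = {i\<in>{..<n}. \<alpha> - (\<alpha> - u) / 2 \<le> y n i \<and> y n i \<le> \<beta> + (\<alpha> - u) / 2}"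
      define B where "B = {i\<in>{..<n}. y n i \<le> \<xi>}"
      have "\<alpha> - (\<alpha> - u) / 2 > \<xi>" using ab(1) u(3) by (simp add: field_simps)
      then have "A \<inter> B = {}" by (auto simp: A_def B_def)
      then have "card A + card B = card (A \<union> B)" by (intro card_Un_disjoint[symmetric]) (auto simp: A_def B_def)
      also have "\<dots> \<le> card {..<n}" by (intro card_mono) (auto simp: A_def B_def)
      finally have "real (card A) + real (card B) \<le> real n" by simp
      then have "real (card A) / real n + real (card B) / real n \<le> 1"
        using elim(2) by (simp add: field_simps)
      then show ?case using elim(1) ab(4) \<Phi>u \<Phi>hi unfolding empirical_df_def A_def B_def by linarith
    qed
  qed
  have "(\<lambda>n. empirical_df n (y n) \<xi>) \<longlonglongrightarrow> \<Phi> \<xi>"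
  proof (rule LIMSEQ_I)
    fix r :: real assume "r > 0"
    then have "eventually (\<lambda>n. empirical_df n (y n) \<xi> \<ge> \<Phi> \<xi> - r / 2 \<and> empirical_df n (y n) \<xi> \<le> \<Phi> \<xi> + r / 2) sequentially"
      using lower[of "r / 2"] upper[of "r / 2"] by (simp add: eventually_conj_iff)
    then obtain N where "\<And>n. n \<ge> N \<Longrightarrow> empirical_df n (y n) \<xi> \<ge> \<Phi> \<xi> - r / 2 \<and> empirical_df n (y n) \<xi> \<le> \<Phi> \<xi> + r / 2"
      unfolding eventually_sequentially by blast
    then show "\<exists>N. \<forall>n\<ge>N. norm (empirical_df n (y n) \<xi> - \<Phi> \<xi>) < r"
      using \<open>r > 0\<close> unfolding real_norm_def by (intro exI[of _ N] allI impI) fastforce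
  qed
  then show ?thesis by (simp add: \<Phi>_def lo_def f_def)
qed

section \<open>Scaling limit of the loop equation\<close>

text \<open>Factor \<open>X^2 - R^2 = (X - R) * (X + R)\<close>: the imaginary parts keep
  \<open>X - R\<close> at distance at least \<open>t\<close> from zero, so the other factor must
  vanish in the limit.\<close>

lemma tendsto_branch:
  fixes X :: "nat \<Rightarrow> complex"
  assumes lim: "(\<lambda>n. (X n)^2) \<longlonglongrightarrow> R^2" and im: "eventually (\<lambda>n. Im (X n) \<le> - t) sequentially"
    and "t > 0" "Im R > 0"
  shows "X \<longlonglongrightarrow> - R"
proof -
  have "(\<lambda>n. cmod ((X n)^2 - R^2) / t) \<longlonglongrightarrow> 0"
    using tendsto_divide[OF tendsto_norm[OF LIM_zero[OF lim]] tendsto_const[of t]] \<open>t > 0\<close> by simp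
  moreover have "eventually (\<lambda>n. norm (X n + R) \<le> cmod ((X n)^2 - R^2) / t) sequentially"
    using im
  proof eventually_elim
    case (elim n)
    have "t \<le> \<bar>Im (X n - R)\<bar>" using elim \<open>Im R > 0\<close> by simp
    also have "\<dots> \<le> cmod (X n - R)" by (rule abs_Im_le_cmod)
    finally have "cmod (X n + R) * t \<le> cmod (X n + R) * cmod (X n - R)" by (intro mult_left_mono) auto
    also have "\<dots> = cmod ((X n)^2 - R^2)"
      by (simp add: norm_mult[symmetric] power2_eq_square algebra_simps)
    finally show ?case using \<open>t > 0\<close> by (simp add: pos_le_divide_eq)
  qed
  ultimately have "(\<lambda>n. X n + R) \<longlonglongrightarrow> 0" by (rule Lim_null_comparison[rotated])
  from tendsto_diff[OF this tendsto_const[of R]] show ?thesis by simp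
qed

lemma Re_csqrt_pos: "w \<notin> \<real>\<^sub>\<le>\<^sub>0 \<Longrightarrow> Re (csqrt w) > 0"
proof (rule ccontr)
  assume w: "w \<notin> \<real>\<^sub>\<le>\<^sub>0" and "\<not> Re (csqrt w) > 0"
  then have "Re (csqrt w) = 0" using Re_csqrt[of w] by linarith
  then have "csqrt w = \<i> * of_real (Im (csqrt w))" by (simp add: complex_eq_iff)
  then have "w = (\<i> * of_real (Im (csqrt w)))^2" by (metis power2_csqrt)
  also have "\<dots> = of_real (- ((Im (csqrt w))^2))" by (simp add: power_mult_distrib)
  finally show False using w by (metis neg_le_0_iff_le nonpos_Reals_of_real_iff zero_le_power2)
qed

section \<open>Deterministic consequences of the four scaling limits\<close>

locale jacobi_scaling =
  fixes ta tb \<epsilon> \<delta> :: "nat \<Rightarrow> real" and a1 a2 b1 b2 :: real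
  assumes ta: "\<And>n. ta n > 0" and tb: "\<And>n. tb n > 0" and \<delta>: "\<And>n. \<delta> n > 0"
    and b1: "b1 > 0" and b2: "b2 > 0"
    and lim1: "(\<lambda>n. ((real n + tb n - 1) / (2 * real n + ta n + tb n - 2) - \<epsilon> n) / \<delta> n) \<longlonglongrightarrow> a1 / 2"
    and lim2: "(\<lambda>n. ((real n * (real n + ta n - 1) + (real n + tb n - 1) * (real n + ta n + tb n - 2))
              / (2 * real n + ta n + tb n - 2)^2 - \<epsilon> n) / \<delta> n) \<longlonglongrightarrow> a2 / 2"
    and lim3: "(\<lambda>n. ((real n + tb n - 1) * (real n + ta n - 1) * real n
              / (2 * real n + ta n + tb n - 2)^3) / (\<delta> n)^2) \<longlonglongrightarrow> b1 / 4"
    and lim4: "(\<lambda>n. ((real n + tb n - 1) * (real n + ta n - 1) * (real n + ta n + tb n - 2) * real n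
              / (2 * real n + ta n + tb n - 2)^4) / (\<delta> n)^2) \<longlonglongrightarrow> b2 / 4"
begin

text \<open>In terms of the ratios \<open>P\<close> and \<open>\<theta>\<close>, \<open>\<alpha>n\<close>, \<open>cn\<close> and \<open>bn\<close> are the analogues at stage \<open>n\<close> of \<open>a1\<close>,
  \<open>a2 - a1\<close> and \<open>b1\<close>.\<close>
definition s :: "nat \<Rightarrow> real" where "s n = 2 * real n + ta n + tb n - 2"
definition P :: "nat \<Rightarrow> real" where "P n = (real n + tb n - 1) / s n"
definition \<theta> :: "nat \<Rightarrow> real" where "\<theta> n = real n / s n"
definition \<alpha>n :: "nat \<Rightarrow> real" where "\<alpha>n n = 2 * (P n - \<epsilon> n) / \<delta> n"
definition cn :: "nat \<Rightarrow> real" where "cn n = 2 * \<theta> n * (1 - 2 * P n) / \<delta> n"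
definition bn :: "nat \<Rightarrow> real" where "bn n = 4 * P n * (1 - P n) * \<theta> n / (\<delta> n)^2"

lemma s_pos: "n \<ge> 2 \<Longrightarrow> s n > 0"
  using ta[of n] tb[of n] by (simp add: s_def)

lemma ratios:
  assumes "n \<ge> 2"
  shows "real n = \<theta> n * s n" "real n + tb n - 1 = P n * s n" "real n + ta n - 1 = (1 - P n) * s n"
    "real n + ta n + tb n - 2 = (1 - \<theta> n) * s n"
proof -
  show 1: "real n = \<theta> n * s n" and 2: "real n + tb n - 1 = P n * s n"
    using s_pos[OF assms] by (simp_all add: \<theta>_def P_def)
  show "real n + ta n - 1 = (1 - P n) * s n" "real n + ta n + tb n - 2 = (1 - \<theta> n) * s n"
    unfolding left_diff_distrib 1[symmetric] 2[symmetric] by (simp_all add: s_def)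
qed

text \<open>The restriction \<open>n \<ge> 2\<close> matters for \<open>\<theta> n \<le> 1\<close>:
  at \<open>n = 1\<close> the numerator \<open>n + ta n + tb n - 2\<close> of
  \<open>1 - \<theta> n\<close> can be negative.\<close>

lemma bounds:
  assumes "n \<ge> 2"
  shows "0 < \<theta> n" "\<theta> n \<le> 1" "0 < P n" "P n < 1"
proof -
  note s = s_pos[OF assms] and r = ratios[OF assms]
  show "0 < \<theta> n" using s assms by (simp add: \<theta>_def)
  have "P n * s n > 0" using assms tb[of n] unfolding r(2)[symmetric] by simp
  then show "0 < P n" using s by (simp add: zero_less_mult_iff)
  have "(1 - P n) * s n > 0" using assms ta[of n] unfolding r(3)[symmetric] by simp
  then show "P n < 1" using s by (simp add: zero_less_mult_iff)
  have "(1 - \<theta> n) * s n \<ge> 0" using assms ta[of n] tb[of n] unfolding r(4)[symmetric] by simp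
  then show "\<theta> n \<le> 1" using s by (simp add: zero_le_mult_iff)
qed

lemma ev2: "eventually (\<lambda>n. n \<ge> (2::nat)) sequentially" by (rule eventually_ge_at_top)

lemma \<alpha>n_lim: "\<alpha>n \<longlonglongrightarrow> a1"
proof -
  have "(\<lambda>n. 2 * (((real n + tb n - 1) / (2 * real n + ta n + tb n - 2) - \<epsilon> n) / \<delta> n)) \<longlonglongrightarrow> 2 * (a1 / 2)"
    by (intro tendsto_intros lim1)
  then show ?thesis by (simp add: \<alpha>n_def[abs_def] P_def s_def)
qed

text \<open>Subtracting (i) from (ii) removes \<open>\<epsilon>\<close>, and \<open>\<theta> * (1 -
  P) + P * (1 - \<theta>) - P = \<theta> * (1 - 2 * P)\<close>.\<close>

lemma cn_lim: "cn \<longlonglongrightarrow> a2 - a1"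
proof -
  have "(\<lambda>n. 2 * (((real n * (real n + ta n - 1) + (real n + tb n - 1) * (real n + ta n + tb n - 2))
              / (2 * real n + ta n + tb n - 2)^2 - \<epsilon> n) / \<delta> n)
     - 2 * (((real n + tb n - 1) / (2 * real n + ta n + tb n - 2) - \<epsilon> n) / \<delta> n)) \<longlonglongrightarrow> 2 * (a2 / 2) - 2 * (a1 / 2)"
    by (intro tendsto_intros lim1 lim2)
  moreover have "eventually (\<lambda>n. 2 * (((real n * (real n + ta n - 1) + (real n + tb n - 1) * (real n + ta n + tb n - 2))
              / (2 * real n + ta n + tb n - 2)^2 - \<epsilon> n) / \<delta> n)
     - 2 * (((real n + tb n - 1) / (2 * real n + ta n + tb n - 2) - \<epsilon> n) / \<delta> n) = cn n) sequentially"
    using ev2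
  proof eventually_elim
    case (elim n)
    have 1: "(real n * (real n + ta n - 1) + (real n + tb n - 1) * (real n + ta n + tb n - 2)) / (s n)^2
      = \<theta> n * (1 - P n) + P n * (1 - \<theta> n)"
      unfolding ratios(2-4)[OF elim] unfolding ratios(1)[OF elim] using s_pos[OF elim]
      by (simp add: add_divide_distrib power2_eq_square)
    have 2: "(real n + tb n - 1) / s n = P n" by (simp add: P_def)
    show ?case unfolding s_def[symmetric] 1 2 cn_def using \<delta>[of n] by (simp add: field_simps)
  qed
  ultimately show ?thesis by (simp add: tendsto_cong)
qed

lemma bn_lim: "bn \<longlonglongrightarrow> b1"
proof -
  have "(\<lambda>n. 4 * (((real n + tb n - 1) * (real n + ta n - 1) * real n
              / (2 * real n + ta n + tb n - 2)^3) / (\<delta> n)^2)) \<longlonglongrightarrow> 4 * (b1 / 4)"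
    by (intro tendsto_intros lim3)
  moreover have "eventually (\<lambda>n. 4 * (((real n + tb n - 1) * (real n + ta n - 1) * real n
              / (2 * real n + ta n + tb n - 2)^3) / (\<delta> n)^2) = bn n) sequentially"
    using ev2
  proof eventually_elim
    case (elim n)
    have "(real n + tb n - 1) * (real n + ta n - 1) * real n / (s n)^3 = P n * (1 - P n) * \<theta> n"
      unfolding ratios(2-4)[OF elim] unfolding ratios(1)[OF elim] using s_pos[OF elim]
      by (simp add: power3_eq_cube)
    then show ?case unfolding s_def[symmetric] bn_def by simp
  qed
  ultimately show ?thesis by (simp add: tendsto_cong)
qed

lemma bn2_lim: "(\<lambda>n. bn n * (1 - \<theta> n)) \<longlonglongrightarrow> b2"
proof -
  have "(\<lambda>n. 4 * (((real n + tb n - 1) * (real n + ta n - 1) * (real n + ta n + tb n - 2) * real n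
              / (2 * real n + ta n + tb n - 2)^4) / (\<delta> n)^2)) \<longlonglongrightarrow> 4 * (b2 / 4)"
    by (intro tendsto_intros lim4)
  moreover have "eventually (\<lambda>n. 4 * (((real n + tb n - 1) * (real n + ta n - 1) * (real n + ta n + tb n - 2) * real n
              / (2 * real n + ta n + tb n - 2)^4) / (\<delta> n)^2) = bn n * (1 - \<theta> n)) sequentially"
    using ev2
  proof eventually_elim
    case (elim n)
    have "(real n + tb n - 1) * (real n + ta n - 1) * (real n + ta n + tb n - 2) * real n / (s n)^4 = P n * (1 - P n) * (1 - \<theta> n) * \<theta> n"
      unfolding ratios(2-4)[OF elim] unfolding ratios(1)[OF elim] using s_pos[OF elim]
      by (simp add: power4_eq_xxxx)
    then show ?case unfolding s_def[symmetric] bn_def by simp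
  qed
  ultimately show ?thesis by (simp add: tendsto_cong)
qed

definition \<theta>\<^sub>0 :: real where "\<theta>\<^sub>0 = 1 - b2 / b1"

text \<open>The expressions in (iv) and (iii) differ exactly by the factor
  \<open>1 - \<theta>\<close>.\<close>

lemma \<theta>_lim: "\<theta> \<longlonglongrightarrow> \<theta>\<^sub>0"
proof -
  have "(\<lambda>n. 1 - bn n * (1 - \<theta> n) / bn n) \<longlonglongrightarrow> 1 - b2 / b1"
    using b1 by (intro tendsto_intros bn_lim bn2_lim) auto
  moreover have "eventually (\<lambda>n. 1 - bn n * (1 - \<theta> n) / bn n = \<theta> n) sequentially"
    using order_tendstoD(1)[OF bn_lim b1] by eventually_elim simp
  ultimately show ?thesis unfolding \<theta>\<^sub>0_def by (simp add: tendsto_cong)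
qed

text \<open>\<open>P\<close> drops out through \<open>(1 - 2 * P)^2 + 4 * P * (1 - P) = 1\<close>,
  so \<open>\<theta> / \<delta>\<close> is determined by quantities with known limits.\<close>

lemma \<theta>_div_\<delta>_lim: "(\<lambda>n. \<theta> n / \<delta> n) \<longlonglongrightarrow> sqrt ((a2 - a1)^2 / 4 + b1 * \<theta>\<^sub>0)"
proof -
  have "(\<lambda>n. sqrt ((cn n)^2 / 4 + bn n * \<theta> n)) \<longlonglongrightarrow> sqrt ((a2 - a1)^2 / 4 + b1 * \<theta>\<^sub>0)"
    by (intro tendsto_intros cn_lim bn_lim \<theta>_lim) auto
  moreover have "eventually (\<lambda>n. sqrt ((cn n)^2 / 4 + bn n * \<theta> n) = \<theta> n / \<delta> n) sequentially"
    using ev2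
  proof eventually_elim
    case (elim n)
    have "(cn n)^2 / 4 + bn n * \<theta> n = (\<theta> n / \<delta> n)^2 * ((1 - 2 * P n)^2 + 4 * P n * (1 - P n))"
      unfolding cn_def bn_def using \<delta>[of n] by (simp add: power2_eq_square field_simps)
    also have "(1 - 2 * P n)^2 + 4 * P n * (1 - P n) = 1" by (simp add: power2_eq_square algebra_simps)
    finally show ?case using bounds(1)[OF elim] \<delta>[of n] by simp
  qed
  ultimately show ?thesis by (simp add: tendsto_cong)
qed

lemma inverse_s_lim: "(\<lambda>n. 1 / s n) \<longlonglongrightarrow> 0"
proof -
  have "(\<lambda>n. \<theta> n * (1 / real n)) \<longlonglongrightarrow> \<theta>\<^sub>0 * 0"
    by (intro tendsto_mult \<theta>_lim lim_1_over_n)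
  moreover have "eventually (\<lambda>n. \<theta> n * (1 / real n) = 1 / s n) sequentially"
    using ev2 by eventually_elim (simp add: \<theta>_def)
  ultimately show ?thesis by (simp add: tendsto_cong)
qed

text \<open>Limits of facts at stage \<open>n\<close>: \<open>\<theta> \<ge> 0\<close>, then
  \<open>(ta + tb) / s \<ge> 0\<close>, and finally an almost sign-definite product for the
  discriminant.\<close>

lemma parameter_bounds: "b2 \<le> b1" "b1 \<le> 2 * b2" "(a2 - a1)^2 * b2 \<le> (2 * b2 - b1)^2"
proof -
  have "\<theta>\<^sub>0 \<ge> 0"
  proof (rule tendsto_lowerbound[OF \<theta>_lim])
    show "eventually (\<lambda>n. 0 \<le> \<theta> n) sequentially"
      using ev2 by eventually_elim (rule less_imp_le[OF bounds(1)])
  qed simp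
  then show "b2 \<le> b1" using b1 by (simp add: \<theta>\<^sub>0_def)
  have "(\<lambda>n. 1 - 2 * \<theta> n + 2 * (1 / s n)) \<longlonglongrightarrow> 1 - 2 * \<theta>\<^sub>0 + 2 * 0"
    by (intro tendsto_intros \<theta>_lim inverse_s_lim)
  moreover have "eventually (\<lambda>n. 1 - 2 * \<theta> n + 2 * (1 / s n) \<ge> 0) sequentially"
    using ev2
  proof eventually_elim
    case (elim n)
    have "1 - 2 * \<theta> n + 2 * (1 / s n) = (s n - 2 * real n + 2) / s n"
      using s_pos[OF elim] by (simp add: \<theta>_def field_simps)
    also have "\<dots> \<ge> 0" using s_pos[OF elim] ta[of n] tb[of n] by (intro divide_nonneg_pos) (auto simp: s_def)
    finally show ?case .
  qed
  ultimately have "1 - 2 * \<theta>\<^sub>0 + 2 * 0 \<ge> 0" by (rule tendsto_lowerbound) simp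
  then show "b1 \<le> 2 * b2" using b1 by (simp add: \<theta>\<^sub>0_def field_simps)
  \<comment> \<open>The limit without the correction is \<open>b2 / b1^2\<close> times
    \<open>(2 * b2 - b1)^2 - (a2 - a1)^2 * b2\<close>. The correction
    \<open>4 * (\<theta> / \<delta>)^2 / n\<close> makes the sequence nonnegative and tends to
    zero.\<close>
  have "(\<lambda>n. (1 - 2 * \<theta> n)^2 * (bn n * (1 - \<theta> n)) - (1 - \<theta> n)^2 * (cn n)^2 + 4 * (\<theta> n / \<delta> n)^2 * (1 / real n))
     \<longlonglongrightarrow> (1 - 2 * \<theta>\<^sub>0)^2 * b2 - (1 - \<theta>\<^sub>0)^2 * (a2 - a1)^2 + 4 * (sqrt ((a2 - a1)^2 / 4 + b1 * \<theta>\<^sub>0))^2 * 0"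
    by (intro tendsto_intros \<theta>_lim bn2_lim cn_lim \<theta>_div_\<delta>_lim lim_1_over_n)
  moreover have "eventually (\<lambda>n. (1 - 2 * \<theta> n)^2 * (bn n * (1 - \<theta> n)) - (1 - \<theta> n)^2 * (cn n)^2 + 4 * (\<theta> n / \<delta> n)^2 * (1 / real n) \<ge> 0) sequentially"
    using ev2
  proof eventually_elim
    case (elim n)
    note s = s_pos[OF elim]
    define d where "d = \<theta> n / \<delta> n"
    have "(P n - \<theta> n) * (1 - P n - \<theta> n) = (tb n - 1) * (ta n - 1) / (s n)^2"
    proof -
      have "(P n - \<theta> n) * s n = tb n - 1" "(1 - P n - \<theta> n) * s n = ta n - 1"
        using ratios[OF elim] by (simp_all add: left_diff_distrib)
      then have "(tb n - 1) * (ta n - 1) = (P n - \<theta> n) * (1 - P n - \<theta> n) * (s n)^2"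
        by (metis (no_types, lifting) mult.assoc mult.left_commute power2_eq_square)
      then show ?thesis using s by simp
    qed
    \<comment> \<open>One of \<open>ta n\<close>, \<open>tb n\<close> may lie below 1 and the other
      above, so the product can be negative. It is still at least \<open>- (ta n + tb n)\<close>, a
      loss of order \<open>1 / s\<close> only.\<close>
    also have "\<dots> \<ge> - s n / (s n)^2"
    proof (rule divide_right_mono)
      have "ta n * tb n > 0" using ta tb by simp
      then have "(tb n - 1) * (ta n - 1) \<ge> - (ta n + tb n)" by (simp add: algebra_simps)
      also have "- (ta n + tb n) \<ge> - s n" using elim by (simp add: s_def)
      finally show "- s n \<le> (tb n - 1) * (ta n - 1)" by simp
    qed simp
    also have "- s n / (s n)^2 = - (\<theta> n / real n)" using s elim by (simp add: \<theta>_def power2_eq_square)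
    finally have low: "(P n - \<theta> n) * (1 - P n - \<theta> n) \<ge> - (\<theta> n / real n)" .
    have "(1 - 2 * \<theta> n)^2 * (bn n * (1 - \<theta> n)) - (1 - \<theta> n)^2 * (cn n)^2
      = 4 * (\<theta> n / (\<delta> n)^2) * (1 - \<theta> n) * ((P n - \<theta> n) * (1 - P n - \<theta> n))"
    proof -
      have "(1 - 2 * \<theta> n)^2 * (4 * P n * (1 - P n) * \<theta> n * (1 - \<theta> n)) - (1 - \<theta> n)^2 * (2 * \<theta> n * (1 - 2 * P n))^2
        = 4 * \<theta> n * (1 - \<theta> n) * ((P n - \<theta> n) * (1 - P n - \<theta> n))"
        by algebra
      moreover have "(1 - 2 * \<theta> n)^2 * (bn n * (1 - \<theta> n)) - (1 - \<theta> n)^2 * (cn n)^2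
        = ((1 - 2 * \<theta> n)^2 * (4 * P n * (1 - P n) * \<theta> n * (1 - \<theta> n)) - (1 - \<theta> n)^2 * (2 * \<theta> n * (1 - 2 * P n))^2) / (\<delta> n)^2"
        unfolding bn_def cn_def by (simp add: diff_divide_distrib power_divide)
      ultimately show ?thesis by simp
    qed
    also have "\<dots> \<ge> 4 * (\<theta> n / (\<delta> n)^2) * (1 - \<theta> n) * (- (\<theta> n / real n))"
      using bounds[OF elim] by (intro mult_left_mono low) auto
    also have "4 * (\<theta> n / (\<delta> n)^2) * (1 - \<theta> n) * (- (\<theta> n / real n)) = - (4 * d^2 * (1 / real n)) * (1 - \<theta> n)"
      by (simp add: d_def power_divide power2_eq_square)
    also have "- (4 * d^2 * (1 / real n)) * (1 - \<theta> n) \<ge> - (4 * d^2 * (1 / real n)) * 1"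
      using bounds[OF elim] by (intro mult_left_mono_neg) auto
    finally show ?case unfolding d_def by simp
  qed
  ultimately have "(1 - 2 * \<theta>\<^sub>0)^2 * b2 - (1 - \<theta>\<^sub>0)^2 * (a2 - a1)^2 + 4 * (sqrt ((a2 - a1)^2 / 4 + b1 * \<theta>\<^sub>0))^2 * 0 \<ge> 0"
    by (rule tendsto_lowerbound) simp
  then have 1: "(1 - \<theta>\<^sub>0)^2 * (a2 - a1)^2 \<le> (1 - 2 * \<theta>\<^sub>0)^2 * b2" by simp
  have "(1 - \<theta>\<^sub>0) = b2 / b1" "(1 - 2 * \<theta>\<^sub>0) = (2 * b2 - b1) / b1" using b1 by (simp_all add: \<theta>\<^sub>0_def field_simps)
  with 1 have "b2^2 * (a2 - a1)^2 / b1^2 \<le> (2 * b2 - b1)^2 * b2 / b1^2" by (simp add: power_divide)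
  then have "b2 * (b2 * (a2 - a1)^2) \<le> b2 * (2 * b2 - b1)^2" using b1
    by (simp add: divide_le_cancel power2_eq_square mult_ac)
  then show "(a2 - a1)^2 * b2 \<le> (2 * b2 - b1)^2" using b2 by (simp add: mult.commute)
qed

text \<open>\<open>bn * \<delta>^2 = 4 * P * (1 - P) * \<theta>\<close> is at most 1, while
  \<open>bn\<close> stays away from zero. This lets a bound on \<open>\<delta>^4\<close> control
  \<open>\<delta>^2\<close>.\<close>

lemma \<delta>_bounded: "eventually (\<lambda>n. (\<delta> n)^2 \<le> 2 / b1) sequentially"
proof -
  have "eventually (\<lambda>n. bn n > b1 / 2) sequentially" using order_tendstoD(1)[OF bn_lim, of "b1 / 2"] b1 by simp
  then show ?thesis using ev2
  proof eventually_elim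
    case (elim n)
    have "b1 / 2 * (\<delta> n)^2 \<le> bn n * (\<delta> n)^2" using elim by (intro mult_right_mono) auto
    also have "\<dots> = 4 * P n * (1 - P n) * \<theta> n" using \<delta>[of n] by (simp add: bn_def)
    also have "\<dots> \<le> 1 * \<theta> n"
    proof (rule mult_right_mono)
      have "(1 - 2 * P n)^2 \<ge> 0" by simp
      then show "4 * P n * (1 - P n) \<le> 1" by (simp add: power2_eq_square algebra_simps)
    qed (use bounds[OF elim(2)] in simp)
    also have "\<dots> \<le> 1" using bounds[OF elim(2)] by simp
    finally show ?case using b1 by (simp add: field_simps)
  qed
qed

text \<open>At \<open>w = \<epsilon> + \<delta> / 2 * z\<close> the loop equation, divided by
  \<open>n * s\<close>, is a quadratic equation for the scaled transform with convergent
  coefficients; the derivative term carries an additional \<open>1 / n\<close>.\<close>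

lemma cauchy_mean_lim:
  assumes crit: "\<And>n i. n \<ge> 2 \<Longrightarrow> i < n \<Longrightarrow>
        2 * (\<Sum>j\<in>{..<n}-{i}. 1 / (x n i - x n j)) + tb n / x n i - ta n / (1 - x n i) = 0"
    and x: "\<And>n i. n \<ge> 2 \<Longrightarrow> i < n \<Longrightarrow> 0 < x n i \<and> x n i < 1" and inj: "\<And>n. n \<ge> 2 \<Longrightarrow> inj_on (x n) {..<n}"
    and z: "Im z > 0"
  shows "(\<lambda>n. cauchy_mean n (\<lambda>i. 2 * (x n i - \<epsilon> n) / \<delta> n) z) \<longlonglongrightarrow> jac_stieltjes a1 a2 b1 b2 z"
proof -
  define G where "G n = cauchy_mean n (\<lambda>i. 2 * (x n i - \<epsilon> n) / \<delta> n) z" for n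
  define k where "k n = (\<Sum>i<n. 1 / (z - of_real (2 * (x n i - \<epsilon> n) / \<delta> n))^2) / of_nat n" for n
  define u where "u n = z - of_real (\<alpha>n n)" for n
  define Q where "Q n = of_real (bn n) + of_real (cn n) * u n - of_real (\<theta> n) * (u n)^2" for n
  \<comment> \<open>The two vanishing terms make the identity at stage \<open>n\<close> exact:
    \<open>tb\<close> and \<open>ta + tb\<close> exceed \<open>s * (P - \<theta>)\<close> and
    \<open>s * (1 - 2 * \<theta>)\<close> by 1 and 2.\<close>
  define L where "L n = of_real (cn n) + of_real (1 - 2 * \<theta> n) * u n
      - of_real (cn n) * of_real (1 / real n) + 2 * u n * of_real (1 / s n)" for n
  \<comment> \<open>By the quadratic formula this is a square root of the discriminant up to an
    error; its limit is found first, and division by \<open>Q\<close> is postponed to the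
    end.\<close>
  define X where "X n = 2 * Q n * G n - L n" for n
  define u0 where "u0 = z - of_real a1"
  define Q0 where "Q0 = of_real b1 + of_real (a2 - a1) * u0 - of_real \<theta>\<^sub>0 * u0^2"
  define L0 where "L0 = of_real (a2 - a1) + of_real (1 - 2 * \<theta>\<^sub>0) * u0"
  define R where "R = \<i> * csqrt (of_real (4 * b2) - (z - of_real a2)^2)"
  have ulim: "u \<longlonglongrightarrow> u0" unfolding u_def[abs_def] u0_def by (intro tendsto_intros \<alpha>n_lim)
  have Qlim: "Q \<longlonglongrightarrow> Q0" unfolding Q_def[abs_def] Q0_def
    by (intro tendsto_intros ulim bn_lim cn_lim \<theta>_lim)
  have "L \<longlonglongrightarrow> of_real (a2 - a1) + of_real (1 - 2 * \<theta>\<^sub>0) * u0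
      - of_real (a2 - a1) * of_real 0 + 2 * u0 * of_real 0" unfolding L_def[abs_def]
    by (intro tendsto_add tendsto_diff tendsto_mult tendsto_of_real ulim cn_lim \<theta>_lim lim_1_over_n inverse_s_lim tendsto_const)
  then have Llim: "L \<longlonglongrightarrow> L0" by (simp add: L0_def)
  have exact: "w * (1 - w) * (of_real (4 * \<theta> n / (\<delta> n)^2)) = Q n"
    "- (2 / of_real (\<delta> n * s n)) * (of_real (tb n) - of_real (ta n + tb n) * w) = L n"
    "(of_nat n - 1 + of_real (ta n + tb n)) / of_real (s n) = complex_of_real (1 - \<theta> n + 1 / s n)"
    if n: "n \<ge> 2" and w: "w = of_real (\<epsilon> n) + of_real (\<delta> n / 2) * z" for n w
  proof -
    note s = s_pos[OF n] and d = \<delta>[of n] and r = ratios[OF n]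
    \<comment> \<open>Centring at \<open>P\<close> instead of \<open>\<epsilon>\<close> makes
      \<open>w * (1 - w)\<close> a quadratic in \<open>u\<close> whose scaled coefficients are
      \<open>bn\<close>, \<open>cn\<close> and \<open>- \<theta>\<close>.\<close>
    have wP: "w = of_real (P n) + of_real (\<delta> n / 2) * u n"
      unfolding w u_def \<alpha>n_def using d by (simp add: field_simps)
    have nz: "complex_of_real (\<delta> n) \<noteq> 0" "complex_of_real (s n) \<noteq> 0" using d s by auto
    show "w * (1 - w) * (of_real (4 * \<theta> n / (\<delta> n)^2)) = Q n"
      unfolding wP Q_def bn_def cn_def using nz by (simp add: power2_eq_square field_simps)
    have tb': "tb n = s n * (P n - \<theta> n) + 1" using r(1,2) by (simp add: algebra_simps)
    have tab': "ta n + tb n = s n * (1 - 2 * \<theta> n) + 2" using r(1,4) by (simp add: algebra_simps)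
    have "cn n * (1 / real n) = 2 * (1 - 2 * P n) / (\<delta> n * s n)"
      using bounds(1)[OF n] by (simp add: r(1) cn_def)
    then have r0: "complex_of_real (cn n) * of_real (1 / real n) = of_real (2 * (1 - 2 * P n) / (\<delta> n * s n))"
      by (metis of_real_mult)
    have "L n = of_real (cn n) + of_real (1 - 2 * \<theta> n) * u n
      - of_real (2 * (1 - 2 * P n) / (\<delta> n * s n)) + 2 * u n * of_real (1 / s n)"
      unfolding L_def r0 ..
    also have "\<dots> = - (2 / of_real (\<delta> n * s n)) * (of_real (tb n) - of_real (ta n + tb n) * w)"
    proof -
      have gen: "2 * t * (1 - 2 * p) / D + (1 - 2 * t) * v - 2 * (1 - 2 * p) / (D * S) + 2 * v * (1 / S)
        = - (2 / (D * S)) * ((S * (p - t) + 1) - (S * (1 - 2 * t) + 2) * (p + D / 2 * v))"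
        if "D \<noteq> 0" "S \<noteq> 0" for t p v D S :: complex
        using that by (simp add: divide_simps) (simp add: algebra_simps)
      have 1: "of_real (tb n) = of_real (s n) * (complex_of_real (P n) - of_real (\<theta> n)) + 1"
        unfolding tb' by simp
      have 2: "of_real (ta n + tb n) = of_real (s n) * (1 - 2 * complex_of_real (\<theta> n)) + 2"
        unfolding tab' by simp
      show ?thesis unfolding 1 2 wP cn_def using gen[OF nz, of "of_real (\<theta> n)" "of_real (P n)" "u n"] by simp
    qed
    finally show "- (2 / of_real (\<delta> n * s n)) * (of_real (tb n) - of_real (ta n + tb n) * w) = L n" by simp
    have "(of_nat n - 1 + of_real (ta n + tb n)) / of_real (s n) = complex_of_real ((real n - 1 + (ta n + tb n)) / s n)"
      by simp
    also have "(real n - 1 + (ta n + tb n)) / s n = 1 - \<theta> n + 1 / s n"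
    proof -
      have e: "real n - 1 + (ta n + tb n) = (1 - \<theta> n) * s n + 1" using r(4) by simp
      show ?thesis unfolding e using s by (simp add: add_divide_distrib)
    qed
    finally show "(of_nat n - 1 + of_real (ta n + tb n)) / of_real (s n) = complex_of_real (1 - \<theta> n + 1 / s n)" .
  qed
  have scale: "z - of_real (2 * (x n i - \<epsilon> n) / \<delta> n) = of_real (2 / \<delta> n) * (w - of_real (x n i))"
    if "w = of_real (\<epsilon> n) + of_real (\<delta> n / 2) * z" for n i w
    unfolding that using \<delta>[of n] by (simp add: field_simps)
  have Geq: "(\<Sum>i<n. 1 / (w - of_real (x n i))) = of_real (2 * real n / \<delta> n) * G n"
    "(\<Sum>i<n. 1 / (w - of_real (x n i))^2) = of_real (4 * real n / (\<delta> n)^2) * k n"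
    if n: "n \<ge> 2" and w: "w = of_real (\<epsilon> n) + of_real (\<delta> n / 2) * z" for n w
  proof -
    have d: "complex_of_real (\<delta> n) \<noteq> 0" using \<delta>[of n] by simp
    have "G n = (\<Sum>i<n. of_real (\<delta> n / 2) * (1 / (w - of_real (x n i)))) / of_nat n"
      unfolding G_def cauchy_mean_def scale[OF w] by simp
    then show "(\<Sum>i<n. 1 / (w - of_real (x n i))) = of_real (2 * real n / \<delta> n) * G n"
      unfolding sum_distrib_left[symmetric] using n d by simp
    have "k n = (\<Sum>i<n. of_real ((\<delta> n)^2 / 4) * (1 / (w - of_real (x n i))^2)) / of_nat n"
    proof -
      have "1 / (of_real (2 / \<delta> n) * v)^2 = of_real ((\<delta> n)^2 / 4) * (1 / v^2)" for v :: complex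
        by (simp add: power_mult_distrib power_divide)
      then show ?thesis unfolding k_def scale[OF w] by (simp only:)
    qed
    then show "(\<Sum>i<n. 1 / (w - of_real (x n i))^2) = of_real (4 * real n / (\<delta> n)^2) * k n"
      unfolding sum_distrib_left[symmetric] using n d by simp
  qed
  have eq: "Q n * ((G n)^2 - k n * of_real (1 / real n)) - L n * G n + of_real (1 - \<theta> n + 1 / s n) = 0" if n: "n \<ge> 2" for n
  proof -
    define w where "w = complex_of_real (\<epsilon> n) + of_real (\<delta> n / 2) * z"
    have wim: "Im w \<noteq> 0" using z \<delta>[of n] by (simp add: w_def)
    define N where "N = complex_of_nat n"
    define S where "S = complex_of_real (s n)"
    define D where "D = complex_of_real (\<delta> n)"
    have nz: "N \<noteq> 0" "S \<noteq> 0" "D \<noteq> 0" using n s_pos[OF n] \<delta>[of n] by (auto simp: N_def S_def D_def)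
    define A where "A = w * (1 - w)"
    define T where "T = of_real (tb n) - of_real (ta n + tb n) * w"
    define V where "V = of_nat n - 1 + complex_of_real (ta n + tb n)"
    have "w * (1 - w) * ((\<Sum>i<n. 1 / (w - of_real (x n i)))^2 - (\<Sum>i<n. 1 / (w - of_real (x n i))^2))
      + (of_real (tb n) - of_real (ta n + tb n) * w) * (\<Sum>i<n. 1 / (w - of_real (x n i)))
      + of_nat n * (of_nat n - 1 + of_real (ta n + tb n)) = 0"
      by (rule loop_equation[OF crit[OF n] x[OF n] inj[OF n] wim])
    then have "A * ((2 * N / D * G n)^2 - 4 * N / D^2 * k n) + T * (2 * N / D * G n) + N * V = 0"
      unfolding Geq[OF n w_def] A_def T_def V_def N_def D_def by simp
    then have "(A * ((2 * N / D * G n)^2 - 4 * N / D^2 * k n) + T * (2 * N / D * G n) + N * V) / (N * S) = 0" by simp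
    then have e: "A * (4 * (N / S) / D^2) * ((G n)^2 - k n * (1 / N)) - (- (2 / (D * S)) * T) * G n + V / S = 0"
    proof -
      have "(A * ((2 * N / D * G n)^2 - 4 * N / D^2 * k n) + T * (2 * N / D * G n) + N * V) / (N * S)
      = A * (4 * (N / S) / D^2) * ((G n)^2 - k n * (1 / N)) - (- (2 / (D * S)) * T) * G n + V / S"
        using nz by (simp add: power2_eq_square field_simps)
      then show ?thesis using \<open>_ / (N * S) = 0\<close> by (simp only:)
    qed
    have ex: "A * (4 * (N / S) / D^2) = Q n" "- (2 / (D * S)) * T = L n" "V / S = of_real (1 - \<theta> n + 1 / s n)"
      using exact[OF n w_def] by (simp_all add: A_def N_def S_def D_def T_def V_def \<theta>_def)
    have "complex_of_real (1 / real n) = 1 / N" by (simp add: N_def)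
    then show ?thesis using e unfolding ex by (simp only:)
  qed
  have X2: "(X n)^2 = (L n)^2 - 4 * Q n * of_real (1 - \<theta> n + 1 / s n) + 4 * (Q n)^2 * (k n * of_real (1 / real n))" if "n \<ge> 2" for n
  proof -
    have "(X n)^2 = (L n)^2 + 4 * Q n * (Q n * (G n)^2 - L n * G n)"
      by (simp add: X_def power2_eq_square algebra_simps)
    also have "Q n * (G n)^2 - L n * G n = Q n * (k n * of_real (1 / real n)) - of_real (1 - \<theta> n + 1 / s n)"
    proof -
      have "Q n * (G n)^2 - L n * G n - (Q n * (k n * of_real (1 / real n)) - of_real (1 - \<theta> n + 1 / s n)) = 0"
        unfolding eq[OF that, symmetric] by (simp add: algebra_simps)
      then show ?thesis by simp
    qed
    finally show ?thesis by (simp add: power2_eq_square algebra_simps)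
  qed
  \<comment> \<open>Every summand of \<open>k\<close> is at most \<open>1 / (Im z)^2\<close>, so its
    mean is bounded and the factor \<open>1 / n\<close> removes it.\<close>
  have klim: "(\<lambda>n. k n * of_real (1 / real n)) \<longlonglongrightarrow> 0"
  proof (rule Lim_null_comparison)
    show "eventually (\<lambda>n. norm (k n * of_real (1 / real n)) \<le> 1 / (Im z)^2 * (1 / real n)) sequentially"
      using ev2
    proof eventually_elim
      case (elim n)
      have "cmod (\<Sum>i<n. 1 / (z - of_real (2 * (x n i - \<epsilon> n) / \<delta> n))^2) \<le> (\<Sum>i<n. 1 / (Im z)^2)"
      proof (rule sum_norm_le)
        fix i
        have "Im z \<le> cmod (z - of_real (2 * (x n i - \<epsilon> n) / \<delta> n))"
          using abs_Im_le_cmod[of "z - of_real (2 * (x n i - \<epsilon> n) / \<delta> n)"] by simp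
        then show "cmod (1 / (z - of_real (2 * (x n i - \<epsilon> n) / \<delta> n))^2) \<le> 1 / (Im z)^2"
          using z unfolding norm_divide norm_power norm_one by (intro divide_left_mono power_mono mult_pos_pos zero_less_power) auto
      qed
      then have "cmod (k n) \<le> real n * (1 / (Im z)^2) / real n"
        unfolding k_def norm_divide norm_of_nat by (intro divide_right_mono) auto
      then have "cmod (k n) \<le> 1 / (Im z)^2" using elim by simp
      then have "cmod (k n) * (1 / real n) \<le> 1 / (Im z)^2 * (1 / real n)" by (rule mult_right_mono) simp
      then show ?case by (simp add: norm_mult norm_divide)
    qed
    show "(\<lambda>n. 1 / (Im z)^2 * (1 / real n)) \<longlonglongrightarrow> 0"
      using tendsto_mult[OF tendsto_const lim_1_over_n, of "1 / (Im z)^2"] by simp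
  qed
  have "(\<lambda>n. (L n)^2 - 4 * Q n * of_real (1 - \<theta> n + 1 / s n) + 4 * (Q n)^2 * (k n * of_real (1 / real n)))
    \<longlonglongrightarrow> L0^2 - 4 * Q0 * of_real (1 - \<theta>\<^sub>0 + 0) + 4 * Q0^2 * 0"
    by (intro tendsto_add tendsto_diff tendsto_mult tendsto_power tendsto_of_real Llim Qlim \<theta>_lim inverse_s_lim klim tendsto_const)
  moreover have "eventually (\<lambda>n. (L n)^2 - 4 * Q n * of_real (1 - \<theta> n + 1 / s n) + 4 * (Q n)^2 * (k n * of_real (1 / real n)) = (X n)^2) sequentially"
    using ev2 by eventually_elim (simp add: X2)
  ultimately have "(\<lambda>n. (X n)^2) \<longlonglongrightarrow> L0^2 - 4 * Q0 * of_real (1 - \<theta>\<^sub>0 + 0) + 4 * Q0^2 * 0" by (rule Lim_transform_eventually)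
  \<comment> \<open>The discriminant collapses to \<open>(z - a2)^2 - 4 * b2\<close>, using
    \<open>b2 = b1 * (1 - \<theta>\<^sub>0)\<close>.\<close>
  moreover have "L0^2 - 4 * Q0 * of_real (1 - \<theta>\<^sub>0 + 0) + 4 * Q0^2 * 0 = R^2"
  proof -
    have "R^2 = (z - of_real a2)^2 - of_real (4 * b2)" by (simp add: R_def power_mult_distrib)
    also have "4 * b2 = 4 * b1 * (1 - \<theta>\<^sub>0)" using b1 by (simp add: \<theta>\<^sub>0_def)
    also have "z - of_real a2 = u0 - of_real (a2 - a1)" by (simp add: u0_def)
    finally show ?thesis unfolding L0_def Q0_def by (simp add: power2_eq_square algebra_simps)
  qed
  ultimately have X2lim: "(\<lambda>n. (X n)^2) \<longlonglongrightarrow> R^2" by simp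
  \<comment> \<open>The transform contributes at most \<open>- 2 * \<theta> * Im z\<close> and
    \<open>L\<close> at least \<open>(1 - 2 * \<theta>) * Im z\<close>. In the difference
    \<open>\<theta>\<close> cancels, which makes the bound uniform in \<open>n\<close>.\<close>
  have XIm: "eventually (\<lambda>n. Im (X n) \<le> - Im z) sequentially"
    using ev2
  proof eventually_elim
    case (elim n)
    define w where "w = complex_of_real (\<epsilon> n) + of_real (\<delta> n / 2) * z"
    have wim: "Im w = \<delta> n / 2 * Im z" by (simp add: w_def)
    have wpos: "Im w > 0" unfolding wim using z \<delta>[of n] by simp
    have "2 * Q n * G n = of_real (4 * \<theta> n / (\<delta> n * real n)) * (w * (1 - w) * (\<Sum>i<n. 1 / (w - of_real (x n i))))"
      unfolding exact(1)[OF elim w_def, symmetric] Geq(1)[OF elim w_def] using elim \<delta>[of n]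
      by (simp add: power2_eq_square)
    then have "Im (2 * Q n * G n) = 4 * \<theta> n / (\<delta> n * real n) * Im (w * (1 - w) * (\<Sum>i<n. 1 / (w - of_real (x n i))))"
      by (simp only: Im_complex_of_real Re_complex_of_real times_complex.sel mult_zero_left add_0_right)
    also have "\<dots> \<le> 4 * \<theta> n / (\<delta> n * real n) * (- real n * Im w)"
    proof (rule mult_left_mono)
      show "Im (w * (1 - w) * (\<Sum>i<n. 1 / (w - of_real (x n i)))) \<le> - real n * Im w"
        by (rule Im_cauchy_sum_le) (use x[OF elim] wpos in auto)
      show "0 \<le> 4 * \<theta> n / (\<delta> n * real n)" using bounds(1)[OF elim] \<delta>[of n] by simp
    qed
    also have "\<dots> = - 2 * \<theta> n * Im z" unfolding wim using elim \<delta>[of n] by simp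
    finally have 1: "Im (2 * Q n * G n) \<le> - 2 * \<theta> n * Im z" .
    have "Im (L n) = (1 - 2 * \<theta> n) * Im z + 2 * Im z / s n" by (simp add: L_def u_def)
    then have "Im (L n) \<ge> (1 - 2 * \<theta> n) * Im z" using z s_pos[OF elim] by simp
    with 1 show ?case by (simp add: X_def algebra_simps)
  qed
  have "Im R > 0"
    using Re_csqrt_pos[OF csqrt_argument_notin_nonpos[OF b2, of z a2]] z by (simp add: R_def del: csqrt.simps)
  then have Xlim: "X \<longlonglongrightarrow> - R" by (rule tendsto_branch[OF X2lim XIm z])
  have Q0b: "of_real b1 * Q0 = of_real (b1^2) + of_real (b1 * (a2 - a1)) * (z - of_real a1) - of_real (b1 - b2) * (z - of_real a1)^2"
  proof -
    have "b1 * \<theta>\<^sub>0 = b1 - b2" using b1 by (simp add: \<theta>\<^sub>0_def right_diff_distrib)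
    then have "of_real (b1 - b2) = complex_of_real b1 * of_real \<theta>\<^sub>0" by (metis of_real_mult)
    then show ?thesis unfolding Q0_def u0_def[symmetric] by (simp only:) (simp add: power2_eq_square algebra_simps)
  qed
  have Q0: "Q0 \<noteq> 0"
    using jac_stieltjes_denominator_nonzero[OF b1 b2 parameter_bounds(1), of z a2 a1] z unfolding Q0b[symmetric] by auto
  have "(\<lambda>n. (X n + L n) / (2 * Q n)) \<longlonglongrightarrow> (- R + L0) / (2 * Q0)"
    by (intro tendsto_intros Xlim Llim Qlim) (use Q0 in simp)
  moreover have "eventually (\<lambda>n. (X n + L n) / (2 * Q n) = G n) sequentially"
    using tendsto_imp_eventually_ne[OF Qlim Q0] by eventually_elim (simp add: X_def)
  ultimately have "G \<longlonglongrightarrow> (- R + L0) / (2 * Q0)" by (rule Lim_transform_eventually)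
  moreover have "(- R + L0) / (2 * Q0) = jac_stieltjes a1 a2 b1 b2 z"
  proof -
    have b1c: "complex_of_real b1 \<noteq> 0" using b1 by simp
    have "b1 * (1 - 2 * \<theta>\<^sub>0) = 2 * b2 - b1" using b1 by (simp add: \<theta>\<^sub>0_def field_simps)
    then have "of_real (2 * b2 - b1) = complex_of_real b1 * of_real (1 - 2 * \<theta>\<^sub>0)" by (metis of_real_mult)
    then have "of_real (b1 * (a2 - a1)) + of_real (2 * b2 - b1) * (z - of_real a1) - of_real b1 * R = of_real b1 * (- R + L0)"
      unfolding L0_def u0_def by (simp only:) (simp add: algebra_simps)
    then have "jac_stieltjes a1 a2 b1 b2 z = (of_real b1 * (- R + L0)) / (2 * (of_real b1 * Q0))"
      unfolding jac_stieltjes_def Q0b R_def by simp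
    also have "\<dots> = (of_real b1 * (- R + L0)) / (of_real b1 * (2 * Q0))" by (simp only: mult.left_commute)
    also have "\<dots> = (- R + L0) / (2 * Q0)" by (rule mult_divide_mult_cancel_left[OF b1c])
    finally show ?thesis by simp
  qed
  ultimately show ?thesis unfolding G_def by simp
qed

end

section \<open>Almost sure convergence\<close>

text \<open>The mean is invariant under permutations, and each resolvent is Lipschitz in its atom
  with constant \<open>1 / (Im z)^2\<close>. The bound
  \<open>\<bar>d\<bar> \<le> r / 2 + d^2 / (2 * r)\<close> passes from absolute to squared
  distances.\<close>

lemma cauchy_mean_permuted_close:
  assumes n: "n > 0" and s: "\<sigma> permutes {..<n}" and z: "Im z > 0" and r: "r > 0"
    and close: "(\<Sum>i<n. (y i - y' (\<sigma> i))^2) \<le> real n * r^2"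
  shows "cmod (cauchy_mean n y z - cauchy_mean n y' z) \<le> r / (Im z)^2"
proof -
  have perm: "(\<Sum>i<n. 1 / (z - of_real (y' i))) = (\<Sum>i<n. 1 / (z - of_real (y' (\<sigma> i))))"
    using sum.reindex_bij_betw[OF permutes_imp_bij[OF s], of "\<lambda>i. 1 / (z - of_real (y' i))"] by simp
  have im: "Im z \<le> cmod (z - of_real t)" for t
    using abs_Im_le_cmod[of "z - of_real t"] by simp
  have "cmod (1 / (z - of_real (y i)) - 1 / (z - of_real (y' (\<sigma> i)))) \<le> (r / 2 + (y i - y' (\<sigma> i))^2 / (2 * r)) / (Im z)^2" for i
  proof -
    have nz: "z - of_real t \<noteq> 0" for t using z by (auto simp: complex_eq_iff)
    define d where "d = y i - y' (\<sigma> i)"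
    have "1 / (z - of_real (y i)) - 1 / (z - of_real (y' (\<sigma> i))) = of_real d / ((z - of_real (y i)) * (z - of_real (y' (\<sigma> i))))"
      using nz[of "y i"] nz[of "y' (\<sigma> i)"] by (simp add: divide_simps d_def)
    then have "cmod (1 / (z - of_real (y i)) - 1 / (z - of_real (y' (\<sigma> i)))) = \<bar>d\<bar> / (cmod (z - of_real (y i)) * cmod (z - of_real (y' (\<sigma> i))))"
      by (simp add: norm_divide norm_mult)
    also have "\<dots> \<le> \<bar>d\<bar> / (Im z * Im z)"
      using z im by (intro divide_left_mono mult_mono mult_pos_pos) (auto intro: less_le_trans)
    also have "\<dots> \<le> (r / 2 + d^2 / (2 * r)) / (Im z * Im z)"
    proof (rule divide_right_mono)
      have "0 \<le> (r - \<bar>d\<bar>)^2" by simp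
      then have "2 * r * \<bar>d\<bar> \<le> r^2 + d^2" by (simp add: power2_diff)
      then show "\<bar>d\<bar> \<le> r / 2 + d^2 / (2 * r)" using r by (simp add: field_simps power2_eq_square)
    qed simp
    finally show ?thesis by (simp add: d_def power2_eq_square)
  qed
  then have "cmod (\<Sum>i<n. 1 / (z - of_real (y i)) - 1 / (z - of_real (y' (\<sigma> i)))) \<le> (\<Sum>i<n. (r / 2 + (y i - y' (\<sigma> i))^2 / (2 * r)) / (Im z)^2)"
    by (rule sum_norm_le)
  also have "\<dots> = (real n * (r / 2) + (\<Sum>i<n. (y i - y' (\<sigma> i))^2) / (2 * r)) / (Im z)^2"
    by (simp add: sum_divide_distrib[symmetric] sum.distrib)
  also have "\<dots> \<le> (real n * (r / 2) + real n * r^2 / (2 * r)) / (Im z)^2"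
    using r by (intro divide_right_mono add_left_mono close) auto
  also have "real n * (r / 2) + real n * r^2 / (2 * r) = real n * r"
    using r by (simp add: power2_eq_square)
  finally have le: "cmod (\<Sum>i<n. 1 / (z - of_real (y i)) - 1 / (z - of_real (y' (\<sigma> i)))) \<le> real n * r / (Im z)^2" .
  have "cauchy_mean n y z - cauchy_mean n y' z = (\<Sum>i<n. 1 / (z - of_real (y i)) - 1 / (z - of_real (y' (\<sigma> i)))) / of_nat n"
    unfolding cauchy_mean_def perm by (simp add: sum_subtractf diff_divide_distrib)
  then have "cmod (cauchy_mean n y z - cauchy_mean n y' z) = cmod (\<Sum>i<n. 1 / (z - of_real (y i)) - 1 / (z - of_real (y' (\<sigma> i)))) / real n"
    by (simp add: norm_divide)
  also have "\<dots> \<le> (real n * r / (Im z)^2) / real n" using le by (rule divide_right_mono) simp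
  also have "\<dots> = r / (Im z)^2" using n by simp
  finally show ?thesis .
qed

text \<open>For \<open>n \<ge> 2\<close> both \<open>fact n\<close> and \<open>2 ^ n\<close> are at
  most \<open>n ^ n\<close>; the exponent 4 therefore leaves \<open>n\<close> to the power
  \<open>- 2 * n\<close>, at most \<open>1 / n^2\<close>.\<close>

lemma summable_of_le_exp:
  fixes p :: "nat \<Rightarrow> real"
  assumes nonneg: "\<And>n. p n \<ge> 0"
    and le: "eventually (\<lambda>n. p n \<le> fact n * (2 ^ n * exp (- 4 * real n * ln (real n)))) sequentially"
  shows "summable p"
proof (rule summable_comparison_test_ev)
  show "summable (\<lambda>n. inverse (real n ^ 2))" by (rule inverse_power_summable) simp
  show "eventually (\<lambda>n. norm (p n) \<le> inverse (real n ^ 2)) sequentially"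
    using le eventually_ge_at_top[of 2]
  proof eventually_elim
    case (elim n)
    have n: "real n > 0" "real n \<ge> 1" using elim by auto
    have "fact n \<le> real n ^ n" using fact_le_power[of n, where 'a = real] by simp
    moreover have "(2::real) ^ n \<le> real n ^ n" using elim(2) by (intro power_mono) auto
    ultimately have "fact n * 2 ^ n \<le> real n ^ n * real n ^ n" by (intro mult_mono) auto
    also have "\<dots> = exp (2 * real n * ln (real n))"
      using n by (simp add: exp_of_nat_mult[symmetric] exp_add[symmetric] flip: powr_realpow) (simp add: powr_def exp_add[symmetric])
    finally have "fact n * 2 ^ n * exp (- 4 * real n * ln (real n)) \<le> exp (2 * real n * ln (real n)) * exp (- 4 * real n * ln (real n))"
      by (intro mult_right_mono) auto
    also have "\<dots> = exp (- (real n * (2 * ln (real n))))" by (simp add: exp_add[symmetric])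
    also have "\<dots> \<le> exp (- (1 * (2 * ln (real n))))"
      using n by (subst exp_le_cancel_iff) (intro le_imp_neg_le mult_right_mono, auto)
    also have "\<dots> = inverse (real n ^ 2)" using n by (simp add: exp_minus exp_double)
    finally show ?case using elim(1) nonneg[of n] by (simp add: mult.assoc)
  qed
qed

theorem theorem3p2:
  fixes M :: "'w measure"
    and \<Lambda> :: "nat \<Rightarrow> 'w \<Rightarrow> (nat \<Rightarrow> real)"
    and a b \<beta> \<delta> \<epsilon> :: "nat \<Rightarrow> real"
    and a1 a2 b1 b2 :: real
  defines "ta \<equiv> (\<lambda>n. (2 * a n + 2) / \<beta> n)"
      and "tb \<equiv> (\<lambda>n. (2 * b n + 2) / \<beta> n)"
  assumes "prob_space M"
    and "\<And>n. a n > -1" and "\<And>n. b n > -1" and "\<And>n. \<beta> n > 0"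
    and "\<And>n. distributed M (lebesgue_n n) (\<Lambda> n)
                (\<lambda>x. ennreal (jacobi_density n (a n) (b n) (\<beta> n) x))"
    and "\<And>n. \<delta> n > 0"
    and "filterlim (\<lambda>n. (a n + b n) / ln (real n)) at_top sequentially"
    and "filterlim (\<lambda>n. (\<delta> n)^4 * (a n + b n) / ln (real n)) at_top sequentially"
    and "b1 > 0" and "b2 > 0"
    and "(\<lambda>n. ((real n + tb n - 1) / (2 * real n + ta n + tb n - 2) - \<epsilon> n) / \<delta> n)
           \<longlonglongrightarrow> a1 / 2"
    and "(\<lambda>n. ((real n * (real n + ta n - 1) + (real n + tb n - 1) * (real n + ta n + tb n - 2))
              / (2 * real n + ta n + tb n - 2)^2 - \<epsilon> n) / \<delta> n)
           \<longlonglongrightarrow> a2 / 2"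
    and "(\<lambda>n. ((real n + tb n - 1) * (real n + ta n - 1) * real n
              / (2 * real n + ta n + tb n - 2)^3) / (\<delta> n)^2)
           \<longlonglongrightarrow> b1 / 4"
    and "(\<lambda>n. ((real n + tb n - 1) * (real n + ta n - 1) * (real n + ta n + tb n - 2) * real n
              / (2 * real n + ta n + tb n - 2)^4) / (\<delta> n)^2)
           \<longlonglongrightarrow> b2 / 4"
  shows "AE \<omega> in M. \<forall>\<xi>::real.
           (\<lambda>n. empirical_df n (\<Lambda> n \<omega>) (2 * \<delta> n * \<xi> + 2 * (2 * \<epsilon> n - 1)))
             \<longlonglongrightarrow> integral {a2 - 2 * sqrt b2 .. \<xi>} (limit_density a1 a2 b1 b2)"
proof -
  interpret prob_space M by fact
  note a = assms(4) and b = assms(5) and \<beta> = assms(6) and dist = assms(7) and \<delta> = assms(8)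
  have ta: "ta n > 0" and tb: "tb n > 0" for n
    using a[of n] b[of n] \<beta>[of n] by (auto simp: ta_def tb_def)
  interpret jacobi_scaling ta tb \<epsilon> \<delta> a1 a2 b1 b2
    by unfold_locales (use assms ta tb in auto)
  have "\<exists>m. inj_on m {..<n} \<and> (\<forall>i<n. m i \<in> {-2<..<2}) \<and>
      (\<forall>x. (\<forall>i<n. x i \<in> {-2..2}) \<longrightarrow> sym_weight n (a n + 1) (b n + 1) (\<beta> n) x \<le> sym_weight n (a n + 1) (b n + 1) (\<beta> n) m)" for n
    using sym_weight_maximizer[of "a n + 1" "b n + 1" "\<beta> n" n] a[of n] b[of n] \<beta>[of n]
    by (metis add.commute add_strict_left_mono add.right_inverse)
  then obtain m where m: "\<And>n. inj_on (m n) {..<n}" "\<And>n i. i < n \<Longrightarrow> m n i \<in> {-2<..<2}"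
     "\<And>n x. (\<And>i. i < n \<Longrightarrow> x i \<in> {-2..2}) \<Longrightarrow> sym_weight n (a n + 1) (b n + 1) (\<beta> n) x \<le> sym_weight n (a n + 1) (b n + 1) (\<beta> n) (m n)"
    by metis
  \<comment> \<open>Affine coordinates on the unit interval, as in the loop equation and the ratios
    \<open>P\<close> and \<open>\<theta>\<close>.\<close>
  define x where "x n i = (2 + m n i) / 4" for n i
  have crit: "2 * (\<Sum>j\<in>{..<n}-{i}. 1 / (x n i - x n j)) + tb n / x n i - ta n / (1 - x n i) = 0" if i: "i < n" for n i
  proof -
    define S where "S = (\<Sum>j\<in>{..<n}-{i}. 1 / (m n i - m n j))"
    define U where "U = (b n + 1) / (2 + m n i)"
    define V where "V = (a n + 1) / (2 - m n i)"
    have zero: "\<beta> n * S + U - V = 0" unfolding S_def U_def V_def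
    proof -
      show "\<beta> n * (\<Sum>j\<in>{..<n}-{i}. 1 / (m n i - m n j)) + (b n + 1) / (2 + m n i) - (a n + 1) / (2 - m n i) = 0"
      by (rule sym_weight_maximizer_critical[OF _ _ \<beta> m(1) m(2) m(3) i]) (use a[of n] b[of n] in auto)
    qed
    have "1 / (x n i - x n j) = 4 * (1 / (m n i - m n j))" for j
    proof -
      have e: "x n i - x n j = (m n i - m n j) / 4" by (simp add: x_def field_simps)
      show ?thesis unfolding e by simp
    qed
    then have 1: "(\<Sum>j\<in>{..<n}-{i}. 1 / (x n i - x n j)) = 4 * S"
      unfolding S_def by (simp only: sum_distrib_left)
    have 2: "tb n / x n i = 8 / \<beta> n * U"
      unfolding U_def by (simp add: x_def tb_def field_simps)
    have 3: "ta n / (1 - x n i) = 8 / \<beta> n * V"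
    proof -
      have e: "1 - x n i = (2 - m n i) / 4" by (simp add: x_def field_simps)
      show ?thesis unfolding e V_def by (simp add: ta_def field_simps)
    qed
    \<comment> \<open>The critical equation for \<open>x\<close> is the one for \<open>m\<close>
      multiplied by \<open>8 / \<beta> n\<close>: a factor 4 from the affine map and
      \<open>2 / \<beta> n\<close> from \<open>ta\<close> and \<open>tb\<close>.\<close>
    have "2 * (4 * S) + 8 / \<beta> n * U - 8 / \<beta> n * V = 8 / \<beta> n * (\<beta> n * S + U - V)"
      using \<beta>[of n] by (simp only: right_diff_distrib distrib_left) simp
    then show ?thesis unfolding 1 2 3 zero by simp
  qed
  have x01: "0 < x n i \<and> x n i < 1" if "i < n" for n i using m(2)[OF that] by (auto simp: x_def)
  have xinj: "inj_on (x n) {..<n}" for n using m(1)[of n] by (auto simp: x_def inj_on_def)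
  \<comment> \<open>The theorem's scaling
    \<open>(\<lambda> - 2 * (2 * \<epsilon> - 1)) / (2 * \<delta>)\<close>, written for
    \<open>\<lambda> = 4 * x - 2\<close>.\<close>
  define y' where "y' n i = 2 * (x n i - \<epsilon> n) / \<delta> n" for n i
  have ylim: "(\<lambda>n. cauchy_mean n (y' n) z) \<longlonglongrightarrow> jac_stieltjes a1 a2 b1 b2 z" if "Im z > 0" for z
    unfolding y'_def by (rule cauchy_mean_lim) (use crit x01 xinj that in auto)
  \<comment> \<open>The thresholds \<open>1 / (k + 1)\<close> form a countable family of closeness
    levels, so one null set serves all of them.\<close>
  define bad where "bad k n = {l \<in> space (lebesgue_n n). \<forall>\<sigma>\<in>{\<sigma>. \<sigma> permutes {..<n}}.
     1 / (real k + 1) * real n * (\<delta> n)^2 \<le> (\<Sum>i<n. (l i - m n (\<sigma> i))^2)}" for k n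
  define K where "K n = (a n + 1) + (b n + 1) + \<beta> n * (real n - 1)" for n
  have K0: "K n \<ge> 0" if "n \<ge> 1" for n
  proof -
    have "\<beta> n * (real n - 1) \<ge> 0" using \<beta>[of n] that by (intro mult_nonneg_nonneg) auto
    then show ?thesis using a[of n] b[of n] unfolding K_def by linarith
  qed
  have conc: "bad k n \<in> sets (lebesgue_n n)"
    "measure M (\<Lambda> n -` bad k n \<inter> space M) \<le> fact n * (2 ^ n * exp (- K n * (1 / (real k + 1) * real n * (\<delta> n)^2) / 32))"
    if "n \<ge> 1" for k n
    unfolding bad_def
    by (rule jacobi_concentration[OF a b \<beta> m(1) m(2) m(3) dist \<open>prob_space M\<close> K_def K0[OF that]]; assumption)+
  have gap: "eventually (\<lambda>n. 4 * real n * ln (real n) \<le> K n * (1 / (real k + 1) * real n * (\<delta> n)^2) / 32) sequentially" for k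
  proof -
    \<comment> \<open>128 is the rate 4 required for summability times the 32 of the contraction;
      \<open>k + 1\<close> undoes the threshold, and \<open>2 / b1\<close> pays for replacing
      \<open>\<delta>^4\<close> by \<open>\<delta>^2\<close>.\<close>
    define T where "T = 128 * (real k + 1) * (2 / b1)"
    have T: "T > 0" using assms(11) by (simp add: T_def)
    have "eventually (\<lambda>n. (\<delta> n)^4 * (a n + b n) / ln (real n) \<ge> T) sequentially"
      using assms(10) unfolding filterlim_at_top by blast
    then show ?thesis using \<delta>_bounded eventually_ge_at_top[of 2]
    proof eventually_elim
      case (elim n)
      have ln: "ln (real n) > 0" using elim(3) by simp
      have ge: "T * ln (real n) \<le> (\<delta> n)^4 * (a n + b n)" using elim(1) ln by (simp add: field_simps)
      moreover have "T * ln (real n) > 0" using T ln by simp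
      ultimately have "(\<delta> n)^4 * (a n + b n) > 0" by linarith
      then have ab: "a n + b n > 0" using \<delta>[of n] by (simp add: zero_less_mult_iff)
      have Kab: "a n + b n \<le> K n" unfolding K_def using \<beta>[of n] elim(3) by simp
      have "T * ln (real n) \<le> (\<delta> n)^2 * (\<delta> n)^2 * (a n + b n)" using ge by (simp add: power2_eq_square power4_eq_xxxx mult.assoc)
      also have "\<dots> \<le> (2 / b1) * (\<delta> n)^2 * (a n + b n)"
        using elim(2) ab by (intro mult_right_mono) auto
      also have "\<dots> \<le> (2 / b1) * (\<delta> n)^2 * K n"
        using Kab assms(11) by (intro mult_left_mono) auto
      finally have "(2 / b1) * (128 * (real k + 1) * ln (real n)) \<le> (2 / b1) * ((\<delta> n)^2 * K n)"
        unfolding T_def by (simp add: mult_ac)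
      then have "128 * (real k + 1) * ln (real n) \<le> (\<delta> n)^2 * K n"
        using assms(11) by (subst (asm) mult_le_cancel_left_pos) auto
      then have "real n * (128 * (real k + 1) * ln (real n)) \<le> real n * ((\<delta> n)^2 * K n)"
        by (rule mult_left_mono) simp
      then show ?case by (simp add: field_simps)
    qed
  qed
  have AEk: "AE \<omega> in M. eventually (\<lambda>n. \<omega> \<notin> \<Lambda> (Suc n) -` bad k (Suc n)) sequentially" for k
  proof -
    \<comment> \<open>Shifted by one because the concentration bound is available only from
      \<open>n = 1\<close> on: \<open>K 0\<close> can be negative.\<close>
    define A where "A n = \<Lambda> (Suc n) -` bad k (Suc n) \<inter> space M" for n
    have sm: "summable (\<lambda>n. measure M (\<Lambda> n -` bad k n \<inter> space M))"
    proof (rule summable_of_le_exp)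
      show "eventually (\<lambda>n. measure M (\<Lambda> n -` bad k n \<inter> space M) \<le> fact n * (2 ^ n * exp (- 4 * real n * ln (real n)))) sequentially"
        using gap[of k] eventually_ge_at_top[of 1]
      proof eventually_elim
        case (elim n)
        note conc(2)[OF elim(2), of k]
        also have "fact n * (2 ^ n * exp (- K n * (1 / (real k + 1) * real n * (\<delta> n)^2) / 32)) \<le> fact n * (2 ^ n * exp (- 4 * real n * ln (real n)))"
          using elim(1) by (intro mult_left_mono) auto
        finally show ?case .
      qed
    qed simp
    have "AE \<omega> in M. eventually (\<lambda>n. \<omega> \<in> space M - A n) sequentially"
    proof (rule borel_cantelli_AE1)
      show "A n \<in> sets M" for n
        unfolding A_def using conc(1)[of "Suc n" k] distributed_measurable[OF dist] by (intro measurable_sets) auto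
      show "emeasure M (A n) < \<infinity>" for n by (simp add: emeasure_eq_measure)
      show "summable (\<lambda>n. measure M (A n))" unfolding A_def using sm by (subst summable_Suc_iff)
    qed
    then show ?thesis
      by (rule AE_mp) (auto intro!: AE_I2 elim!: eventually_mono simp: A_def)
  qed
  \<comment> \<open>From here on \<open>\<omega>\<close> is fixed, and the exceptional set depends
    neither on \<open>z\<close> nor on \<open>\<xi>\<close>.\<close>
  have "AE \<omega> in M. \<forall>k. eventually (\<lambda>n. \<omega> \<notin> \<Lambda> (Suc n) -` bad k (Suc n)) sequentially"
    using AEk by (simp add: AE_all_countable)
  then show ?thesis
  proof (rule AE_mp, intro AE_I2 impI allI)
    fix \<omega> \<xi>
    assume \<omega>: "\<omega> \<in> space M" and ev: "\<forall>k. eventually (\<lambda>n. \<omega> \<notin> \<Lambda> (Suc n) -` bad k (Suc n)) sequentially"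
    define y where "y n i = (\<Lambda> n \<omega> i - 2 * (2 * \<epsilon> n - 1)) / (2 * \<delta> n)" for n i
    have close: "(\<lambda>n. cauchy_mean n (y n) z - cauchy_mean n (y' n) z) \<longlonglongrightarrow> 0" if z: "Im z > 0" for z
    proof (rule tendstoI)
      fix e :: real assume e: "e > 0"
      \<comment> \<open>Chosen so that the bound \<open>r / (Im z)^2\<close> of
        \<open>cauchy_mean_permuted_close\<close> equals \<open>e / 2\<close>; \<open>k\<close> is
        then taken with threshold below \<open>r^2\<close>.\<close>
      define r where "r = e * (Im z)^2 / 2"
      have r: "r > 0" using e z by (simp add: r_def)
      obtain k where k: "inverse (real (Suc k)) < r^2" using reals_Archimedean[of "r^2"] r by auto
      have "eventually (\<lambda>n. \<omega> \<notin> \<Lambda> n -` bad k n) sequentially"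
        by (rule eventually_sequentially_Suc[THEN iffD1]) (rule ev[rule_format])
      then show "eventually (\<lambda>n. dist (cauchy_mean n (y n) z - cauchy_mean n (y' n) z) 0 < e) sequentially"
        using eventually_ge_at_top[of 1]
      proof eventually_elim
        case (elim n)
        have "\<Lambda> n \<omega> \<in> space (lebesgue_n n)"
          using distributed_measurable[OF dist] \<omega> by (rule measurable_space)
        then obtain \<sigma> where s: "\<sigma> permutes {..<n}" "(\<Sum>i<n. (\<Lambda> n \<omega> i - m n (\<sigma> i))^2) < 1 / (real k + 1) * real n * (\<delta> n)^2"
          using elim(1) unfolding bad_def by (auto simp: not_le)
        have "(\<Sum>i<n. (y n i - y' n (\<sigma> i))^2) = (\<Sum>i<n. (\<Lambda> n \<omega> i - m n (\<sigma> i))^2) / (4 * (\<delta> n)^2)"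
        proof -
          have "y n i - y' n (\<sigma> i) = (\<Lambda> n \<omega> i - m n (\<sigma> i)) / (2 * \<delta> n)" for i
            unfolding y_def y'_def x_def using \<delta>[of n] by (simp add: field_simps)
          then show ?thesis by (simp add: power_divide power_mult_distrib sum_divide_distrib)
        qed
        also have "\<dots> \<le> (1 / (real k + 1) * real n * (\<delta> n)^2) / (4 * (\<delta> n)^2)"
          using s(2) by (intro divide_right_mono) auto
        also have "\<dots> = real n * (inverse (real (Suc k)) / 4)"
        proof -
          have gen: "(1 / v * t * d) / (4 * d) = t * (inverse v / 4)" if "d \<noteq> 0" for v t d :: real
            using that by (cases "v = 0") (simp_all add: field_simps)
          have suc: "real (Suc k) = real k + 1" by simp
          show ?thesis unfolding suc by (rule gen) (use \<delta>[of n] in simp)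
        qed
        also have "\<dots> \<le> real n * r^2"
        proof (rule mult_left_mono)
          have "inverse (real (Suc k)) / 4 \<le> inverse (real (Suc k))" by simp
          then show "inverse (real (Suc k)) / 4 \<le> r^2" using k by linarith
        qed simp
        finally have "cmod (cauchy_mean n (y n) z - cauchy_mean n (y' n) z) \<le> r / (Im z)^2"
          using elim(2) s(1) z r by (intro cauchy_mean_permuted_close[of n \<sigma>]) auto
        also have "\<dots> = e / 2" using z by (simp add: r_def)
        finally show ?case using e by (simp add: dist_norm)
      qed
    qed
    have "(\<lambda>n. cauchy_mean n (y n) z) \<longlonglongrightarrow> jac_stieltjes a1 a2 b1 b2 z" if "Im z > 0" for z
      using tendsto_add[OF close[OF that] ylim[OF that]] by simp
    then have "(\<lambda>n. empirical_df n (y n) \<xi>) \<longlonglongrightarrow> integral {a2 - 2 * sqrt b2 .. \<xi>} (limit_density a1 a2 b1 b2)"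
      by (rule empirical_df_convergence[OF assms(11,12) parameter_bounds])
    moreover have "empirical_df n (y n) \<xi> = empirical_df n (\<Lambda> n \<omega>) (2 * \<delta> n * \<xi> + 2 * (2 * \<epsilon> n - 1))" for n
    proof -
      have "y n i \<le> \<xi> \<longleftrightarrow> \<Lambda> n \<omega> i \<le> 2 * \<delta> n * \<xi> + 2 * (2 * \<epsilon> n - 1)" for i
      proof -
        have "y n i \<le> \<xi> \<longleftrightarrow> \<Lambda> n \<omega> i - 2 * (2 * \<epsilon> n - 1) \<le> \<xi> * (2 * \<delta> n)"
          unfolding y_def using \<delta>[of n] by (intro pos_divide_le_eq) simp
        then show ?thesis by (simp add: algebra_simps)
      qed
      then show ?thesis unfolding empirical_df_def by simp
    qed
    ultimately show "(\<lambda>n. empirical_df n (\<Lambda> n \<omega>) (2 * \<delta> n * \<xi> + 2 * (2 * \<epsilon> n - 1)))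
        \<longlonglongrightarrow> integral {a2 - 2 * sqrt b2 .. \<xi>} (limit_density a1 a2 b1 b2)" by simp
  qed
qed

end
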